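(* Let $u:\mathbb{R}^2\to\mathbb{R}$ be bounded and Lipschitz continuous, and let the payoffs $X_1,\dots,X_K$ of the $K$ arms have finite means $\mu_k$ and finite variances $\sigma_k^2\ge0$. Let $V_n=\sup_{\theta\in\Theta}U_n(\theta)$. Then $V=\lim_{n\to\infty}V_n$ exists and $$V=\sup_{a\in[\mathcal{A}](0,1)}E_P\Big[u\Big(\int_0^1a_s^{(1)}ds,\int_0^1a_s^{(2)}dB_s^{(2)}\Big)\Big]=\sup_{a\in[\mathcal{A}]^{ext}(0,1)}E_P\Big[u\Big(\int_0^1a_s^{(1)}ds,\int_0^1a_s^{(2)}dB_s^{(2)}\Big)\Big].$$
   Context: Setting. $(\Omega,\mathcal{F},P)$ is a probability space on which all random variables are defined. There are $K$ arms. Arm $k$ has random payoff $X_k$ with mean $\mu_k=E_P[X_k]$ and variance $\sigma_k^2=Var_P[X_k]$; $\{X_{k,n}:n\ge1\}$ are i.i.d. copies of $X_k$, and payoffs are independent across arms and across stages. The set of mean-variance pairs is $\mathcal{A}=\{(\mu_k,\sigma_k^2):1\le k\le K\}$, and $\mathcal{A}^{ext}$ is the set of extreme points of the convex hull of $\mathcal{A}$. A strategy $\theta=(\theta_1,\theta_2,\dots)$ is a sequence of $\{1,\dots,K\}$-valued random variables; the reward at stage $n$ is $Z_n^\theta=X_{k,n}$ on $\{\theta_n=k\}$. Let $\mathcal{H}_0^\theta=\{\emptyset,\Omega\}$ and $\mathcal{H}_{n-1}^\theta=\sigma\{Z_1^\theta,\dots,Z_{n-1}^\theta,\theta_1,\dots,\theta_{n-1}\}$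 for $n>1$. $\theta$ is admissible if $\theta_n$ is $\mathcal{H}_{n-1}^\theta$-measurable for all $n\ge1$; $\Theta$ is the set of admissible strategies. For horizon $n$, $$U_n(\theta)=E_P\Big[u\Big(\tfrac1n\sum_{i=1}^nZ_i^\theta,\ \tfrac1{\sqrt n}\sum_{i=1}^n\big(Z_i^\theta-E_P[Z_i^\theta\mid\mathcal{H}_{i-1}^\theta]\big)\Big)\Big].$$ Put $[\mathcal{A}]=\{(\mu,\sigma):\sigma\ge0,\ (\mu,\sigma^2)\in\mathcal{A}\}$ and $[\mathcal{A}]^{ext}=\{(\mu,\sigma):\sigma\ge0,\ (\mu,\sigma^2)\in\mathcal{A}^{ext}\}$. $B_t=(B_t^{(1)},B_t^{(2)})$ is a two-dimensional standard Brownian motion on $(\Omega,\mathcal{F},P)$ with natural filtration $\{\mathcal{F}_t\}$. $[\mathcal{A}](t,T)$ is the set of all $\{\mathcal{F}_s\}$-progressively measurable processes $a=(a^{(1)},a^{(2)}):[t,T]\times\Omega\to[\mathcal{A}]$, and $[\mathcal{A}]^{ext}(t,T)$ is defined in the same way with values in $[\mathcal{A}]^{ext}$. *)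

theory Defs
  imports "HOL-Probability.Probability"
begin

section \<open>Mean-variance pairs of the arms\<close>

definition mean_variance :: "'w measure \<Rightarrow> ('w \<Rightarrow> real) \<Rightarrow> real \<times> real" where
  "mean_variance M Y = (prob_space.expectation M Y, prob_space.variance M Y)"

definition mv_pairs :: "'w measure \<Rightarrow> nat \<Rightarrow> (nat \<Rightarrow> 'w \<Rightarrow> real) \<Rightarrow> (real \<times> real) set" where
  "mv_pairs M K X = (\<lambda>k. mean_variance M (X k)) ` {1..K}"

definition ext_hull :: "(real \<times> real) set \<Rightarrow> (real \<times> real) set" where
  "ext_hull A = {p. p extreme_point_of (convex hull A)}"

text \<open>The passage from pairs (mean, variance) to pairs (mean, standard deviation).\<close>

definition sd_pairs :: "(real \<times> real) set \<Rightarrow> (real \<times> real) set" where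
  "sd_pairs A = {(\<mu>, \<sigma>). \<sigma> \<ge> 0 \<and> (\<mu>, \<sigma>\<^sup>2) \<in> A}"

section \<open>Strategies, rewards and histories\<close>

text \<open>
  Throughout, \<open>X k n\<close> is the payoff of arm \<open>k \<in> {1..K}\<close> at stage \<open>n \<ge> 1\<close>, and \<open>\<theta> n\<close> is the arm
  chosen at stage \<open>n \<ge> 1\<close>; values at index 0 are irrelevant.
\<close>

definition reward :: "(nat \<Rightarrow> nat \<Rightarrow> 'w \<Rightarrow> real) \<Rightarrow> (nat \<Rightarrow> 'w \<Rightarrow> nat) \<Rightarrow> nat \<Rightarrow> 'w \<Rightarrow> real" where
  "reward X \<theta> n \<omega> = X (\<theta> n \<omega>) n \<omega>"

text \<open>
  \<open>history M X \<theta> n\<close> is the \<open>\<sigma>\<close>-algebra generated by the rewards and choices of stages \<open>1, \<dots>, n\<close>.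
  For \<open>n = 0\<close> the set of generators is empty, so the \<open>\<sigma>\<close>-algebra is trivial.
\<close>

definition history ::
    "'w measure \<Rightarrow> (nat \<Rightarrow> nat \<Rightarrow> 'w \<Rightarrow> real) \<Rightarrow> (nat \<Rightarrow> 'w \<Rightarrow> nat) \<Rightarrow> nat \<Rightarrow> 'w measure" where
  "history M X \<theta> n = sigma (space M)
     ({reward X \<theta> i -` S \<inter> space M | i S. i \<in> {1..n} \<and> S \<in> sets borel} \<union>
      {\<theta> i -` S \<inter> space M | i S. i \<in> {1..n} \<and> S \<in> sets (count_space UNIV)})"

definition strategies ::
    "'w measure \<Rightarrow> nat \<Rightarrow> (nat \<Rightarrow> nat \<Rightarrow> 'w \<Rightarrow> real) \<Rightarrow> (nat \<Rightarrow> 'w \<Rightarrow> nat) set" where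
  "strategies M K X =
     {\<theta>. \<forall>n\<ge>1. \<theta> n \<in> measurable M (count_space {1..K}) \<and>
               \<theta> n \<in> measurable (history M X \<theta> (n - 1)) (count_space {1..K})}"

definition horizon_utility ::
    "'w measure \<Rightarrow> (nat \<Rightarrow> nat \<Rightarrow> 'w \<Rightarrow> real) \<Rightarrow> (real \<times> real \<Rightarrow> real) \<Rightarrow> nat \<Rightarrow>
     (nat \<Rightarrow> 'w \<Rightarrow> nat) \<Rightarrow> real" where
  "horizon_utility M X u n \<theta> =
     prob_space.expectation M (\<lambda>\<omega>. u
       ((1 / real n) * (\<Sum>i=1..n. reward X \<theta> i \<omega>),
        (1 / sqrt (real n)) *
          (\<Sum>i=1..n. reward X \<theta> i \<omega> -
                      real_cond_exp M (history M X \<theta> (i - 1)) (reward X \<theta> i) \<omega>)))"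

definition horizon_value ::
    "'w measure \<Rightarrow> nat \<Rightarrow> (nat \<Rightarrow> nat \<Rightarrow> 'w \<Rightarrow> real) \<Rightarrow> (real \<times> real \<Rightarrow> real) \<Rightarrow> nat \<Rightarrow> real" where
  "horizon_value M K X u n = (SUP \<theta>\<in>strategies M K X. horizon_utility M X u n \<theta>)"

section \<open>Two-dimensional Brownian motion and its filtration\<close>

definition brownian_motion_2d :: "'w measure \<Rightarrow> (real \<Rightarrow> 'w \<Rightarrow> real \<times> real) \<Rightarrow> bool" where
  "brownian_motion_2d M B \<longleftrightarrow>
     (\<forall>t\<ge>0. B t \<in> borel_measurable M) \<and>
     (AE \<omega> in M. B 0 \<omega> = 0) \<and>
     (AE \<omega> in M. continuous_on {0..} (\<lambda>t. B t \<omega>)) \<and>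
     (\<forall>n (t :: nat \<Rightarrow> real). 0 \<le> t 0 \<longrightarrow> (\<forall>i<n. t i < t (Suc i)) \<longrightarrow>
        prob_space.indep_vars M (\<lambda>_. borel) (\<lambda>i \<omega>. B (t (Suc i)) \<omega> - B (t i) \<omega>) {..<n}) \<and>
     (\<forall>s t. 0 \<le> s \<longrightarrow> s < t \<longrightarrow>
        distributed M lborel (\<lambda>\<omega>. B t \<omega> - B s \<omega>)
          (\<lambda>(x, y). ennreal (normal_density 0 (sqrt (t - s)) x * normal_density 0 (sqrt (t - s)) y)))"

text \<open>The raw (not completed) filtration generated by a process.\<close>

definition natural_filtration ::
    "'w measure \<Rightarrow> (real \<Rightarrow> 'w \<Rightarrow> 'b::topological_space) \<Rightarrow> real \<Rightarrow> 'w measure" where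
  "natural_filtration M B t =
     sigma (space M) {B s -` S \<inter> space M | s S. s \<in> {0..t} \<and> S \<in> sets borel}"

section \<open>Progressively measurable controls\<close>

definition progressively_measurable ::
    "(real \<Rightarrow> 'w measure) \<Rightarrow> real \<Rightarrow> real \<Rightarrow> (real \<Rightarrow> 'w \<Rightarrow> 'b::topological_space) \<Rightarrow> bool" where
  "progressively_measurable F t T a \<longleftrightarrow>
     (\<forall>s\<in>{t..T}. (\<lambda>(r, \<omega>). a r \<omega>) \<in> borel_measurable (restrict_space borel {t..s} \<Otimes>\<^sub>M F s))"

text \<open>Only the values on \<open>{t..T} \<times> space M\<close> of a process matter.\<close>

definition controls ::
    "'w measure \<Rightarrow> (real \<Rightarrow> 'w measure) \<Rightarrow> (real \<times> real) set \<Rightarrow> real \<Rightarrow> real \<Rightarrow>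
     (real \<Rightarrow> 'w \<Rightarrow> real \<times> real) set" where
  "controls M F S t T =
     {a. progressively_measurable F t T a \<and> (\<forall>s\<in>{t..T}. \<forall>\<omega>\<in>space M. a s \<omega> \<in> S)}"

section \<open>The Ito integral\<close>

text \<open>
  A triple \<open>m\<close>, \<open>\<tau>\<close>, \<open>\<xi>\<close> encodes the simple process with value \<open>\<xi> i\<close> on \<open>{\<tau> i<..\<tau> (Suc i)}\<close>, \<open>i < m\<close>.
  Integrals of general integrands are \<open>L\<^sup>2(M)\<close>-limits of integrals of simple processes that converge to
  the integrand in \<open>L\<^sup>2(ds \<otimes> M)\<close>. Such a limit is determined only up to null sets, so
  \<open>ito_integral\<close> selects a version.
\<close>

definition simple_integrand ::
    "'w measure \<Rightarrow> (real \<Rightarrow> 'w measure) \<Rightarrow> real \<Rightarrow> real \<Rightarrow>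
     nat \<Rightarrow> (nat \<Rightarrow> real) \<Rightarrow> (nat \<Rightarrow> 'w \<Rightarrow> real) \<Rightarrow> bool" where
  "simple_integrand M F t T m \<tau> \<xi> \<longleftrightarrow>
     \<tau> 0 = t \<and> \<tau> m = T \<and> (\<forall>i<m. \<tau> i < \<tau> (Suc i)) \<and>
     (\<forall>i<m. \<xi> i \<in> borel_measurable (F (\<tau> i))) \<and>
     (\<exists>C. \<forall>i<m. \<forall>\<omega>\<in>space M. \<bar>\<xi> i \<omega>\<bar> \<le> C)"

definition simple_process ::
    "nat \<Rightarrow> (nat \<Rightarrow> real) \<Rightarrow> (nat \<Rightarrow> 'w \<Rightarrow> real) \<Rightarrow> real \<Rightarrow> 'w \<Rightarrow> real" where
  "simple_process m \<tau> \<xi> s \<omega> = (\<Sum>i<m. \<xi> i \<omega> * indicator {\<tau> i<..\<tau> (Suc i)} s)"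

definition simple_ito_integral ::
    "(real \<Rightarrow> 'w \<Rightarrow> real) \<Rightarrow> nat \<Rightarrow> (nat \<Rightarrow> real) \<Rightarrow> (nat \<Rightarrow> 'w \<Rightarrow> real) \<Rightarrow> 'w \<Rightarrow> real" where
  "simple_ito_integral W m \<tau> \<xi> \<omega> = (\<Sum>i<m. \<xi> i \<omega> * (W (\<tau> (Suc i)) \<omega> - W (\<tau> i) \<omega>))"

definition has_ito_integral ::
    "'w measure \<Rightarrow> (real \<Rightarrow> 'w measure) \<Rightarrow> (real \<Rightarrow> 'w \<Rightarrow> real) \<Rightarrow> real \<Rightarrow> real \<Rightarrow>
     (real \<Rightarrow> 'w \<Rightarrow> real) \<Rightarrow> ('w \<Rightarrow> real) \<Rightarrow> bool" where
  "has_ito_integral M F W t T f I \<longleftrightarrow>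
     I \<in> borel_measurable M \<and>
     (\<exists>(m :: nat \<Rightarrow> nat) (\<tau> :: nat \<Rightarrow> nat \<Rightarrow> real) (\<xi> :: nat \<Rightarrow> nat \<Rightarrow> 'w \<Rightarrow> real).
        (\<forall>j. simple_integrand M F t T (m j) (\<tau> j) (\<xi> j)) \<and>
        ((\<lambda>j. \<integral>\<^sup>+\<omega>. (\<integral>\<^sup>+s\<in>{t..T}.
              ennreal ((simple_process (m j) (\<tau> j) (\<xi> j) s \<omega> - f s \<omega>)\<^sup>2) \<partial>lborel) \<partial>M)
           \<longlonglongrightarrow> 0) \<and>
        ((\<lambda>j. \<integral>\<^sup>+\<omega>. ennreal ((simple_ito_integral W (m j) (\<tau> j) (\<xi> j) \<omega> - I \<omega>)\<^sup>2) \<partial>M)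
           \<longlonglongrightarrow> 0))"

definition ito_integral ::
    "'w measure \<Rightarrow> (real \<Rightarrow> 'w measure) \<Rightarrow> (real \<Rightarrow> 'w \<Rightarrow> real) \<Rightarrow> real \<Rightarrow> real \<Rightarrow>
     (real \<Rightarrow> 'w \<Rightarrow> real) \<Rightarrow> 'w \<Rightarrow> real" where
  "ito_integral M F W t T f = (SOME I. has_ito_integral M F W t T f I)"

text \<open>
  The filtration is the one generated by both components of \<open>B\<close>, while only the second component
  is the integrator.
\<close>

definition control_utility ::
    "'w measure \<Rightarrow> (real \<Rightarrow> 'w \<Rightarrow> real \<times> real) \<Rightarrow> (real \<times> real \<Rightarrow> real) \<Rightarrow>
     (real \<Rightarrow> 'w \<Rightarrow> real \<times> real) \<Rightarrow> real" where
  "control_utility M B u a =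
     prob_space.expectation M (\<lambda>\<omega>. u
       (LINT s:{0..1}|lborel. fst (a s \<omega>),
        ito_integral M (natural_filtration M B) (\<lambda>s \<omega>. snd (B s \<omega>)) 0 1 (\<lambda>s \<omega>. snd (a s \<omega>)) \<omega>))"

end

theory Submission
  imports Defs
begin

text \<open>
  Both the bandit problem and the control problem restricted to piecewise constant controls are solved
  by iterating operators \<open>f \<mapsto> max\<^sub>k E f(\<cdot> + step k)\<close>. Such an operator is a supremum of averages and
  commutes with translations, so mollifying its iterates yields supersolutions: a supremum of averages
  is at most the average of the suprema. The mollified iterates are smooth enough for a Taylor expansion
  in which a step enters only through \<open>\<mu> \<partial>\<^sub>1 + \<sigma>\<^sup>2/2 \<partial>\<^sub>2\<^sub>2\<close>. This expression is linear in the pair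
  \<open>(\<mu>, \<sigma>\<^sup>2)\<close>, so the values of two such problems can be compared as soon as the pairs of one lie in the
  convex hull of the pairs of the other. Applied to arms, Gaussian steps for all pairs, and Gaussian
  steps for extreme pairs, this shows that the three values differ by \<open>o(1)\<close>; no regularity theory for
  the Hamilton-Jacobi-Bellman equation is needed.

  A general control takes finitely many values. On each slot of a uniform grid it is replaced by the
  value which it took for the longest time during the previous slot. These replacements are adapted, piecewise
  constant, have values in the same finite set, and converge to the control in measure; the Ito isometry
  transfers the convergence to the utilities.
\<close>

section \<open>Sublinear averaging operators\<close>

text \<open>Variances may vanish, so the limiting equation is degenerate and smooth solutions cannot
  be expected; hence the functions that are expanded are mollified iterates of the discrete problem
  itself. The mollification width is fixed by the tolerance before \<open>n\<close> grows, so the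
  derivative bounds may blow up with it: all iterates share the bound and the Lipschitz constant of
  \<open>u\<close>, and \<open>n\<close> Taylor errors of order o(1/n) sum to o(1). Mollifying
  yields supersolutions only, hence one-sided comparisons; the reverse inequality comes from
  exchanging the two problems, which is possible because all pairs and the extreme pairs have the
  same hull. The limit exists by a squeeze and not by a Cauchy argument. For Gaussian steps the
  iterated operator at 0 is the utility of some piecewise constant control, so it stays below the
  control value for every \<open>n\<close>; conversely, each fixed control is eventually below it up
  to any tolerance. The supremum in the middle does not depend on \<open>n\<close>. A replacement
  that reads the current slot would anticipate the future; reading the previous one is adapted, and
  the price is a convergence statement for lagged time fractions.\<close>

definition bounded_lipschitz :: "real \<Rightarrow> real \<Rightarrow> ('a::real_normed_vector \<Rightarrow> real) \<Rightarrow> bool" where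
  "bounded_lipschitz C L f \<longleftrightarrow> (\<forall>s. \<bar>f s\<bar> \<le> C) \<and> (\<forall>s t. \<bar>f s - f t\<bar> \<le> L * norm (s - t))"

definition borel_prob :: "'a::topological_space measure \<Rightarrow> bool" where
  "borel_prob \<kappa> \<longleftrightarrow> prob_space \<kappa> \<and> sets \<kappa> = sets borel"

text \<open>Steps of a walk and mollifiers are both integrals over translates, which is why they
  commute with each other.\<close>

definition average :: "'a measure \<Rightarrow> ('a \<Rightarrow> real) \<Rightarrow> 'a::real_normed_vector \<Rightarrow> real" where
  "average \<kappa> f s = (\<integral>v. f (s + v) \<partial>\<kappa>)"

definition bellman ::
    "'k set \<Rightarrow> ('k \<Rightarrow> 'a measure) \<Rightarrow> ('a \<Rightarrow> real) \<Rightarrow> 'a::real_normed_vector \<Rightarrow> real" where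
  "bellman J \<nu> f s = Max ((\<lambda>k. average (\<nu> k) f s) ` J)"

lemma bounded_lipschitzD:
  assumes "bounded_lipschitz C L f"
  shows "\<bar>f s\<bar> \<le> C" "\<bar>f s - f t\<bar> \<le> L * norm (s - t)"
  using assms unfolding bounded_lipschitz_def by blast+

lemma bounded_lipschitz_nonneg: "bounded_lipschitz C L f \<Longrightarrow> 0 \<le> C"
  using bounded_lipschitzD(1)[of C L f 0] by linarith

lemma bounded_lipschitz_continuous:
  assumes f: "bounded_lipschitz C L f"
  shows "continuous_on UNIV f"
proof -
  have "(max L 0)-lipschitz_on UNIV f"
  proof (rule lipschitz_onI)
    fix x y
    have "\<bar>f x - f y\<bar> \<le> L * norm (x - y)"
      using bounded_lipschitzD(2)[OF f] .
    also have "\<dots> \<le> max L 0 * norm (x - y)" by (intro mult_right_mono) auto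
    finally show "dist (f x) (f y) \<le> max L 0 * dist x y" by (simp add: dist_norm)
  qed auto
  then show ?thesis by (rule lipschitz_on_continuous_on)
qed

lemma bounded_lipschitz_measurable:
  "bounded_lipschitz C L f \<Longrightarrow> f \<in> borel_measurable borel"
  by (rule borel_measurable_continuous_onI[OF bounded_lipschitz_continuous])

lemma borel_probD:
  assumes "borel_prob \<kappa>"
  shows "prob_space \<kappa>" "sets \<kappa> = sets borel" "space \<kappa> = UNIV"
  using assms sets_eq_imp_space_eq[of \<kappa> borel] unfolding borel_prob_def by auto

lemma borel_prob_distr:
  assumes "prob_space M" "f \<in> borel_measurable M"
  shows "borel_prob (distr M borel f)"
  using prob_space.prob_space_distr[OF assms] by (simp add: borel_prob_def)

lemma average_integrable:
  fixes f :: "'a::{real_normed_vector, second_countable_topology} \<Rightarrow> real"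
  assumes f: "bounded_lipschitz C L f" and \<kappa>: "borel_prob \<kappa>"
  shows "integrable \<kappa> (\<lambda>v. f (s + v))"
proof -
  interpret prob_space \<kappa> by (rule borel_probD(1)[OF \<kappa>])
  note [measurable] = bounded_lipschitz_measurable[OF f]
  note [measurable_cong] = borel_probD(2)[OF \<kappa>]
  show ?thesis
    by (rule integrable_const_bound[where B=C]) (use bounded_lipschitzD(1)[OF f] in auto)
qed

lemma bounded_lipschitz_average:
  fixes f :: "'a::{real_normed_vector, second_countable_topology} \<Rightarrow> real"
  assumes f: "bounded_lipschitz C L f" and \<kappa>: "borel_prob \<kappa>"
  shows "bounded_lipschitz C L (average \<kappa> f)"
proof -
  interpret prob_space \<kappa> by (rule borel_probD(1)[OF \<kappa>])
  note I = average_integrable[OF f \<kappa>]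
  have "\<bar>average \<kappa> f s\<bar> \<le> C" for s
  proof -
    have "\<bar>average \<kappa> f s\<bar> \<le> (\<integral>v. \<bar>f (s + v)\<bar> \<partial>\<kappa>)"
      unfolding average_def by (rule integral_abs_bound)
    also have "\<dots> \<le> (\<integral>v. C \<partial>\<kappa>)"
      by (rule integral_mono) (use I bounded_lipschitzD(1)[OF f] in auto)
    finally show ?thesis by (simp add: prob_space)
  qed
  moreover have "\<bar>average \<kappa> f s - average \<kappa> f t\<bar> \<le> L * norm (s - t)" for s t
  proof -
    have "average \<kappa> f s - average \<kappa> f t = (\<integral>v. f (s + v) - f (t + v) \<partial>\<kappa>)"
      unfolding average_def using I by simp
    also have "\<bar>\<dots>\<bar> \<le> (\<integral>v. \<bar>f (s + v) - f (t + v)\<bar> \<partial>\<kappa>)"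
      by (rule integral_abs_bound)
    also have "\<dots> \<le> (\<integral>v. L * norm (s - t) \<partial>\<kappa>)"
    proof (rule integral_mono)
      show "\<bar>f (s + v) - f (t + v)\<bar> \<le> L * norm (s - t)" for v
        using bounded_lipschitzD(2)[OF f, of "s + v" "t + v"] by simp
    qed (use I in auto)
    finally show ?thesis by (simp add: prob_space)
  qed
  ultimately show ?thesis unfolding bounded_lipschitz_def by blast
qed

text \<open>The additive constant carries errors accumulated in earlier steps through an average
  unchanged, since the total mass is one.\<close>

lemma average_mono_add:
  fixes f g :: "'a::{real_normed_vector, second_countable_topology} \<Rightarrow> real"
  assumes f: "bounded_lipschitz C L f" and g: "bounded_lipschitz C' L' g" and \<kappa>: "borel_prob \<kappa>"
    and le: "\<And>s. f s \<le> g s + c"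
  shows "average \<kappa> f s \<le> average \<kappa> g s + c"
proof -
  interpret prob_space \<kappa> by (rule borel_probD(1)[OF \<kappa>])
  have "average \<kappa> f s \<le> (\<integral>v. g (s + v) + c \<partial>\<kappa>)"
    unfolding average_def
    by (rule integral_mono) (use average_integrable[OF f \<kappa>] average_integrable[OF g \<kappa>] le in auto)
  also have "\<dots> = average \<kappa> g s + c"
    unfolding average_def using average_integrable[OF g \<kappa>] by (simp add: prob_space)
  finally show ?thesis .
qed

lemma average_near:
  fixes f :: "'a::{real_normed_vector, second_countable_topology} \<Rightarrow> real"
  assumes f: "bounded_lipschitz C L f" and \<kappa>: "borel_prob \<kappa>"
    and near: "AE v in \<kappa>. norm v \<le> \<epsilon>" and "0 \<le> L"
  shows "\<bar>average \<kappa> f s - f s\<bar> \<le> L * \<epsilon>"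
proof -
  interpret prob_space \<kappa> by (rule borel_probD(1)[OF \<kappa>])
  note I = average_integrable[OF f \<kappa>]
  have "average \<kappa> f s - f s = (\<integral>v. f (s + v) - f s \<partial>\<kappa>)"
    unfolding average_def using I by (simp add: prob_space)
  also have "\<bar>\<dots>\<bar> \<le> (\<integral>v. \<bar>f (s + v) - f s\<bar> \<partial>\<kappa>)"
    by (rule integral_abs_bound)
  also have "\<dots> \<le> (\<integral>v. L * \<epsilon> \<partial>\<kappa>)"
  proof (rule integral_mono_AE)
    show "AE v in \<kappa>. \<bar>f (s + v) - f s\<bar> \<le> L * \<epsilon>"
      using near
    proof eventually_elim
      case (elim v)
      have "\<bar>f (s + v) - f s\<bar> \<le> L * norm v"
        using bounded_lipschitzD(2)[OF f, of "s + v" s] by simp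
      also have "\<dots> \<le> L * \<epsilon>" using elim \<open>0 \<le> L\<close> by (rule mult_left_mono)
      finally show ?case .
    qed
  qed (use I in auto)
  finally show ?thesis by (simp add: prob_space)
qed

text \<open>Both sides are the integral of \<open>f (s + v + w)\<close> over the product measure;
  boundedness of \<open>f\<close> permits Fubini.\<close>

lemma average_commute:
  fixes f :: "'a::{real_normed_vector, second_countable_topology} \<Rightarrow> real"
  assumes f: "bounded_lipschitz C L f" and \<kappa>: "borel_prob \<kappa>" and \<nu>: "borel_prob \<nu>"
  shows "average \<kappa> (average \<nu> f) s = average \<nu> (average \<kappa> f) s"
proof -
  interpret K: prob_space \<kappa> by (rule borel_probD(1)[OF \<kappa>])
  interpret N: prob_space \<nu> by (rule borel_probD(1)[OF \<nu>])
  interpret P: pair_prob_space \<kappa> \<nu> ..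
  note [measurable] = bounded_lipschitz_measurable[OF f]
  note [measurable_cong] = borel_probD(2)[OF \<kappa>] borel_probD(2)[OF \<nu>]
  have "integrable (\<kappa> \<Otimes>\<^sub>M \<nu>) (\<lambda>(v, w). f (s + v + w))"
    by (rule P.P.integrable_const_bound[where B=C]) (use bounded_lipschitzD(1)[OF f] in auto)
  from P.Fubini_integral[OF this] show ?thesis
    unfolding average_def by (simp add: add_ac)
qed

locale control_family =
  fixes J :: "'k set" and \<nu> :: "'k \<Rightarrow> 'a::{real_normed_vector, second_countable_topology} measure"
  assumes finite_J: "finite J" and nonempty_J: "J \<noteq> {}"
    and borel_prob_\<nu>: "\<And>k. k \<in> J \<Longrightarrow> borel_prob (\<nu> k)"
begin

lemma bellman_attained: "\<exists>k\<in>J. bellman J \<nu> f s = average (\<nu> k) f s"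
proof -
  have "bellman J \<nu> f s \<in> (\<lambda>k. average (\<nu> k) f s) ` J"
    unfolding bellman_def by (rule Max_in) (use finite_J nonempty_J in auto)
  then show ?thesis by blast
qed

lemma bellman_ge: "k \<in> J \<Longrightarrow> average (\<nu> k) f s \<le> bellman J \<nu> f s"
  unfolding bellman_def using finite_J by auto

lemma bellman_mono_add:
  assumes f: "bounded_lipschitz C L f" and g: "bounded_lipschitz C' L' g"
    and le: "\<And>s. f s \<le> g s + c"
  shows "bellman J \<nu> f s \<le> bellman J \<nu> g s + c"
proof -
  obtain k where k: "k \<in> J" "bellman J \<nu> f s = average (\<nu> k) f s"
    using bellman_attained by blast
  show ?thesis
    using average_mono_add[OF f g borel_prob_\<nu>[OF k(1)] le, of s]
      bellman_ge[OF k(1), of g s] k(2) by simp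
qed

text \<open>A maximum of functions with common bounds keeps these bounds. Because \<open>C\<close>
  and \<open>L\<close> do not deteriorate, a single Taylor constant serves all iterates.\<close>

lemma bounded_lipschitz_bellman:
  assumes f: "bounded_lipschitz C L f"
  shows "bounded_lipschitz C L (bellman J \<nu> f)"
proof -
  have A: "bounded_lipschitz C L (average (\<nu> k) f)" if "k \<in> J" for k
    using bounded_lipschitz_average[OF f borel_prob_\<nu>[OF that]] .
  have "\<bar>bellman J \<nu> f s\<bar> \<le> C" for s
    using bellman_attained[of f s] bounded_lipschitzD(1)[OF A] by metis
  moreover have "bellman J \<nu> f s - bellman J \<nu> f t \<le> L * norm (s - t)" for s t
  proof -
    obtain k where k: "k \<in> J" "bellman J \<nu> f s = average (\<nu> k) f s"
      using bellman_attained by blast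
    show ?thesis
      using bounded_lipschitzD(2)[OF A[OF k(1)], of s t] bellman_ge[OF k(1), of f t] k(2) by linarith
  qed
  then have "\<bar>bellman J \<nu> f s - bellman J \<nu> f t\<bar> \<le> L * norm (s - t)" for s t
    by (metis abs_le_iff minus_diff_eq norm_minus_commute)
  ultimately show ?thesis unfolding bounded_lipschitz_def by blast
qed

lemma bounded_lipschitz_bellman_funpow:
  "bounded_lipschitz C L f \<Longrightarrow> bounded_lipschitz C L ((bellman J \<nu> ^^ i) f)"
  by (induction i) (auto intro: bounded_lipschitz_bellman)

text \<open>On the left one index, optimal for the averaged function, is used for all translates; on
  the right the index may be chosen anew for each translate.\<close>

lemma bellman_average_le:
  assumes f: "bounded_lipschitz C L f" and \<kappa>: "borel_prob \<kappa>"
  shows "bellman J \<nu> (average \<kappa> f) s \<le> average \<kappa> (bellman J \<nu> f) s"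
proof -
  obtain k where k: "k \<in> J" "bellman J \<nu> (average \<kappa> f) s = average (\<nu> k) (average \<kappa> f) s"
    using bellman_attained by blast
  note \<nu> = borel_prob_\<nu>[OF k(1)]
  have "average (\<nu> k) (average \<kappa> f) s = average \<kappa> (average (\<nu> k) f) s"
    by (rule average_commute[OF f \<nu> \<kappa>])
  also have "\<dots> \<le> average \<kappa> (bellman J \<nu> f) s"
    using average_mono_add[OF bounded_lipschitz_average[OF f \<nu>] bounded_lipschitz_bellman[OF f] \<kappa>,
        where c=0 and s=s] bellman_ge[OF k(1), of f] by simp
  finally show ?thesis using k(2) by simp
qed

end

section \<open>Smoothing and Taylor expansion\<close>

text \<open>The uniform law on the segment from \<open>- \<epsilon> e\<close> to
  \<open>\<epsilon> e\<close>. Averaging against it gains one derivative along \<open>e\<close>, and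
  this derivative is a difference quotient of the original function, so it is again
  Lipschitz.\<close>

definition segment_law :: "real \<Rightarrow> 'a::{real_normed_vector} \<Rightarrow> 'a measure" where
  "segment_law \<epsilon> e = distr (uniform_measure lborel {-\<epsilon>..\<epsilon>}) borel (\<lambda>t. t *\<^sub>R e)"

lemma prob_space_uniform_interval:
  "0 < \<epsilon> \<Longrightarrow> prob_space (uniform_measure lborel {-\<epsilon>..\<epsilon>::real})"
  by (rule prob_space_uniform_measure) auto

lemma integral_uniform_interval:
  fixes f :: "real \<Rightarrow> real"
  assumes "0 < \<epsilon>" and [measurable]: "f \<in> borel_measurable borel"
  shows "(\<integral>t. f t \<partial>uniform_measure lborel {-\<epsilon>..\<epsilon>})
    = (\<integral>t. f t * indicator {-\<epsilon>..\<epsilon>} t \<partial>lborel) / (2 * \<epsilon>)"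
proof -
  have "uniform_measure lborel {-\<epsilon>..\<epsilon>}
      = density lborel (\<lambda>t. ennreal (indicator {-\<epsilon>..\<epsilon>} t / (2 * \<epsilon>)))"
    unfolding uniform_measure_def
  proof (rule density_cong)
    show "AE t in lborel. indicator {-\<epsilon>..\<epsilon>} t / emeasure lborel {-\<epsilon>..\<epsilon>}
        = ennreal (indicator {-\<epsilon>..\<epsilon>} t / (2 * \<epsilon>))"
    proof (rule AE_I2)
      fix t :: real
      show "indicator {-\<epsilon>..\<epsilon>} t / emeasure lborel {-\<epsilon>..\<epsilon>}
          = ennreal (indicator {-\<epsilon>..\<epsilon>} t / (2 * \<epsilon>))"
        using \<open>0 < \<epsilon>\<close> divide_ennreal[of 1 "2 * \<epsilon>"] by (cases "t \<in> {-\<epsilon>..\<epsilon>}") auto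
    qed
  qed auto
  then have "(\<integral>t. f t \<partial>uniform_measure lborel {-\<epsilon>..\<epsilon>})
      = (\<integral>t. (indicator {-\<epsilon>..\<epsilon>} t / (2 * \<epsilon>)) *\<^sub>R f t \<partial>lborel)"
    by (simp only:) (rule integral_density, use \<open>0 < \<epsilon>\<close> in auto)
  also have "\<dots> = (\<integral>t. (f t * indicator {-\<epsilon>..\<epsilon>} t) / (2 * \<epsilon>) \<partial>lborel)"
    by (rule Bochner_Integration.integral_cong) auto
  finally show ?thesis by simp
qed

lemma borel_prob_segment_law:
  fixes e :: "'a::{real_normed_vector, second_countable_topology}"
  assumes "0 < \<epsilon>"
  shows "borel_prob (segment_law \<epsilon> e)"
  unfolding segment_law_def
  by (rule borel_prob_distr[OF prob_space_uniform_interval[OF assms]]) measurable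

lemma segment_law_near:
  fixes e :: "'a::{real_normed_vector, second_countable_topology}"
  assumes "0 < \<epsilon>" "norm e = 1"
  shows "AE v in segment_law \<epsilon> e. norm v \<le> \<epsilon>"
proof -
  have "AE t in uniform_measure lborel {-\<epsilon>..\<epsilon>}. norm (t *\<^sub>R e) \<le> \<epsilon>"
    by (rule AE_uniform_measureI) (use assms in auto)
  then show ?thesis
    unfolding segment_law_def by (subst AE_distr_iff) auto
qed

text \<open>Along \<open>e\<close> the average equals
  \<open>(G (r + \<epsilon>) - G (r - \<epsilon>)) / (2 * \<epsilon>)\<close> for an antiderivative
  \<open>G\<close> of \<open>f\<close> on that line, so continuity of \<open>f\<close> suffices for
  differentiability.\<close>

lemma average_segment_law_derivative:
  fixes f :: "'a::{real_normed_vector, second_countable_topology} \<Rightarrow> real"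
  assumes f: "bounded_lipschitz C L f" and "0 < \<epsilon>"
  shows "((\<lambda>r. average (segment_law \<epsilon> e) f (s + r *\<^sub>R e)) has_real_derivative
     (f (s + (r + \<epsilon>) *\<^sub>R e) - f (s + (r - \<epsilon>) *\<^sub>R e)) / (2 * \<epsilon>)) (at r)"
proof -
  define g where "g = (\<lambda>t. f (s + t *\<^sub>R e))"
  have "continuous_on UNIV g"
    unfolding g_def
    by (rule continuous_on_compose2[OF bounded_lipschitz_continuous[OF f]]) (auto intro!: continuous_intros)
  then have cont: "isCont g t" for t by (simp add: continuous_on_eq_continuous_at)
  have [measurable]: "f \<in> borel_measurable borel" by (rule bounded_lipschitz_measurable[OF f])
  \<comment> \<open>The antiderivative is taken on the whole line at once, so that no range for
    \<open>r\<close> has to be fixed.\<close>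
  obtain G where G: "\<And>x. (G has_real_derivative g x) (at x)"
  proof -
    have "\<exists>F. \<forall>x::real. - \<infinity> < ereal x \<longrightarrow> ereal x < \<infinity> \<longrightarrow> (F has_vector_derivative g x) (at x)"
      by (rule einterval_antiderivative) (use cont in auto)
    then show ?thesis using that by (auto simp: has_real_derivative_iff_has_vector_derivative)
  qed
  have G_shift: "((\<lambda>t. G (t + c)) has_real_derivative g (t + c)) (at t)" for c t
    using G[of "t + c"] by (simp only: DERIV_shift)
  have avg: "average (segment_law \<epsilon> e) f (s + r *\<^sub>R e) = (G (r + \<epsilon>) - G (r - \<epsilon>)) / (2 * \<epsilon>)" for r
  proof -
    have "average (segment_law \<epsilon> e) f (s + r *\<^sub>R e)
        = (\<integral>t. g (r + t) \<partial>uniform_measure lborel {-\<epsilon>..\<epsilon>})"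
      unfolding average_def segment_law_def g_def by (subst integral_distr) (auto simp: algebra_simps)
    also have "\<dots> = (\<integral>t. g (r + t) * indicator {-\<epsilon>..\<epsilon>} t \<partial>lborel) / (2 * \<epsilon>)"
      by (rule integral_uniform_interval[OF \<open>0 < \<epsilon>\<close>]) (simp add: g_def)
    also have "(\<integral>t. g (r + t) * indicator {-\<epsilon>..\<epsilon>} t \<partial>lborel) = G (r + \<epsilon>) - G (r + - \<epsilon>)"
    proof (rule integral_FTC_Icc_real)
      show "((\<lambda>t. G (r + t)) has_real_derivative g (r + t)) (at t)" for t
        using G_shift[of r t] by (simp add: add.commute)
      show "isCont (\<lambda>t. g (r + t)) t" for t
        by (rule isCont_o2[where g=g, OF _ cont]) simp
    qed (use \<open>0 < \<epsilon>\<close> in auto)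
    finally show ?thesis by simp
  qed
  have "((\<lambda>r. (G (r + \<epsilon>) - G (r - \<epsilon>)) / (2 * \<epsilon>)) has_real_derivative
      (g (r + \<epsilon>) - g (r - \<epsilon>)) / (2 * \<epsilon>)) (at r)"
    using DERIV_diff[OF G_shift[of \<epsilon> r] G_shift[of "-\<epsilon>" r]] by (intro DERIV_cdivide) simp
  then show ?thesis unfolding avg by (simp add: g_def)
qed

lemma abs_divide_diff_le:
  fixes x y c d :: real
  assumes "0 < c" "\<bar>x - y\<bar> \<le> c * d"
  shows "\<bar>x / c - y / c\<bar> \<le> d"
proof -
  have "\<bar>x / c - y / c\<bar> = \<bar>x - y\<bar> / c"
    using assms(1) by (simp add: diff_divide_distrib[symmetric])
  also have "\<dots> \<le> d" using assms by (simp add: pos_divide_le_eq mult.commute)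
  finally show ?thesis .
qed

text \<open>Mean value theorem: the derivative is a difference quotient of width
  \<open>2 * \<epsilon>\<close> of an \<open>L\<close>-Lipschitz function and therefore varies by at
  most \<open>L / \<epsilon>\<close> times the displacement.\<close>

lemma average_segment_law_first_order:
  fixes f :: "'a::{real_normed_vector, second_countable_topology} \<Rightarrow> real"
  assumes f: "bounded_lipschitz C L f" and "0 < \<epsilon>" "0 \<le> L" "norm e = 1"
  shows "\<bar>average (segment_law \<epsilon> e) f (s + a *\<^sub>R e) - average (segment_law \<epsilon> e) f s
      - a * ((f (s + \<epsilon> *\<^sub>R e) - f (s - \<epsilon> *\<^sub>R e)) / (2 * \<epsilon>))\<bar> \<le> L / \<epsilon> * a\<^sup>2"
proof (cases "a = 0")
  case False
  define P where "P = (\<lambda>r. (f (s + (r + \<epsilon>) *\<^sub>R e) - f (s + (r - \<epsilon>) *\<^sub>R e)) / (2 * \<epsilon>))"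
  define h where "h = (\<lambda>r. average (segment_law \<epsilon> e) f (s + r *\<^sub>R e))"
  have D: "(h has_real_derivative P r) (at r)" for r
    unfolding h_def P_def by (rule average_segment_law_derivative[OF f \<open>0 < \<epsilon>\<close>])
  obtain \<xi> where \<xi>: "h a - h 0 = a * P \<xi>" "\<bar>\<xi>\<bar> \<le> \<bar>a\<bar>"
  proof (cases "0 < a")
    case True
    from MVT2[OF True D] show ?thesis using that by fastforce
  next
    case False
    with \<open>a \<noteq> 0\<close> have "a < 0" by simp
    from MVT2[OF this D] obtain z where "a < z" "z < 0" "h 0 - h a = (0 - a) * P z" by blast
    then show ?thesis using that[of z] by (auto simp: algebra_simps)
  qed
  have "\<bar>P \<xi> - P 0\<bar> \<le> L / \<epsilon> * \<bar>\<xi>\<bar>"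
  proof -
    have "\<bar>f (s + (\<xi> + c) *\<^sub>R e) - f (s + c *\<^sub>R e)\<bar> \<le> L * \<bar>\<xi>\<bar>" for c
    proof -
      have "s + (\<xi> + c) *\<^sub>R e - (s + c *\<^sub>R e) = \<xi> *\<^sub>R e" by (simp add: algebra_simps)
      then show ?thesis
        using bounded_lipschitzD(2)[OF f, of "s + (\<xi> + c) *\<^sub>R e" "s + c *\<^sub>R e"] \<open>norm e = 1\<close> by simp
    qed
    from this[of \<epsilon>] this[of "-\<epsilon>"]
    have "\<bar>(f (s + (\<xi> + \<epsilon>) *\<^sub>R e) - f (s + (\<xi> - \<epsilon>) *\<^sub>R e))
         - (f (s + \<epsilon> *\<^sub>R e) - f (s - \<epsilon> *\<^sub>R e))\<bar> \<le> 2 * (L * \<bar>\<xi>\<bar>)" by simp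
    then show ?thesis
      unfolding P_def using \<open>0 < \<epsilon>\<close> by (intro abs_divide_diff_le) simp_all
  qed
  also have "\<dots> \<le> L / \<epsilon> * \<bar>a\<bar>" using \<xi>(2) \<open>0 < \<epsilon>\<close> \<open>0 \<le> L\<close> by (intro mult_left_mono) auto
  finally have "\<bar>a\<bar> * \<bar>P \<xi> - P 0\<bar> \<le> \<bar>a\<bar> * (L / \<epsilon> * \<bar>a\<bar>)" by (intro mult_left_mono) auto
  moreover have "h a - h 0 - a * P 0 = a * (P \<xi> - P 0)" using \<xi>(1) by (simp add: algebra_simps)
  moreover have "\<bar>a\<bar> * (L / \<epsilon> * \<bar>a\<bar>) = L / \<epsilon> * a\<^sup>2"
    by (simp add: power2_eq_square abs_mult_self_eq mult.left_commute)
  ultimately have "\<bar>h a - h 0 - a * P 0\<bar> \<le> L / \<epsilon> * a\<^sup>2"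
    by (simp only: abs_mult)
  then show ?thesis unfolding h_def P_def by simp
qed simp

text \<open>After two averages the second derivative is the second difference of \<open>f\<close>
  with spacing \<open>2 * \<epsilon>\<close>. Its variation is bounded in two ways: through
  \<open>C\<close>, which gives the quadratic branch of the remainder, and through \<open>L\<close>,
  which gives the cubic branch.\<close>

lemma average_segment_law_second_order:
  fixes f :: "'a::{real_normed_vector, second_countable_topology} \<Rightarrow> real"
  assumes f: "bounded_lipschitz C L f" and "0 < \<epsilon>" "0 \<le> L" "norm e = 1"
  defines "A \<equiv> average (segment_law \<epsilon> e)"
  shows "\<bar>A (A f) (s + b *\<^sub>R e) - A (A f) s
      - b * ((A f (s + \<epsilon> *\<^sub>R e) - A f (s - \<epsilon> *\<^sub>R e)) / (2 * \<epsilon>))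
      - b\<^sup>2 / 2 * ((f (s + (2 * \<epsilon>) *\<^sub>R e) - 2 * f s + f (s - (2 * \<epsilon>) *\<^sub>R e)) / (4 * \<epsilon>\<^sup>2))\<bar>
    \<le> (C + L) / \<epsilon>\<^sup>2 * min (b\<^sup>2) (\<bar>b\<bar>^3)"
proof (cases "b = 0")
  case True
  then show ?thesis by simp
next
  case False
  define h where "h = (\<lambda>r. A (A f) (s + r *\<^sub>R e))"
  define P where "P = (\<lambda>r. (A f (s + (r + \<epsilon>) *\<^sub>R e) - A f (s + (r - \<epsilon>) *\<^sub>R e)) / (2 * \<epsilon>))"
  define Q where "Q = (\<lambda>r. (f (s + (r + 2 * \<epsilon>) *\<^sub>R e) - 2 * f (s + r *\<^sub>R e)
      + f (s + (r - 2 * \<epsilon>) *\<^sub>R e)) / (4 * \<epsilon>\<^sup>2))"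
  have Af: "bounded_lipschitz C L (A f)"
    unfolding A_def by (rule bounded_lipschitz_average[OF f borel_prob_segment_law[OF \<open>0 < \<epsilon>\<close>]])
  have Dh: "(h has_real_derivative P r) (at r)" for r
    unfolding h_def P_def A_def
    by (rule average_segment_law_derivative[OF Af[unfolded A_def] \<open>0 < \<epsilon>\<close>])
  have DP: "(P has_real_derivative Q r) (at r)" for r
  proof -
    have *: "((\<lambda>r. A f (s + (r + c) *\<^sub>R e)) has_real_derivative
        (f (s + (r + c + \<epsilon>) *\<^sub>R e) - f (s + (r + c - \<epsilon>) *\<^sub>R e)) / (2 * \<epsilon>)) (at r)" for c
      using average_segment_law_derivative[OF f \<open>0 < \<epsilon>\<close>, of e s "r + c"]
      unfolding A_def by (simp only: DERIV_shift)
    have "(P has_real_derivative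
        ((f (s + (r + \<epsilon> + \<epsilon>) *\<^sub>R e) - f (s + (r + \<epsilon> - \<epsilon>) *\<^sub>R e)) / (2 * \<epsilon>)
         - (f (s + (r + - \<epsilon> + \<epsilon>) *\<^sub>R e) - f (s + (r + - \<epsilon> - \<epsilon>) *\<^sub>R e)) / (2 * \<epsilon>)) / (2 * \<epsilon>)) (at r)"
      unfolding P_def using DERIV_diff[OF *[of \<epsilon>] *[of "-\<epsilon>"]]
      by (intro DERIV_cdivide) simp
    moreover have "((f (s + (r + \<epsilon> + \<epsilon>) *\<^sub>R e) - f (s + (r + \<epsilon> - \<epsilon>) *\<^sub>R e)) / (2 * \<epsilon>)
         - (f (s + (r + - \<epsilon> + \<epsilon>) *\<^sub>R e) - f (s + (r + - \<epsilon> - \<epsilon>) *\<^sub>R e)) / (2 * \<epsilon>)) / (2 * \<epsilon>) = Q r"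
    proof -
      have "r + \<epsilon> + \<epsilon> = r + 2 * \<epsilon>" "r + \<epsilon> - \<epsilon> = r" "r + - \<epsilon> + \<epsilon> = r" "r + - \<epsilon> - \<epsilon> = r - 2 * \<epsilon>"
        by simp_all
      moreover have "(x / (2 * \<epsilon>) - y / (2 * \<epsilon>)) / (2 * \<epsilon>) = (x - y) / (4 * \<epsilon>\<^sup>2)" for x y
        by (simp add: power2_eq_square diff_divide_distrib[symmetric])
      ultimately show ?thesis
        unfolding Q_def by (simp add: add.commute[of r])
    qed
    ultimately show ?thesis by simp
  qed
  obtain \<xi> where \<xi>: "h b = h 0 + P 0 * b + Q \<xi> / 2 * b\<^sup>2" "\<bar>\<xi>\<bar> \<le> \<bar>b\<bar>"
  proof -
    define d where "d = (\<lambda>m::nat. if m = 0 then h else if m = 1 then P else Q)"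
    have "\<exists>t. (if b < 0 then b < t \<and> t < 0 else 0 < t \<and> t < b) \<and>
        h b = (\<Sum>m<2. d m 0 / fact m * (b - 0)^m) + d 2 t / fact 2 * (b - 0)^2"
      \<comment> \<open>Expansion point and endpoint are 0 and \<open>b\<close> in either order, so
        the interval is spanned by \<open>min b 0\<close> and \<open>max b 0\<close>.\<close>
      by (rule Taylor[where a="min b 0" and b="max b 0"])
        (use False Dh DP in \<open>auto simp: d_def less_2_cases_iff\<close>)
    then show ?thesis
      using that by (auto simp: d_def numeral_2_eq_2 split: if_splits)
  qed
  have lip: "\<bar>f (s + (\<xi> + c) *\<^sub>R e) - f (s + c *\<^sub>R e)\<bar> \<le> L * \<bar>\<xi>\<bar>" for c
  proof -
    have "s + (\<xi> + c) *\<^sub>R e - (s + c *\<^sub>R e) = \<xi> *\<^sub>R e" by (simp add: algebra_simps)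
    then show ?thesis
      using bounded_lipschitzD(2)[OF f, of "s + (\<xi> + c) *\<^sub>R e" "s + c *\<^sub>R e"] \<open>norm e = 1\<close> by simp
  qed
  have Q1: "\<bar>Q \<xi> - Q 0\<bar> \<le> L / \<epsilon>\<^sup>2 * \<bar>b\<bar>"
  proof -
    have "\<bar>(f (s + (\<xi> + 2 * \<epsilon>) *\<^sub>R e) - 2 * f (s + \<xi> *\<^sub>R e) + f (s + (\<xi> - 2 * \<epsilon>) *\<^sub>R e))
        - (f (s + (2 * \<epsilon>) *\<^sub>R e) - 2 * f s + f (s - (2 * \<epsilon>) *\<^sub>R e))\<bar> \<le> 4 * (L * \<bar>\<xi>\<bar>)"
      using lip[of "2 * \<epsilon>"] lip[of 0] lip[of "- (2 * \<epsilon>)"] by simp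
    also have "\<dots> \<le> 4 * (L * \<bar>b\<bar>)" using \<xi>(2) \<open>0 \<le> L\<close> by (simp add: mult_left_mono)
    finally show ?thesis
      unfolding Q_def using \<open>0 < \<epsilon>\<close> by (intro abs_divide_diff_le) simp_all
  qed
  have Q2: "\<bar>Q \<xi> - Q 0\<bar> \<le> 2 * C / \<epsilon>\<^sup>2"
  proof -
    have "\<bar>(f (s + (\<xi> + 2 * \<epsilon>) *\<^sub>R e) - 2 * f (s + \<xi> *\<^sub>R e) + f (s + (\<xi> - 2 * \<epsilon>) *\<^sub>R e))
        - (f (s + (2 * \<epsilon>) *\<^sub>R e) - 2 * f s + f (s - (2 * \<epsilon>) *\<^sub>R e))\<bar> \<le> 8 * C"
      using bounded_lipschitzD(1)[OF f, of "s + (\<xi> + 2 * \<epsilon>) *\<^sub>R e"]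
        bounded_lipschitzD(1)[OF f, of "s + \<xi> *\<^sub>R e"]
        bounded_lipschitzD(1)[OF f, of "s + (\<xi> - 2 * \<epsilon>) *\<^sub>R e"]
        bounded_lipschitzD(1)[OF f, of "s + (2 * \<epsilon>) *\<^sub>R e"]
        bounded_lipschitzD(1)[OF f, of s]
        bounded_lipschitzD(1)[OF f, of "s - (2 * \<epsilon>) *\<^sub>R e"] by linarith
    then show ?thesis
      unfolding Q_def using \<open>0 < \<epsilon>\<close> by (intro abs_divide_diff_le) simp_all
  qed
  have "0 \<le> C" by (rule bounded_lipschitz_nonneg[OF f])
  have "h b - h 0 - b * P 0 - b\<^sup>2 / 2 * Q 0 = b\<^sup>2 / 2 * (Q \<xi> - Q 0)"
    using \<xi>(1) by (simp add: algebra_simps diff_divide_distrib)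
  then have eq: "\<bar>h b - h 0 - b * P 0 - b\<^sup>2 / 2 * Q 0\<bar> = b\<^sup>2 / 2 * \<bar>Q \<xi> - Q 0\<bar>"
    by (simp only: abs_mult abs_divide abs_power2 abs_numeral)
  have "b\<^sup>2 / 2 * \<bar>Q \<xi> - Q 0\<bar> \<le> (C + L) / \<epsilon>\<^sup>2 * b\<^sup>2"
  proof -
    have "b\<^sup>2 / 2 * \<bar>Q \<xi> - Q 0\<bar> \<le> b\<^sup>2 / 2 * (2 * C / \<epsilon>\<^sup>2)" by (intro mult_left_mono Q2) auto
    also have "\<dots> = C / \<epsilon>\<^sup>2 * b\<^sup>2" by simp
    also have "\<dots> \<le> (C + L) / \<epsilon>\<^sup>2 * b\<^sup>2"
      using \<open>0 \<le> L\<close> by (intro mult_right_mono divide_right_mono) auto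
    finally show ?thesis .
  qed
  moreover have "b\<^sup>2 / 2 * \<bar>Q \<xi> - Q 0\<bar> \<le> (C + L) / \<epsilon>\<^sup>2 * \<bar>b\<bar>^3"
  proof -
    have "b\<^sup>2 / 2 * \<bar>Q \<xi> - Q 0\<bar> \<le> b\<^sup>2 * (L / \<epsilon>\<^sup>2 * \<bar>b\<bar>)" by (intro mult_mono Q1) auto
    also have "\<dots> = L / \<epsilon>\<^sup>2 * \<bar>b\<bar>^3"
      by (simp add: power2_eq_square power3_eq_cube abs_mult_self_eq mult.assoc)
    also have "\<dots> \<le> (C + L) / \<epsilon>\<^sup>2 * \<bar>b\<bar>^3"
      using \<open>0 \<le> C\<close> by (intro mult_right_mono divide_right_mono) auto
    finally show ?thesis .
  qed
  ultimately have "\<bar>h b - h 0 - b * P 0 - b\<^sup>2 / 2 * Q 0\<bar> \<le> (C + L) / \<epsilon>\<^sup>2 * min (b\<^sup>2) (\<bar>b\<bar>^3)"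
    unfolding eq by (simp add: min_def)
  then show ?thesis unfolding h_def P_def Q_def by simp
qed

text \<open>A step has size 1/n along the first axis and 1/sqrt n along the second. One derivative
  is needed along the first axis and two along the second, and each derivative costs one
  average.\<close>

definition smooth :: "real \<Rightarrow> (real \<times> real \<Rightarrow> real) \<Rightarrow> real \<times> real \<Rightarrow> real" where
  "smooth \<epsilon> f = average (segment_law \<epsilon> (1, 0)) (average (segment_law \<epsilon> (0, 1)) (average (segment_law \<epsilon> (0, 1)) f))"

text \<open>
  The quadratic branch of the minimum makes the gauge integrable for steps without third moments, the
  cubic branch makes its integral \<open>o(1/n)\<close>.
\<close>

definition taylor_gauge :: "real \<times> real \<Rightarrow> real" where
  "taylor_gauge v = (fst v)\<^sup>2 + \<bar>fst v\<bar> * \<bar>snd v\<bar> + min ((snd v)\<^sup>2) (\<bar>snd v\<bar>^3)"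

lemma bounded_lipschitz_smooth:
  "bounded_lipschitz C L f \<Longrightarrow> 0 < \<epsilon> \<Longrightarrow> bounded_lipschitz C L (smooth \<epsilon> f)"
  unfolding smooth_def by (intro bounded_lipschitz_average borel_prob_segment_law)

text \<open>First move along the second axis with the second-order expansion at \<open>s\<close>,
  then along the first axis from the shifted point. The change of \<open>p\<close> between the two
  points produces the mixed term of the gauge. The coefficients depend on \<open>s\<close> and not
  on \<open>v\<close>, so different step laws can be compared with the same ones.\<close>

lemma smooth_taylor:
  assumes f: "bounded_lipschitz C L f" and "0 < \<epsilon>" "0 \<le> L"
  shows "\<exists>p q r. \<forall>s v. \<bar>smooth \<epsilon> f (s + v) - smooth \<epsilon> f s - fst v * p s - snd v * r s
      - (snd v)\<^sup>2 / 2 * q s\<bar> \<le> (L / \<epsilon> + (C + L) / \<epsilon>\<^sup>2) * taylor_gauge v"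
proof -
  define A1 where "A1 = average (segment_law \<epsilon> (1::real, 0::real))"
  define A2 where "A2 = average (segment_law \<epsilon> (0::real, 1::real))"
  note B = borel_prob_segment_law[OF \<open>0 < \<epsilon>\<close>]
  have S: "smooth \<epsilon> f = A1 (A2 (A2 f))" unfolding smooth_def A1_def A2_def ..
  have BL: "bounded_lipschitz C L (A2 (A2 f))" "bounded_lipschitz C L (A2 f)"
    "bounded_lipschitz C L (A1 f)"
    unfolding A1_def A2_def by (intro bounded_lipschitz_average B f)+
  \<comment> \<open>The expansions differentiate the outermost averages; commuting them brings
    either axis to the outside.\<close>
  have S': "smooth \<epsilon> f = A2 (A2 (A1 f))"
  proof -
    have "A1 (A2 (A2 f)) = A2 (A1 (A2 f))"
      unfolding A1_def A2_def
      by (rule ext) (rule average_commute[OF bounded_lipschitz_average[OF f B] B B])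
    also have "A1 (A2 f) = A2 (A1 f)"
      unfolding A1_def A2_def by (rule ext) (rule average_commute[OF f B B])
    finally show ?thesis using S by simp
  qed
  define p where "p = (\<lambda>s. (A2 (A2 f) (s + \<epsilon> *\<^sub>R (1, 0)) - A2 (A2 f) (s - \<epsilon> *\<^sub>R (1, 0))) / (2 * \<epsilon>))"
  define r where "r = (\<lambda>s. (A2 (A1 f) (s + \<epsilon> *\<^sub>R (0, 1)) - A2 (A1 f) (s - \<epsilon> *\<^sub>R (0, 1))) / (2 * \<epsilon>))"
  define q where "q = (\<lambda>s. (A1 f (s + (2 * \<epsilon>) *\<^sub>R (0, 1)) - 2 * A1 f s
      + A1 f (s - (2 * \<epsilon>) *\<^sub>R (0, 1))) / (4 * \<epsilon>\<^sup>2))"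
  have x: "\<bar>smooth \<epsilon> f (s + a *\<^sub>R (1, 0)) - smooth \<epsilon> f s - a * p s\<bar> \<le> L / \<epsilon> * a\<^sup>2" for s a
    using average_segment_law_first_order[OF BL(1) \<open>0 < \<epsilon>\<close> \<open>0 \<le> L\<close>, of "(1, 0)" s a]
    unfolding S p_def A1_def by simp
  have y: "\<bar>smooth \<epsilon> f (s + b *\<^sub>R (0, 1)) - smooth \<epsilon> f s - b * r s - b\<^sup>2 / 2 * q s\<bar>
      \<le> (C + L) / \<epsilon>\<^sup>2 * min (b\<^sup>2) (\<bar>b\<bar>^3)" for s b
    using average_segment_law_second_order[OF BL(3) \<open>0 < \<epsilon>\<close> \<open>0 \<le> L\<close>, of "(0, 1)" s b]
    unfolding S' r_def q_def A2_def by simp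
  have p: "\<bar>p (s + b *\<^sub>R (0, 1)) - p s\<bar> \<le> L / \<epsilon> * \<bar>b\<bar>" for s b
  proof -
    have "\<bar>A2 (A2 f) (s + b *\<^sub>R (0, 1) + w) - A2 (A2 f) (s + w)\<bar> \<le> L * \<bar>b\<bar>" for w
      using bounded_lipschitzD(2)[OF BL(1), of "s + b *\<^sub>R (0, 1) + w" "s + w"] by simp
    from this[of "\<epsilon> *\<^sub>R (1, 0)"] this[of "- (\<epsilon> *\<^sub>R (1, 0))", unfolded add_uminus_conv_diff]
    have "\<bar>(A2 (A2 f) (s + b *\<^sub>R (0, 1) + \<epsilon> *\<^sub>R (1, 0)) - A2 (A2 f) (s + b *\<^sub>R (0, 1) - \<epsilon> *\<^sub>R (1, 0)))
      - (A2 (A2 f) (s + \<epsilon> *\<^sub>R (1, 0)) - A2 (A2 f) (s - \<epsilon> *\<^sub>R (1, 0)))\<bar> \<le> 2 * (L * \<bar>b\<bar>)"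
      by linarith
    then show ?thesis
      unfolding p_def using \<open>0 < \<epsilon>\<close> by (intro abs_divide_diff_le) simp_all
  qed
  have "\<bar>smooth \<epsilon> f (s + v) - smooth \<epsilon> f s - fst v * p s - snd v * r s - (snd v)\<^sup>2 / 2 * q s\<bar>
      \<le> (L / \<epsilon> + (C + L) / \<epsilon>\<^sup>2) * taylor_gauge v" for s v
  proof -
    obtain a b where v: "v = (a, b)" by (cases v)
    have sv: "s + v = s + b *\<^sub>R (0, 1) + a *\<^sub>R (1, 0)" by (simp add: v prod_eq_iff)
    define s' where "s' = s + b *\<^sub>R (0, 1)"
    have "\<bar>a * p s' - a * p s\<bar> \<le> L / \<epsilon> * (\<bar>a\<bar> * \<bar>b\<bar>)"
    proof -
      have "\<bar>a * p s' - a * p s\<bar> = \<bar>a\<bar> * \<bar>p s' - p s\<bar>"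
        by (simp add: right_diff_distrib[symmetric] abs_mult)
      also have "\<dots> \<le> \<bar>a\<bar> * (L / \<epsilon> * \<bar>b\<bar>)" unfolding s'_def by (intro mult_left_mono p) auto
      finally show ?thesis by (simp add: algebra_simps)
    qed
    with x[of s' a] y[of s b]
    have *: "\<bar>smooth \<epsilon> f (s + v) - smooth \<epsilon> f s - a * p s - b * r s - b\<^sup>2 / 2 * q s\<bar>
        \<le> L / \<epsilon> * a\<^sup>2 + L / \<epsilon> * (\<bar>a\<bar> * \<bar>b\<bar>) + (C + L) / \<epsilon>\<^sup>2 * min (b\<^sup>2) (\<bar>b\<bar>^3)"
      unfolding sv s'_def by linarith
    also have "\<dots> \<le> (L / \<epsilon> + (C + L) / \<epsilon>\<^sup>2) * taylor_gauge v"
    proof -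
      have "0 \<le> L / \<epsilon>" "0 \<le> (C + L) / \<epsilon>\<^sup>2"
        using \<open>0 < \<epsilon>\<close> \<open>0 \<le> L\<close> bounded_lipschitz_nonneg[OF f] by auto
      then have "L / \<epsilon> * x + L / \<epsilon> * y + (C + L) / \<epsilon>\<^sup>2 * z \<le> (L / \<epsilon> + (C + L) / \<epsilon>\<^sup>2) * (x + y + z)"
        if "0 \<le> x" "0 \<le> y" "0 \<le> z" for x y z
      proof -
        have "0 \<le> (C + L) / \<epsilon>\<^sup>2 * (x + y)" "0 \<le> L / \<epsilon> * z"
          using that \<open>0 \<le> L / \<epsilon>\<close> \<open>0 \<le> (C + L) / \<epsilon>\<^sup>2\<close> by (simp_all only: mult_nonneg_nonneg add_nonneg_nonneg)
        then show ?thesis by (simp only: distrib_left distrib_right)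
      qed
      then show ?thesis
        unfolding taylor_gauge_def v fst_conv snd_conv by simp
    qed
    finally show ?thesis by (simp add: v)
  qed
  then show ?thesis by blast
qed

text \<open>Three averages, each moving the value by at most \<open>L * \<epsilon>\<close>, since
  the inner ones preserve the Lipschitz constant.\<close>

lemma smooth_near:
  assumes f: "bounded_lipschitz C L f" and "0 < \<epsilon>" "0 \<le> L"
  shows "\<bar>smooth \<epsilon> f s - f s\<bar> \<le> 3 * L * \<epsilon>"
proof -
  note B = borel_prob_segment_law[OF \<open>0 < \<epsilon>\<close>]
  note A = bounded_lipschitz_average[OF _ B]
  have N: "\<bar>average (segment_law \<epsilon> e) g s - g s\<bar> \<le> L * \<epsilon>"
    if "bounded_lipschitz C L g" "norm e = 1" for g s and e :: "real \<times> real"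
    by (rule average_near[OF that(1) B segment_law_near[OF \<open>0 < \<epsilon>\<close> that(2)] \<open>0 \<le> L\<close>])
  show ?thesis
    unfolding smooth_def
    using N[OF f, of "(0, 1)" s] N[OF A[OF f], of "(0, 1)" "(0, 1)" s]
      N[OF A[OF A[OF f]], of "(1, 0)" "(0, 1)" "(0, 1)" s] by simp
qed


text \<open>The operator is pushed through one average at a time, using that the outer averages are
  monotone.\<close>

lemma bellman_smooth_le:
  assumes J: "control_family J \<nu>" and f: "bounded_lipschitz C L f" and "0 < \<epsilon>"
  shows "bellman J \<nu> (smooth \<epsilon> f) s \<le> smooth \<epsilon> (bellman J \<nu> f) s"
proof -
  interpret control_family J \<nu> by (rule J)
  note B = borel_prob_segment_law[OF \<open>0 < \<epsilon>\<close>]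
  note A = bounded_lipschitz_average[OF _ B]
  note T = bounded_lipschitz_bellman
  let ?A1 = "average (segment_law \<epsilon> (1, 0))" and ?A2 = "average (segment_law \<epsilon> (0, 1))"
  have step: "average (segment_law \<epsilon> e) g s \<le> average (segment_law \<epsilon> e) h s"
    if "bounded_lipschitz C L g" "bounded_lipschitz C L h" "\<And>s. g s \<le> h s" for g h s and e :: "real \<times> real"
    using average_mono_add[OF that(1,2) B, where c=0] that(3) by simp
  have 1: "bellman J \<nu> (?A2 f) s \<le> ?A2 (bellman J \<nu> f) s" for s
    by (rule bellman_average_le[OF f B])
  have 2: "bellman J \<nu> (?A2 (?A2 f)) s \<le> ?A2 (?A2 (bellman J \<nu> f)) s" for s
    by (rule order_trans[OF bellman_average_le[OF A[OF f] B] step[OF T[OF A[OF f]] A[OF T[OF f]] 1]])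
  show ?thesis
    unfolding smooth_def
    by (rule order_trans[OF bellman_average_le[OF A[OF A[OF f]] B]
          step[OF T[OF A[OF A[OF f]]] A[OF A[OF T[OF f]]] 2]])
qed

section \<open>Asymptotic comparison of control problems\<close>

text \<open>
  \<open>m k\<close> is a pair (mean, variance): a step of the walk with law \<open>\<nu> n k\<close> acts on smooth functions,
  up to \<open>o(1/n)\<close>, like \<open>(fst (m k) \<partial>\<^sub>1 + snd (m k) / 2 \<partial>\<^sub>2\<^sub>2) / n\<close>.
\<close>

definition consistent ::
    "'k set \<Rightarrow> ('k \<Rightarrow> real \<times> real) \<Rightarrow> (nat \<Rightarrow> 'k \<Rightarrow> (real \<times> real) measure) \<Rightarrow> bool" where
  "consistent J m \<nu> \<longleftrightarrow> finite J \<and> J \<noteq> {} \<and>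
     (\<forall>n>0. \<forall>k\<in>J. borel_prob (\<nu> n k) \<and>
        integrable (\<nu> n k) (\<lambda>v. (fst v)\<^sup>2) \<and> integrable (\<nu> n k) (\<lambda>v. (snd v)\<^sup>2) \<and>
        (\<integral>v. fst v \<partial>\<nu> n k) = fst (m k) / n \<and> (\<integral>v. snd v \<partial>\<nu> n k) = 0 \<and>
        (\<integral>v. (snd v)\<^sup>2 \<partial>\<nu> n k) = snd (m k) / n) \<and>
     (\<forall>k\<in>J. (\<lambda>n. n * (\<integral>v. taylor_gauge v \<partial>\<nu> n k)) \<longlonglongrightarrow> 0)"

lemma consistent_control_family: "consistent J m \<nu> \<Longrightarrow> 0 < n \<Longrightarrow> control_family J (\<nu> n)"
  unfolding consistent_def control_family_def by blast

lemma integrable_abs_mult_squares: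
  fixes f g :: "'a \<Rightarrow> real"
  assumes [measurable]: "f \<in> borel_measurable M" "g \<in> borel_measurable M"
    and "integrable M (\<lambda>x. (f x)\<^sup>2)" "integrable M (\<lambda>x. (g x)\<^sup>2)"
  shows "integrable M (\<lambda>x. \<bar>f x\<bar> * \<bar>g x\<bar>)" "integrable M (\<lambda>x. f x * g x)"
proof -
  have "\<bar>f x * g x\<bar> \<le> (f x)\<^sup>2 + (g x)\<^sup>2" for x
  proof -
    have "0 \<le> \<bar>f x\<bar> * \<bar>g x\<bar>" by simp
    then show ?thesis
      using sum_squares_bound[of "\<bar>f x\<bar>" "\<bar>g x\<bar>"] unfolding abs_mult power2_abs by linarith
  qed
  then show "integrable M (\<lambda>x. \<bar>f x\<bar> * \<bar>g x\<bar>)" "integrable M (\<lambda>x. f x * g x)"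
    using assms(3,4)
    by (auto intro!: Bochner_Integration.integrable_bound[OF Bochner_Integration.integrable_add[OF assms(3,4)]]
        simp: abs_mult)
qed

lemma taylor_gauge_measurable [measurable]: "taylor_gauge \<in> borel_measurable borel"
  unfolding taylor_gauge_def[abs_def] borel_prod[symmetric] by measurable

lemma taylor_gauge_nonneg: "0 \<le> taylor_gauge v"
  unfolding taylor_gauge_def by simp

lemma square_integrable_imp_integrable:
  fixes f :: "'a \<Rightarrow> real"
  assumes "prob_space M" and [measurable]: "f \<in> borel_measurable M"
    and "integrable M (\<lambda>x. (f x)\<^sup>2)"
  shows "integrable M f"
proof -
  interpret prob_space M by fact
  show ?thesis
    using integrable_abs_mult_squares(2)[OF assms(2) borel_measurable_const[of 1] assms(3)] by simp
qed

lemma consistent_moments: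
  assumes c: "consistent J m \<nu>" and "0 < n" "k \<in> J"
  shows "integrable (\<nu> n k) fst" "integrable (\<nu> n k) snd" "integrable (\<nu> n k) (\<lambda>v. (snd v)\<^sup>2)"
    "integrable (\<nu> n k) taylor_gauge"
    "(\<integral>v. fst v \<partial>\<nu> n k) = fst (m k) / n" "(\<integral>v. snd v \<partial>\<nu> n k) = 0"
    "(\<integral>v. (snd v)\<^sup>2 \<partial>\<nu> n k) = snd (m k) / n"
    "borel_prob (\<nu> n k)"
proof -
  have *: "borel_prob (\<nu> n k)" "integrable (\<nu> n k) (\<lambda>v. (fst v)\<^sup>2)"
    "integrable (\<nu> n k) (\<lambda>v. (snd v)\<^sup>2)" "(\<integral>v. fst v \<partial>\<nu> n k) = fst (m k) / n"
    "(\<integral>v. snd v \<partial>\<nu> n k) = 0" "(\<integral>v. (snd v)\<^sup>2 \<partial>\<nu> n k) = snd (m k) / n"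
    using c assms(2,3) unfolding consistent_def by blast+
  have sets: "sets (\<nu> n k) = sets (borel \<Otimes>\<^sub>M borel)"
    unfolding borel_prod by (rule borel_probD(2)[OF *(1)])
  have meas: "fst \<in> borel_measurable (\<nu> n k)" "snd \<in> borel_measurable (\<nu> n k)"
    unfolding measurable_cong_sets[OF sets refl] by measurable
  have tg: "taylor_gauge \<in> borel_measurable (\<nu> n k)"
    unfolding measurable_cong_sets[OF borel_probD(2)[OF *(1)] refl] by (rule taylor_gauge_measurable)
  show "integrable (\<nu> n k) taylor_gauge"
  proof (rule Bochner_Integration.integrable_bound)
    show "integrable (\<nu> n k) (\<lambda>v. (fst v)\<^sup>2 + \<bar>fst v\<bar> * \<bar>snd v\<bar> + (snd v)\<^sup>2)"
      by (intro Bochner_Integration.integrable_add integrable_abs_mult_squares(1) meas *(2,3))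
    show "AE v in \<nu> n k. norm (taylor_gauge v) \<le> norm ((fst v)\<^sup>2 + \<bar>fst v\<bar> * \<bar>snd v\<bar> + (snd v)\<^sup>2)"
    proof (rule AE_I2)
      fix v :: "real \<times> real"
      have "0 \<le> (fst v)\<^sup>2 + \<bar>fst v\<bar> * \<bar>snd v\<bar> + (snd v)\<^sup>2" by (simp add: add_nonneg_nonneg)
      moreover have "taylor_gauge v \<le> (fst v)\<^sup>2 + \<bar>fst v\<bar> * \<bar>snd v\<bar> + (snd v)\<^sup>2"
        unfolding taylor_gauge_def by simp
      ultimately show "norm (taylor_gauge v) \<le> norm ((fst v)\<^sup>2 + \<bar>fst v\<bar> * \<bar>snd v\<bar> + (snd v)\<^sup>2)"
        using taylor_gauge_nonneg[of v] by simp
    qed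
  qed (rule tg)
  show "integrable (\<nu> n k) fst" "integrable (\<nu> n k) snd"
    by (fact square_integrable_imp_integrable[OF borel_probD(1)[OF *(1)] meas(1) *(2)]
        square_integrable_imp_integrable[OF borel_probD(1)[OF *(1)] meas(2) *(3)])+
  show "integrable (\<nu> n k) (\<lambda>v. (snd v)\<^sup>2)" "(\<integral>v. fst v \<partial>\<nu> n k) = fst (m k) / n"
    "(\<integral>v. snd v \<partial>\<nu> n k) = 0" "(\<integral>v. (snd v)\<^sup>2 \<partial>\<nu> n k) = snd (m k) / n" "borel_prob (\<nu> n k)"
    by (fact *)+
qed

text \<open>The first-order term in the second coordinate disappears because the steps are centred
  there; hence \<open>r\<close> does not occur in the conclusion and noise enters only through its
  variance.\<close>

lemma average_taylor:
  assumes c: "consistent J m \<nu>" and "0 < n" "k \<in> J" and g: "bounded_lipschitz C L g"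
    and taylor: "\<And>v. \<bar>g (s + v) - g s - fst v * p - snd v * r - (snd v)\<^sup>2 / 2 * q\<bar> \<le> D * taylor_gauge v"
  shows "\<bar>average (\<nu> n k) g s - g s - (fst (m k) * p + snd (m k) / 2 * q) / n\<bar>
    \<le> D * (\<integral>v. taylor_gauge v \<partial>\<nu> n k)"
proof -
  note M = consistent_moments[OF c assms(2,3)]
  interpret prob_space "\<nu> n k" by (rule borel_probD(1)[OF M(8)])
  note I = average_integrable[OF g M(8)]
  have eq: "average (\<nu> n k) g s - g s - (fst (m k) * p + snd (m k) / 2 * q) / n
      = (\<integral>v. g (s + v) - g s - fst v * p - snd v * r - (snd v)\<^sup>2 / 2 * q \<partial>\<nu> n k)"
  proof -
    have *: "(\<integral>v. g (s + v) - g s - fst v * p - snd v * r - (snd v)\<^sup>2 / 2 * q \<partial>\<nu> n k)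
        = (\<integral>v. g (s + v) \<partial>\<nu> n k) - g s - (\<integral>v. fst v \<partial>\<nu> n k) * p - (\<integral>v. snd v \<partial>\<nu> n k) * r
          - (\<integral>v. (snd v)\<^sup>2 \<partial>\<nu> n k) / 2 * q"
    proof -
      note h = has_bochner_integral_integrable
      have "has_bochner_integral (\<nu> n k) (\<lambda>v. g s) (g s)"
        using h[of "\<nu> n k" "\<lambda>v. g s"] by (simp add: prob_space)
      then show ?thesis
        by (intro has_bochner_integral_integral_eq has_bochner_integral_diff
            has_bochner_integral_mult_left has_bochner_integral_divide_zero h I M(1-3))
    qed
    show ?thesis
      unfolding average_def * M(5-7) by (simp add: add_divide_distrib)
  qed
  have "\<bar>average (\<nu> n k) g s - g s - (fst (m k) * p + snd (m k) / 2 * q) / n\<bar>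
      \<le> (\<integral>v. \<bar>g (s + v) - g s - fst v * p - snd v * r - (snd v)\<^sup>2 / 2 * q\<bar> \<partial>\<nu> n k)"
    unfolding eq by (rule integral_abs_bound)
  also have "\<dots> \<le> (\<integral>v. D * taylor_gauge v \<partial>\<nu> n k)"
  proof (rule integral_mono)
    show "integrable (\<nu> n k) (\<lambda>v. \<bar>g (s + v) - g s - fst v * p - snd v * r - (snd v)\<^sup>2 / 2 * q\<bar>)"
      by (intro integrable_abs Bochner_Integration.integrable_diff integrable_mult_left
          integrable_divide_zero I M(1-3) integrable_const)
    show "integrable (\<nu> n k) (\<lambda>v. D * taylor_gauge v)"
      using M(4) by simp
  qed (rule taylor)
  finally show ?thesis by simp
qed

text \<open>The half-space bounded by the largest value at a generator is convex and contains all
  generators, hence the hull. The dominating index depends on the functional and so, later, on the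
  point at which derivatives are taken.\<close>

lemma linear_le_on_convex_hull:
  fixes p q :: real
  assumes "finite J" "J \<noteq> {}" and x: "x \<in> convex hull (m ` J)"
  shows "\<exists>k\<in>J. fst x * p + snd x * q \<le> fst (m k) * p + snd (m k) * q"
proof -
  define l where "l = (\<lambda>x. (p, q) \<bullet> x)"
  have l: "l y = fst y * p + snd y * q" for y
    unfolding l_def by (cases y) (simp add: mult.commute)
  have "Max (l ` m ` J) \<in> l ` m ` J" by (rule Max_in) (use assms in auto)
  then obtain k where k: "k \<in> J" "Max (l ` m ` J) = l (m k)" by auto
  have "convex hull (m ` J) \<subseteq> {y. (p, q) \<bullet> y \<le> l (m k)}"
  proof (rule hull_minimal)
    show "m ` J \<subseteq> {y. (p, q) \<bullet> y \<le> l (m k)}"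
      using k(2)[symmetric] \<open>finite J\<close> by (auto simp: l_def[symmetric])
  qed (rule convex_halfspace_le)
  then show ?thesis using x k(1) l unfolding l_def by auto
qed

text \<open>The smoothed iterates of the second problem are supersolutions of the first up to
  \<open>D * err n\<close> per step. Induction over the steps accumulates
  \<open>n * (D * err n)\<close>, which vanishes for fixed \<open>\<epsilon>\<close>; smoothing at
  the start and unsmoothing at the end cost \<open>3 * L * \<epsilon>\<close> each.\<close>

lemma bellman_comparison:
  assumes c1: "consistent J1 m1 \<nu>1" and c2: "consistent J2 m2 \<nu>2"
    and hull: "m1 ` J1 \<subseteq> convex hull (m2 ` J2)"
    and u: "bounded_lipschitz C L u" and "0 \<le> L" "0 < \<delta>"
  shows "\<forall>\<^sub>F n in sequentially.
    (bellman J1 (\<nu>1 n) ^^ n) u 0 \<le> (bellman J2 (\<nu>2 n) ^^ n) u 0 + \<delta>"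
proof -
  \<comment> \<open>Chosen so that the two smoothing errors together use at most half of
    \<open>\<delta>\<close>; \<open>L + 1\<close> keeps the quotient meaningful for
    \<open>L = 0\<close>.\<close>
  define \<epsilon> where "\<epsilon> = \<delta> / (12 * (L + 1))"
  have "0 < \<epsilon>" unfolding \<epsilon>_def using \<open>0 \<le> L\<close> \<open>0 < \<delta>\<close> by simp
  have \<epsilon>: "6 * L * \<epsilon> \<le> \<delta> / 2"
    unfolding \<epsilon>_def using \<open>0 \<le> L\<close> \<open>0 < \<delta>\<close> by (simp add: field_simps)
  define D where "D = L / \<epsilon> + (C + L) / \<epsilon>\<^sup>2"
  have "0 \<le> D"
    unfolding D_def using \<open>0 < \<epsilon>\<close> \<open>0 \<le> L\<close> bounded_lipschitz_nonneg[OF u] by simp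
  have fin: "finite J1" "finite J2" "J2 \<noteq> {}" using c1 c2 unfolding consistent_def by auto
  \<comment> \<open>Summing over all indices bounds the remainder for any pair of indices, whichever
    ones turn out to be optimal.\<close>
  define err where "err = (\<lambda>n. (\<Sum>k\<in>J1. \<integral>v. taylor_gauge v \<partial>\<nu>1 n k) + (\<Sum>k\<in>J2. \<integral>v. taylor_gauge v \<partial>\<nu>2 n k))"
  have "(\<lambda>n. D * ((\<Sum>k\<in>J1. n * (\<integral>v. taylor_gauge v \<partial>\<nu>1 n k)) + (\<Sum>k\<in>J2. n * (\<integral>v. taylor_gauge v \<partial>\<nu>2 n k)))) \<longlonglongrightarrow> D * ((\<Sum>k\<in>J1. 0) + (\<Sum>k\<in>J2. 0))"
    using c1 c2 unfolding consistent_def by (intro tendsto_intros) auto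
  then have "(\<lambda>n. n * (D * err n)) \<longlonglongrightarrow> 0"
    unfolding err_def by (simp add: sum_distrib_left distrib_left mult.left_commute)
  then have "\<forall>\<^sub>F n in sequentially. n * (D * err n) < \<delta> / 2"
    by (rule order_tendstoD) (use \<open>0 < \<delta>\<close> in simp)
  then show ?thesis
    using eventually_gt_at_top[of 0]
  proof eventually_elim
    case (elim n)
    interpret J1: control_family J1 "\<nu>1 n" by (rule consistent_control_family[OF c1 elim(2)])
    interpret J2: control_family J2 "\<nu>2 n" by (rule consistent_control_family[OF c2 elim(2)])
    define f where "f = (\<lambda>i. (bellman J2 (\<nu>2 n) ^^ i) u)"
    have f: "bounded_lipschitz C L (f i)" for i
      unfolding f_def by (rule J2.bounded_lipschitz_bellman_funpow[OF u])
    note S = bounded_lipschitz_smooth[OF f \<open>0 < \<epsilon>\<close>]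
    have err_ge: "(\<integral>v. taylor_gauge v \<partial>\<nu>1 n k1) + (\<integral>v. taylor_gauge v \<partial>\<nu>2 n k2) \<le> err n"
      if "k1 \<in> J1" "k2 \<in> J2" for k1 k2
      unfolding err_def using that fin
      by (intro add_mono member_le_sum) (auto intro!: integral_nonneg_AE simp: taylor_gauge_nonneg)
    \<comment> \<open>Both step laws are expanded around the same point with the same coefficients.
      The index of the first problem is then replaced by one of the second with at least as large a
      generator term.\<close>
    have step: "bellman J1 (\<nu>1 n) (smooth \<epsilon> (f i)) s \<le> smooth \<epsilon> (f (Suc i)) s + D * err n" for i s
    proof -
      obtain p q r where pqr: "\<And>s v. \<bar>smooth \<epsilon> (f i) (s + v) - smooth \<epsilon> (f i) s - fst v * p s - snd v * r s
          - (snd v)\<^sup>2 / 2 * q s\<bar> \<le> D * taylor_gauge v"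
        using smooth_taylor[OF f \<open>0 < \<epsilon>\<close> \<open>0 \<le> L\<close>] unfolding D_def by blast
      obtain k1 where k1: "k1 \<in> J1"
        "bellman J1 (\<nu>1 n) (smooth \<epsilon> (f i)) s = average (\<nu>1 n k1) (smooth \<epsilon> (f i)) s"
        using J1.bellman_attained by blast
      \<comment> \<open>The generator is linear in (mean, variance) with coefficients
        \<open>p s\<close> and \<open>q s / 2\<close>; the half comes from the second-order Taylor
        term.\<close>
      obtain k2 where k2: "k2 \<in> J2"
        "fst (m1 k1) * p s + snd (m1 k1) * (q s / 2) \<le> fst (m2 k2) * p s + snd (m2 k2) * (q s / 2)"
        using linear_le_on_convex_hull[OF fin(2,3), of "m1 k1" m2 "p s" "q s / 2"] hull k1(1) by blast
      from k2(2) have "(fst (m1 k1) * p s + snd (m1 k1) / 2 * q s) / n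
          \<le> (fst (m2 k2) * p s + snd (m2 k2) / 2 * q s) / n"
        by (intro divide_right_mono) simp_all
      moreover note average_taylor[OF c1 elim(2) k1(1) S pqr] average_taylor[OF c2 elim(2) k2(1) S pqr]
      ultimately have "average (\<nu>1 n k1) (smooth \<epsilon> (f i)) s \<le> average (\<nu>2 n k2) (smooth \<epsilon> (f i)) s
          + D * (\<integral>v. taylor_gauge v \<partial>\<nu>1 n k1) + D * (\<integral>v. taylor_gauge v \<partial>\<nu>2 n k2)"
        by (smt (verit))
      also have "\<dots> \<le> average (\<nu>2 n k2) (smooth \<epsilon> (f i)) s + D * err n"
        using mult_left_mono[OF err_ge[OF k1(1) k2(1)] \<open>0 \<le> D\<close>] by (simp add: distrib_left)
      also have "average (\<nu>2 n k2) (smooth \<epsilon> (f i)) s \<le> bellman J2 (\<nu>2 n) (smooth \<epsilon> (f i)) s"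
        by (rule J2.bellman_ge[OF k2(1)])
      also have "\<dots> \<le> smooth \<epsilon> (f (Suc i)) s"
        unfolding f_def funpow.simps comp_def
        by (rule bellman_smooth_le[OF J2.control_family_axioms f[unfolded f_def] \<open>0 < \<epsilon>\<close>])
      finally show ?thesis using k1(2) by simp
    qed
    have "(bellman J1 (\<nu>1 n) ^^ i) u s \<le> smooth \<epsilon> (f i) s + (3 * L * \<epsilon> + i * (D * err n))" for i s
    proof (induction i arbitrary: s)
      case 0
      then show ?case using smooth_near[OF u \<open>0 < \<epsilon>\<close> \<open>0 \<le> L\<close>, of s] by (simp add: f_def)
    next
      case (Suc i)
      have "(bellman J1 (\<nu>1 n) ^^ Suc i) u s
          \<le> bellman J1 (\<nu>1 n) (smooth \<epsilon> (f i)) s + (3 * L * \<epsilon> + i * (D * err n))"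
        unfolding funpow.simps comp_def
        by (rule J1.bellman_mono_add[OF J1.bounded_lipschitz_bellman_funpow[OF u] S Suc])
      with step[of i s] show ?case by (simp add: algebra_simps)
    qed
    from this[of n 0] smooth_near[OF f \<open>0 < \<epsilon>\<close> \<open>0 \<le> L\<close>, of n 0]
    have "(bellman J1 (\<nu>1 n) ^^ n) u 0 \<le> f n 0 + 6 * L * \<epsilon> + n * (D * err n)" by simp
    then show ?case using \<epsilon> elim(1) by (simp add: f_def)
  qed
qed

section \<open>Independence of a sub-\<open>\<sigma>\<close>-algebra\<close>

text \<open>\<open>F\<close> enters only through its measurable sets, so the measure carried by a
  generated sigma-algebra is irrelevant. A product formula for single events is the form in which
  the filtrations below deliver independence.\<close>

definition indep_of :: "'w measure \<Rightarrow> 'w measure \<Rightarrow> ('w \<Rightarrow> 'b::topological_space) \<Rightarrow> bool" where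
  "indep_of M F Y \<longleftrightarrow> Y \<in> borel_measurable M \<and>
     (\<forall>A\<in>sets F. \<forall>D\<in>sets borel.
        measure M (A \<inter> (Y -` D \<inter> space M)) = measure M A * measure M (Y -` D \<inter> space M))"

lemma indep_of_compose:
  assumes "indep_of M F Y" and [measurable]: "g \<in> borel_measurable borel"
  shows "indep_of M F (\<lambda>\<omega>. g (Y \<omega>))"
proof -
  have [measurable]: "Y \<in> borel_measurable M" using assms(1) by (simp add: indep_of_def)
  have "g -` D \<in> sets borel" if "D \<in> sets borel" for D
    using measurable_sets[OF assms(2) that] by simp
  moreover have "(\<lambda>\<omega>. g (Y \<omega>)) -` D \<inter> space M = Y -` (g -` D) \<inter> space M" for D by auto
  ultimately show ?thesis using assms(1) unfolding indep_of_def by simp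
qed

context prob_space
begin

lemma indep_of_joint_law:
  fixes Y :: "'a \<Rightarrow> 'd::topological_space"
  assumes F: "subalgebra M F" and Y: "indep_of M F Y" and U: "U \<in> measurable F N"
  shows "distr M N U \<Otimes>\<^sub>M distr M borel Y = distr M (N \<Otimes>\<^sub>M borel) (\<lambda>\<omega>. (U \<omega>, Y \<omega>))"
proof (rule pair_measure_eqI)
  have rv [measurable]: "U \<in> measurable M N" "Y \<in> borel_measurable M"
    using measurable_from_subalg[OF F U] Y by (auto simp: indep_of_def)
  show "sigma_finite_measure (distr M N U)" "sigma_finite_measure (distr M borel Y)"
    by (auto intro!: prob_space_imp_sigma_finite prob_space_distr)
  have sp: "space F = space M" using F by (simp add: subalgebra_def)
  fix A D assume "A \<in> sets (distr M N U)" "D \<in> sets (distr M borel Y)"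
  then have [measurable]: "A \<in> sets N" "D \<in> sets borel" by simp_all
  have "U -` A \<inter> space M \<in> sets F"
    using measurable_sets[OF U \<open>A \<in> sets N\<close>] sp by simp
  then have "prob ((U -` A \<inter> space M) \<inter> (Y -` D \<inter> space M)) = prob (U -` A \<inter> space M) * prob (Y -` D \<inter> space M)"
    using Y \<open>D \<in> sets borel\<close> unfolding indep_of_def by blast
  moreover have "(\<lambda>\<omega>. (U \<omega>, Y \<omega>)) -` (A \<times> D) \<inter> space M = (U -` A \<inter> space M) \<inter> (Y -` D \<inter> space M)" by auto
  ultimately show "emeasure (distr M N U) A * emeasure (distr M borel Y) D
      = emeasure (distr M (N \<Otimes>\<^sub>M borel) (\<lambda>\<omega>. (U \<omega>, Y \<omega>))) (A \<times> D)"
    by (simp add: emeasure_distr emeasure_eq_measure ennreal_mult)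
qed simp

text \<open>The freezing lemma in integrated form: the joint law is a product, so Fubini integrates
  out the independent variable while the known one is held fixed.\<close>

lemma expectation_freeze:
  fixes f :: "'c \<times> 'd::topological_space \<Rightarrow> real"
  assumes F: "subalgebra M F" and Y: "indep_of M F Y" and U: "U \<in> measurable F N"
    and f [measurable]: "f \<in> borel_measurable (N \<Otimes>\<^sub>M borel)" and bound: "\<And>x. \<bar>f x\<bar> \<le> C"
  shows "expectation (\<lambda>\<omega>. f (U \<omega>, Y \<omega>)) = expectation (\<lambda>\<omega>. \<integral>y. f (U \<omega>, y) \<partial>distr M borel Y)"
proof -
  have [measurable]: "U \<in> measurable M N" "Y \<in> borel_measurable M"
    using measurable_from_subalg[OF F U] Y by (auto simp: indep_of_def)
  interpret U: prob_space "distr M N U" by (rule prob_space_distr) simp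
  interpret Y: prob_space "distr M borel Y" by (rule prob_space_distr) simp
  interpret P: pair_prob_space "distr M N U" "distr M borel Y" ..
  have joint: "distr M N U \<Otimes>\<^sub>M distr M borel Y = distr M (N \<Otimes>\<^sub>M borel) (\<lambda>\<omega>. (U \<omega>, Y \<omega>))"
    by (rule indep_of_joint_law[OF F Y U])
  have int: "integrable (distr M N U \<Otimes>\<^sub>M distr M borel Y) f"
    by (rule P.P.integrable_const_bound[where B=C]) (use bound in auto)
  have "expectation (\<lambda>\<omega>. f (U \<omega>, Y \<omega>)) = (\<integral>x. f x \<partial>(distr M N U \<Otimes>\<^sub>M distr M borel Y))"
    unfolding joint by (subst integral_distr) auto
  also have "\<dots> = (\<integral>x. \<integral>y. f (x, y) \<partial>distr M borel Y \<partial>distr M N U)"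
    using P.integral_fst'[OF int] by simp
  also have "\<dots> = expectation (\<lambda>\<omega>. \<integral>y. f (U \<omega>, y) \<partial>distr M borel Y)"
    by (rule integral_distr) (auto intro!: Y.borel_measurable_lebesgue_integral simp: case_prod_beta')
  finally show ?thesis .
qed

end

definition generated_by :: "'w measure \<Rightarrow> ('i \<Rightarrow> 'w \<Rightarrow> 'b::topological_space) \<Rightarrow> 'i set \<Rightarrow> 'w measure" where
  "generated_by M Z A = sigma (space M) (\<Union>i\<in>A. {Z i -` S \<inter> space M | S. S \<in> sets borel})"

lemma space_generated_by [simp]: "space (generated_by M Z A) = space M"
  unfolding generated_by_def by (rule space_measure_of) auto

lemma sets_generated_by:
  "sets (generated_by M Z A) = sigma_sets (space M) (\<Union>i\<in>A. {Z i -` S \<inter> space M | S. S \<in> sets borel})"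
  unfolding generated_by_def by (rule sets_measure_of) auto

lemma measurable_generated_by: "i \<in> A \<Longrightarrow> Z i \<in> borel_measurable (generated_by M Z A)"
  by (rule measurableI) (auto simp: sets_generated_by)

lemma generated_by_mono: "A \<subseteq> A' \<Longrightarrow> sets (generated_by M Z A) \<subseteq> sets (generated_by M Z A')"
  unfolding sets_generated_by by (intro sigma_sets_mono' UN_mono) auto

text \<open>The indices are grouped into the two blocks \<open>A\<close> and \<open>{j}\<close>,
  labelled by booleans; the preimages under each variable are stable under intersection, so
  independence extends to the generated sigma-algebras.\<close>

lemma (in prob_space) indep_of_generated_by:
  assumes Z: "indep_vars (\<lambda>_. borel) Z I" and A: "A \<subseteq> I" "j \<in> I - A"
  shows "indep_of M (generated_by M Z A) (Z j)"
proof -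
  define E where "E i = {Z i -` S \<inter> space M | S. S \<in> sets borel}" for i
  define C where "C b = (if b then A else {j})" for b
  have E: "indep_sets E I"
    using Z unfolding indep_vars_def2 E_def[abs_def] by (rule conjunct2)
  have stable: "Int_stable (E i)" for i
  proof (rule Int_stableI)
    fix a b assume "a \<in> E i" "b \<in> E i"
    then obtain S T where ST: "S \<in> sets borel" "T \<in> sets borel" "a = Z i -` S \<inter> space M" "b = Z i -` T \<inter> space M"
      unfolding E_def by blast
    then have "a \<inter> b = Z i -` (S \<inter> T) \<inter> space M" by auto
    with ST(1,2) show "a \<inter> b \<in> E i" unfolding E_def by blast
  qed
  have "indep_sets (\<lambda>b. sigma_sets (space M) (\<Union>i\<in>C b. E i)) UNIV"
  proof (rule indep_sets_collect_sigma)
    show "indep_sets E (\<Union>b\<in>UNIV. C b)"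
      by (rule indep_sets_mono_index[OF _ E]) (use A in \<open>auto simp: C_def UNIV_bool\<close>)
    show "disjoint_family_on C UNIV"
      using A by (auto simp: disjoint_family_on_def C_def UNIV_bool)
  qed (rule stable)
  note ind = indep_setsD[OF this, of UNIV]
  have "prob (a \<inter> (Z j -` D \<inter> space M)) = prob a * prob (Z j -` D \<inter> space M)"
    if a: "a \<in> sets (generated_by M Z A)" and D: "D \<in> sets borel" for a D
  proof -
    have "a \<in> sigma_sets (space M) (\<Union>i\<in>C True. E i)"
      using a unfolding sets_generated_by C_def E_def by simp
    moreover have "Z j -` D \<inter> space M \<in> sigma_sets (space M) (\<Union>i\<in>C False. E i)"
      using D unfolding C_def E_def by (intro sigma_sets.Basic UN_I[of j]) auto
    ultimately show ?thesis
      using ind[of "\<lambda>b. if b then a else Z j -` D \<inter> space M"] by (simp add: UNIV_bool Int_commute)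
  qed
  moreover have "Z j \<in> borel_measurable M" using Z A(2) unfolding indep_vars_def2 by blast
  ultimately show ?thesis by (simp add: indep_of_def)
qed

section \<open>Dynamic programming for controlled random walks\<close>

text \<open>Induction on \<open>J\<close>: the new index takes over where its value is at least that
  of the current choice, and this region is measurable.\<close>

lemma argmax_measurable:
  fixes h :: "'k \<Rightarrow> 'a \<Rightarrow> real"
  assumes "finite J" "J \<noteq> {}" "\<And>k. k \<in> J \<Longrightarrow> h k \<in> borel_measurable N"
  shows "\<exists>sel\<in>measurable N (count_space J). \<forall>x\<in>space N. \<forall>k\<in>J. h k x \<le> h (sel x) x"
  using assms
proof (induction J rule: finite_ne_induct)
  case (singleton k)
  show ?case by (intro bexI[of _ "\<lambda>_. k"]) auto
next
  case (insert k J)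
  have "\<exists>sel\<in>measurable N (count_space J). \<forall>x\<in>space N. \<forall>j\<in>J. h j x \<le> h (sel x) x"
    by (rule insert.IH) (rule insert.prems, simp)
  then obtain sel where sel: "sel \<in> measurable N (count_space J)"
    "\<And>x j. x \<in> space N \<Longrightarrow> j \<in> J \<Longrightarrow> h j x \<le> h (sel x) x" by blast
  have hk: "h k \<in> borel_measurable N" by (rule insert.prems) simp
  have sel': "sel \<in> measurable N (count_space (insert k J))"
    by (rule measurable_compose[OF sel(1), of "\<lambda>x. x"]) auto
  have hsel: "(\<lambda>x. h (sel x) x) \<in> borel_measurable N"
  proof (rule measurable_compose_countable'[OF _ sel(1)])
    show "h j \<in> borel_measurable N" if "j \<in> J" for j
      by (rule insert.prems) (use that in simp)
    show "countable J" using insert.hyps(1) by (rule countable_finite)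
  qed
  define sel1 where "sel1 x = (if h (sel x) x \<le> h k x then k else sel x)" for x
  have "sel1 \<in> measurable N (count_space (insert k J))"
    unfolding sel1_def
  proof (rule measurable_If[OF _ sel'])
    show "{x \<in> space N. h (sel x) x \<le> h k x} \<in> sets N"
      by (rule borel_measurable_le[OF hsel hk])
  qed simp
  moreover have "h j x \<le> h (sel1 x) x" if "x \<in> space N" "j \<in> insert k J" for x j
  proof (cases "j = k")
    case False
    then have "h j x \<le> h (sel x) x" using sel(2) that by blast
    then show ?thesis unfolding sel1_def by simp
  qed (simp add: sel1_def)
  ultimately show ?case by blast
qed

lemma (in control_family) bellman_selector:
  assumes f: "bounded_lipschitz C L f"
  shows "\<exists>sel\<in>measurable borel (count_space J). \<forall>s. average (\<nu> (sel s)) f s = bellman J \<nu> f s"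
proof -
  have "average (\<nu> k) f \<in> borel_measurable borel" if "k \<in> J" for k
    by (rule bounded_lipschitz_measurable[OF bounded_lipschitz_average[OF f borel_prob_\<nu>[OF that]]])
  from argmax_measurable[OF finite_J nonempty_J, where h="\<lambda>k. average (\<nu> k) f", OF this]
  obtain sel where sel: "sel \<in> measurable borel (count_space J)"
    "\<And>s k. k \<in> J \<Longrightarrow> average (\<nu> k) f s \<le> average (\<nu> (sel s)) f s"
    by (metis UNIV_I space_borel)
  have "average (\<nu> (sel s)) f s = bellman J \<nu> f s" for s
  proof (rule antisym)
    have "sel s \<in> J" using measurable_space[OF sel(1)] by simp
    then show "average (\<nu> (sel s)) f s \<le> bellman J \<nu> f s" by (rule bellman_ge)
    show "bellman J \<nu> f s \<le> average (\<nu> (sel s)) f s"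
    proof -
      obtain k where "k \<in> J" "bellman J \<nu> f s = average (\<nu> k) f s" using bellman_attained by blast
      then show ?thesis using sel(2)[of k s] by simp
    qed
  qed
  with sel(1) show ?thesis by blast
qed

text \<open>The step actually taken depends on \<open>F\<close> through the choice, so it cannot be
  frozen directly. Splitting according to the chosen index leaves a fixed \<open>\<zeta> k\<close>,
  which is independent of \<open>F\<close>.\<close>

lemma (in prob_space) expectation_controlled_step:
  fixes f :: "'b::{real_normed_vector, second_countable_topology} \<Rightarrow> real"
  assumes F: "subalgebra M F" and "finite J"
    and S: "S \<in> borel_measurable F" and \<theta>: "\<theta> \<in> measurable F (count_space J)"
    and \<zeta>: "\<And>k. k \<in> J \<Longrightarrow> indep_of M F (\<zeta> k)"
    and \<nu>: "\<And>k. k \<in> J \<Longrightarrow> distr M borel (\<zeta> k) = \<nu> k"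
    and f: "bounded_lipschitz C L f"
  shows "expectation (\<lambda>\<omega>. f (S \<omega> + \<zeta> (\<theta> \<omega>) \<omega>)) = expectation (\<lambda>\<omega>. average (\<nu> (\<theta> \<omega>)) f (S \<omega>))"
proof -
  note [measurable] = bounded_lipschitz_measurable[OF f]
  have sp: "space F = space M" using F by (simp add: subalgebra_def)
  have \<theta>J: "\<theta> \<omega> \<in> J" if "\<omega> \<in> space M" for \<omega>
    using measurable_space[OF \<theta>] that sp by simp
  have C: "0 \<le> C" by (rule bounded_lipschitz_nonneg[OF f])
  note SM = measurable_from_subalg[OF F S] and \<theta>M = measurable_from_subalg[OF F \<theta>]
  define I where "I k \<omega> = (if \<theta> \<omega> = k then 1 else 0 :: real)" for k \<omega>
  have I: "I k \<in> borel_measurable F" if "k \<in> J" for k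
    unfolding I_def
    by (rule measurable_compose[OF \<theta>, where g="\<lambda>j. if j = k then 1 else 0"]) simp
  have IM: "I k \<in> borel_measurable M" if "k \<in> J" for k
    by (rule measurable_from_subalg[OF F I[OF that]])
  have split: "g (\<theta> \<omega>) = (\<Sum>k\<in>J. I k \<omega> * g k)" if "\<omega> \<in> space M" for g and \<omega>
    using \<open>finite J\<close> \<theta>J[OF that] by (simp add: I_def if_distrib[of "\<lambda>x. x * _"] sum.delta cong: if_cong)
  have term_eq: "expectation (\<lambda>\<omega>. I k \<omega> * f (S \<omega> + \<zeta> k \<omega>)) = expectation (\<lambda>\<omega>. I k \<omega> * average (\<nu> k) f (S \<omega>))"
    if k: "k \<in> J" for k
  proof -
    \<comment> \<open>The indicator of the choice and the state are frozen together. Testing for the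
      value 1 instead of multiplying keeps \<open>g\<close> bounded by \<open>C\<close> for all real
      arguments.\<close>
    define g where "g = (\<lambda>x. if fst (fst x) = (1::real) then f (snd (fst x) + snd x) else 0)"
    have "expectation (\<lambda>\<omega>. g ((I k \<omega>, S \<omega>), \<zeta> k \<omega>))
        = expectation (\<lambda>\<omega>. \<integral>y. g ((I k \<omega>, S \<omega>), y) \<partial>distr M borel (\<zeta> k))"
    proof (rule expectation_freeze[OF F \<zeta>[OF k], where N="borel \<Otimes>\<^sub>M borel" and C=C])
      show "(\<lambda>\<omega>. (I k \<omega>, S \<omega>)) \<in> measurable F (borel \<Otimes>\<^sub>M borel)"
        using I[OF k] S by measurable
      show "g \<in> borel_measurable ((borel \<Otimes>\<^sub>M borel) \<Otimes>\<^sub>M borel)"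
        unfolding g_def by measurable
      show "\<bar>g x\<bar> \<le> C" for x
        unfolding g_def using bounded_lipschitzD(1)[OF f] C by auto
    qed
    also have "(\<lambda>\<omega>. g ((I k \<omega>, S \<omega>), \<zeta> k \<omega>)) = (\<lambda>\<omega>. I k \<omega> * f (S \<omega> + \<zeta> k \<omega>))"
      by (auto simp: g_def I_def)
    also have "(\<lambda>\<omega>. \<integral>y. g ((I k \<omega>, S \<omega>), y) \<partial>distr M borel (\<zeta> k)) = (\<lambda>\<omega>. I k \<omega> * average (\<nu> k) f (S \<omega>))"
      by (auto simp: g_def I_def average_def \<nu>[OF k])
    finally show ?thesis .
  qed
  have int1: "integrable M (\<lambda>\<omega>. I k \<omega> * f (S \<omega> + \<zeta> k \<omega>))" if k: "k \<in> J" for k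
  proof (rule integrable_const_bound[where B=C])
    have [measurable]: "\<zeta> k \<in> borel_measurable M" using \<zeta>[OF k] by (simp add: indep_of_def)
    note [measurable] = SM IM[OF k]
    show "(\<lambda>\<omega>. I k \<omega> * f (S \<omega> + \<zeta> k \<omega>)) \<in> borel_measurable M" by measurable
  qed (use bounded_lipschitzD(1)[OF f] C in \<open>auto simp: I_def\<close>)
  have A: "bounded_lipschitz C L (average (\<nu> k) f)" if k: "k \<in> J" for k
    using borel_prob_distr[OF prob_space_axioms, of "\<zeta> k"] \<zeta>[OF k] \<nu>[OF k]
    by (intro bounded_lipschitz_average[OF f]) (simp add: indep_of_def)
  have int2: "integrable M (\<lambda>\<omega>. I k \<omega> * average (\<nu> k) f (S \<omega>))" if k: "k \<in> J" for k
  proof (rule integrable_const_bound[where B=C])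
    note [measurable] = SM IM[OF k] bounded_lipschitz_measurable[OF A[OF k]]
    show "(\<lambda>\<omega>. I k \<omega> * average (\<nu> k) f (S \<omega>)) \<in> borel_measurable M" by measurable
  qed (use bounded_lipschitzD(1)[OF A[OF k]] C in \<open>auto simp: I_def\<close>)
  have "expectation (\<lambda>\<omega>. f (S \<omega> + \<zeta> (\<theta> \<omega>) \<omega>)) = expectation (\<lambda>\<omega>. \<Sum>k\<in>J. I k \<omega> * f (S \<omega> + \<zeta> k \<omega>))"
    by (rule Bochner_Integration.integral_cong[OF refl]) (rule split)
  also have "\<dots> = (\<Sum>k\<in>J. expectation (\<lambda>\<omega>. I k \<omega> * f (S \<omega> + \<zeta> k \<omega>)))"
    by (rule Bochner_Integration.integral_sum) (rule int1)
  also have "\<dots> = (\<Sum>k\<in>J. expectation (\<lambda>\<omega>. I k \<omega> * average (\<nu> k) f (S \<omega>)))"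
    by (rule sum.cong[OF refl]) (rule term_eq)
  also have "\<dots> = expectation (\<lambda>\<omega>. \<Sum>k\<in>J. I k \<omega> * average (\<nu> k) f (S \<omega>))"
    by (rule Bochner_Integration.integral_sum[symmetric]) (rule int2)
  also have "\<dots> = expectation (\<lambda>\<omega>. average (\<nu> (\<theta> \<omega>)) f (S \<omega>))"
    by (rule Bochner_Integration.integral_cong[OF refl]) (rule split[symmetric])
  finally show ?thesis .
qed

text \<open>Common frame for bandit strategies and grid controls. \<open>F i\<close> is the
  information before step \<open>i\<close>; each \<open>\<zeta> i k\<close> is a potential step, of
  which only the chosen one is taken.\<close>

locale controlled_walk = prob_space M + control_family J \<nu>
  for M :: "'w measure" and J :: "'k set"
    and \<nu> :: "'k \<Rightarrow> 'b::{real_normed_vector, second_countable_topology} measure" +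
  fixes N :: nat and F :: "nat \<Rightarrow> 'w measure" and S :: "nat \<Rightarrow> 'w \<Rightarrow> 'b"
    and \<theta> :: "nat \<Rightarrow> 'w \<Rightarrow> 'k" and \<zeta> :: "nat \<Rightarrow> 'k \<Rightarrow> 'w \<Rightarrow> 'b"
  assumes F: "\<And>i. i < N \<Longrightarrow> subalgebra M (F i)"
    and S_measurable: "\<And>i. i < N \<Longrightarrow> S i \<in> borel_measurable (F i)"
    and \<theta>_measurable: "\<And>i. i < N \<Longrightarrow> \<theta> i \<in> measurable (F i) (count_space J)"
    and \<zeta>_indep: "\<And>i k. i < N \<Longrightarrow> k \<in> J \<Longrightarrow> indep_of M (F i) (\<zeta> i k)"
    and \<zeta>_law: "\<And>i k. i < N \<Longrightarrow> k \<in> J \<Longrightarrow> distr M borel (\<zeta> i k) = \<nu> k"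
    and S_0: "\<And>\<omega>. \<omega> \<in> space M \<Longrightarrow> S 0 \<omega> = 0"
    and S_Suc: "\<And>i \<omega>. i < N \<Longrightarrow> \<omega> \<in> space M \<Longrightarrow> S (Suc i) \<omega> = S i \<omega> + \<zeta> i (\<theta> i \<omega>) \<omega>"
begin

lemma expectation_step:
  assumes "i < N" and f: "bounded_lipschitz C L f"
  shows "expectation (\<lambda>\<omega>. f (S (Suc i) \<omega>)) = expectation (\<lambda>\<omega>. average (\<nu> (\<theta> i \<omega>)) f (S i \<omega>))"
proof -
  have "expectation (\<lambda>\<omega>. f (S (Suc i) \<omega>)) = expectation (\<lambda>\<omega>. f (S i \<omega> + \<zeta> i (\<theta> i \<omega>) \<omega>))"
    by (rule Bochner_Integration.integral_cong) (use S_Suc[OF \<open>i < N\<close>] in auto)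
  also have "\<dots> = expectation (\<lambda>\<omega>. average (\<nu> (\<theta> i \<omega>)) f (S i \<omega>))"
    using assms finite_J
    by (intro expectation_controlled_step[where F="F i" and J=J and C=C and L=L])
      (auto intro: F S_measurable \<theta>_measurable \<zeta>_indep \<zeta>_law)
  finally show ?thesis .
qed

lemma \<theta>_in: "i < N \<Longrightarrow> \<omega> \<in> space M \<Longrightarrow> \<theta> i \<omega> \<in> J"
  using measurable_space[OF measurable_from_subalg[OF F \<theta>_measurable]] by fastforce

text \<open>Evaluated along the walk, the value-to-go has nonincreasing expectation: one step
  averages it with some index, and the operator takes the best index.\<close>

lemma expectation_le_bellman:
  assumes u: "bounded_lipschitz C L u"
  shows "expectation (\<lambda>\<omega>. u (S N \<omega>)) \<le> (bellman J \<nu> ^^ N) u 0"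
proof -
  define f where "f j = (bellman J \<nu> ^^ j) u" for j
  have f: "bounded_lipschitz C L (f j)" for j
    unfolding f_def by (rule bounded_lipschitz_bellman_funpow[OF u])
  have "expectation (\<lambda>\<omega>. f (N - j) (S j \<omega>)) \<le> f N 0" if "j \<le> N" for j
    using that
  proof (induction j)
    case 0
    have "expectation (\<lambda>\<omega>. f (N - 0) (S 0 \<omega>)) = expectation (\<lambda>\<omega>. f N 0)"
      by (rule Bochner_Integration.integral_cong) (auto simp: S_0)
    then show ?case by (simp add: prob_space)
  next
    case (Suc j)
    then have "j < N" by simp
    note SM = measurable_from_subalg[OF F S_measurable, OF \<open>j < N\<close> \<open>j < N\<close>]
    have fs: "f (N - j) = bellman J \<nu> (f (N - Suc j))"
    proof -
      have "N - j = Suc (N - Suc j)" using \<open>j < N\<close> by simp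
      then show ?thesis unfolding f_def by simp
    qed
    have "expectation (\<lambda>\<omega>. f (N - Suc j) (S (Suc j) \<omega>))
        = expectation (\<lambda>\<omega>. average (\<nu> (\<theta> j \<omega>)) (f (N - Suc j)) (S j \<omega>))"
      by (rule expectation_step[OF \<open>j < N\<close> f])
    also have "\<dots> \<le> expectation (\<lambda>\<omega>. f (N - j) (S j \<omega>))"
    proof (rule integral_mono)
      have A: "bounded_lipschitz C L (average (\<nu> k) (f i))" if "k \<in> J" for k i
        by (rule bounded_lipschitz_average[OF f borel_prob_\<nu>[OF that]])
      show "integrable M (\<lambda>\<omega>. f (N - j) (S j \<omega>))"
        using bounded_lipschitzD(1)[OF f] measurable_compose[OF SM bounded_lipschitz_measurable[OF f]]
        by (intro integrable_const_bound[where B=C]) auto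
      show "integrable M (\<lambda>\<omega>. average (\<nu> (\<theta> j \<omega>)) (f (N - Suc j)) (S j \<omega>))"
      proof (rule integrable_const_bound[where B=C])
        show "(\<lambda>\<omega>. average (\<nu> (\<theta> j \<omega>)) (f (N - Suc j)) (S j \<omega>)) \<in> borel_measurable M"
          by (rule measurable_compose_countable'[OF _ measurable_from_subalg[OF F \<theta>_measurable, OF \<open>j < N\<close> \<open>j < N\<close>]])
            (use finite_J in \<open>auto intro: countable_finite measurable_compose[OF SM bounded_lipschitz_measurable[OF A]]\<close>)
        show "AE \<omega> in M. norm (average (\<nu> (\<theta> j \<omega>)) (f (N - Suc j)) (S j \<omega>)) \<le> C"
          using bounded_lipschitzD(1)[OF A] \<theta>_in[OF \<open>j < N\<close>] by (intro AE_I2) simp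
      qed
      show "average (\<nu> (\<theta> j \<omega>)) (f (N - Suc j)) (S j \<omega>) \<le> f (N - j) (S j \<omega>)" if "\<omega> \<in> space M" for \<omega>
        unfolding fs by (rule bellman_ge[OF \<theta>_in[OF \<open>j < N\<close> that]])
    qed
    finally show ?case using Suc by simp
  qed
  from this[of N] show ?thesis by (simp add: f_def)
qed

text \<open>If every choice attains the maximum, no step loses anything and the chain of
  inequalities becomes one of equalities.\<close>

lemma expectation_eq_bellman:
  assumes u: "bounded_lipschitz C L u"
    and greedy: "\<And>i \<omega>. i < N \<Longrightarrow> \<omega> \<in> space M \<Longrightarrow>
      average (\<nu> (\<theta> i \<omega>)) ((bellman J \<nu> ^^ (N - Suc i)) u) (S i \<omega>)
        = (bellman J \<nu> ^^ (N - i)) u (S i \<omega>)"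
  shows "expectation (\<lambda>\<omega>. u (S N \<omega>)) = (bellman J \<nu> ^^ N) u 0"
proof -
  define f where "f j = (bellman J \<nu> ^^ j) u" for j
  have f: "bounded_lipschitz C L (f j)" for j
    unfolding f_def by (rule bounded_lipschitz_bellman_funpow[OF u])
  have "expectation (\<lambda>\<omega>. f (N - j) (S j \<omega>)) = f N 0" if "j \<le> N" for j
    using that
  proof (induction j)
    case 0
    have "expectation (\<lambda>\<omega>. f (N - 0) (S 0 \<omega>)) = expectation (\<lambda>\<omega>. f N 0)"
      by (rule Bochner_Integration.integral_cong) (auto simp: S_0)
    then show ?case by (simp add: prob_space)
  next
    case (Suc j)
    then have "j < N" by simp
    have "expectation (\<lambda>\<omega>. f (N - Suc j) (S (Suc j) \<omega>))
        = expectation (\<lambda>\<omega>. average (\<nu> (\<theta> j \<omega>)) (f (N - Suc j)) (S j \<omega>))"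
      by (rule expectation_step[OF \<open>j < N\<close> f])
    also have "\<dots> = expectation (\<lambda>\<omega>. f (N - j) (S j \<omega>))"
      by (rule Bochner_Integration.integral_cong) (use greedy[OF \<open>j < N\<close>] in \<open>auto simp: f_def\<close>)
    finally show ?case using Suc by simp
  qed
  from this[of N] show ?thesis by (simp add: f_def)
qed

end

section \<open>Diffusively rescaled steps and their consistency\<close>

definition scaled_law ::
    "'w measure \<Rightarrow> ('w \<Rightarrow> real) \<Rightarrow> ('w \<Rightarrow> real) \<Rightarrow> nat \<Rightarrow> (real \<times> real) measure" where
  "scaled_law P A Y n = distr P borel (\<lambda>\<omega>. (A \<omega> / n, Y \<omega> / sqrt n))"

lemma scaled_law_gauge:
  fixes n :: nat
  assumes "0 < n"
  shows "n * taylor_gauge (a / n, y / sqrt n)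
    = a\<^sup>2 / n + \<bar>a\<bar> * \<bar>y\<bar> / sqrt n + min (y\<^sup>2) (\<bar>y\<bar>^3 / sqrt n)"
proof -
  have n: "0 < real n" using assms by simp
  have s: "sqrt n * sqrt n = real n" "0 < sqrt n" "\<bar>sqrt n\<bar> = sqrt n" using n by simp_all
  have 1: "n * (a / n)\<^sup>2 = a\<^sup>2 / n" using n by (simp add: power2_eq_square)
  have 2: "n * (\<bar>a / n\<bar> * \<bar>y / sqrt n\<bar>) = \<bar>a\<bar> * \<bar>y\<bar> / sqrt n" using n by simp
  have 3: "n * (y / sqrt n)\<^sup>2 = y\<^sup>2" using n by (simp add: power_divide)
  have 4: "n * \<bar>y / sqrt n\<bar>^3 = \<bar>y\<bar>^3 / sqrt n"
  proof -
    have "n * \<bar>y / sqrt n\<bar>^3 = \<bar>y\<bar>^3 * n / (sqrt n * sqrt n * sqrt n)"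
      using s(3) by (simp add: power_divide power3_eq_cube mult.assoc)
    then show ?thesis using s(1) n by simp
  qed
  have "n * min ((y / sqrt n)\<^sup>2) (\<bar>y / sqrt n\<bar>^3) = min (y\<^sup>2) (\<bar>y\<bar>^3 / sqrt n)"
    using n by (simp only: 3[symmetric] 4[symmetric] min_mult_distrib_left) simp
  with 1 2 show ?thesis unfolding taylor_gauge_def fst_conv snd_conv distrib_left by simp
qed

text \<open>Dominated convergence: the rescaled gauge tends to 0 pointwise and stays below
  \<open>B\<close>, which is integrable by the second moments alone.\<close>

lemma scaled_law_gauge_tendsto:
  assumes "prob_space P" and [measurable]: "A \<in> borel_measurable P" "Y \<in> borel_measurable P"
    and A2: "integrable P (\<lambda>\<omega>. (A \<omega>)\<^sup>2)" and Y2: "integrable P (\<lambda>\<omega>. (Y \<omega>)\<^sup>2)"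
  shows "(\<lambda>n. n * (\<integral>v. taylor_gauge v \<partial>scaled_law P A Y n)) \<longlonglongrightarrow> 0"
proof -
  interpret prob_space P by fact
  define B where "B \<omega> = (A \<omega>)\<^sup>2 + \<bar>A \<omega>\<bar> * \<bar>Y \<omega>\<bar> + (Y \<omega>)\<^sup>2" for \<omega>
  define g where "g n \<omega> = (A \<omega>)\<^sup>2 / real n + \<bar>A \<omega>\<bar> * \<bar>Y \<omega>\<bar> / sqrt (real n)
    + min ((Y \<omega>)\<^sup>2) (\<bar>Y \<omega>\<bar>^3 / sqrt (real n))" for n :: nat and \<omega>
  have "(\<lambda>n. expectation (g n)) \<longlonglongrightarrow> expectation (\<lambda>\<omega>. 0)"
  proof (rule integral_dominated_convergence[where w=B])
    show "integrable P B"
      unfolding B_def by (intro Bochner_Integration.integrable_add integrable_abs_mult_squares A2 Y2) measurable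
    show "g n \<in> borel_measurable P" for n unfolding g_def by measurable
    show "AE \<omega> in P. (\<lambda>n. g n \<omega>) \<longlonglongrightarrow> 0"
    proof (rule AE_I2)
      fix \<omega>
      have "(\<lambda>n. (A \<omega>)\<^sup>2 / real n) \<longlonglongrightarrow> 0" "(\<lambda>n. \<bar>A \<omega>\<bar> * \<bar>Y \<omega>\<bar> / sqrt (real n)) \<longlonglongrightarrow> 0"
        "(\<lambda>n. \<bar>Y \<omega>\<bar>^3 / sqrt (real n)) \<longlonglongrightarrow> 0"
        by (intro real_tendsto_divide_at_top[OF tendsto_const] filterlim_real_sequentially
            filterlim_compose[OF sqrt_at_top filterlim_real_sequentially])+
      then have "(\<lambda>n. g n \<omega>) \<longlonglongrightarrow> 0 + 0 + min ((Y \<omega>)\<^sup>2) 0"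
        unfolding g_def by (intro tendsto_add tendsto_min tendsto_const)
      then show "(\<lambda>n. g n \<omega>) \<longlonglongrightarrow> 0" by (simp add: min_absorb2)
    qed
    show "AE \<omega> in P. norm (g n \<omega>) \<le> B \<omega>" for n
    proof (rule AE_I2)
      fix \<omega>
      \<comment> \<open>The alternative \<open>r = 0\<close> covers \<open>n = 0\<close>, where
        division by zero returns 0.\<close>
      have "x / r \<le> x" if "0 \<le> x" "1 \<le> r \<or> r = 0" for x r :: real
        using that divide_left_mono[of 1 r x] by auto
      moreover have "1 \<le> real n \<or> real n = 0" "1 \<le> sqrt (real n) \<or> sqrt (real n) = 0" by auto
      ultimately have "(A \<omega>)\<^sup>2 / real n \<le> (A \<omega>)\<^sup>2" "\<bar>A \<omega>\<bar> * \<bar>Y \<omega>\<bar> / sqrt (real n) \<le> \<bar>A \<omega>\<bar> * \<bar>Y \<omega>\<bar>"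
        by simp_all
      moreover have "min ((Y \<omega>)\<^sup>2) (\<bar>Y \<omega>\<bar>^3 / sqrt (real n)) \<le> (Y \<omega>)\<^sup>2" by simp
      ultimately have "g n \<omega> \<le> B \<omega>" unfolding g_def B_def by (intro add_mono)
      moreover have "0 \<le> g n \<omega>" unfolding g_def by (intro add_nonneg_nonneg) auto
      ultimately show "norm (g n \<omega>) \<le> B \<omega>" by simp
    qed
  qed simp_all
  moreover have "n * (\<integral>v. taylor_gauge v \<partial>scaled_law P A Y n) = expectation (g n)" if "0 < n" for n :: nat
  proof -
    have "(\<integral>v. taylor_gauge v \<partial>scaled_law P A Y n) = expectation (\<lambda>\<omega>. taylor_gauge (A \<omega> / n, Y \<omega> / sqrt n))"
    proof -
      have "(\<lambda>\<omega>. (A \<omega> / n, Y \<omega> / sqrt n)) \<in> measurable P borel"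
        unfolding borel_prod[symmetric] by measurable
      then show ?thesis
        unfolding scaled_law_def by (rule integral_distr) (rule taylor_gauge_measurable)
    qed
    then have "n * (\<integral>v. taylor_gauge v \<partial>scaled_law P A Y n)
        = expectation (\<lambda>\<omega>. n * taylor_gauge (A \<omega> / n, Y \<omega> / sqrt n))" by simp
    then show ?thesis unfolding scaled_law_gauge[OF that] g_def .
  qed
  then have "\<forall>\<^sub>F n in sequentially. n * (\<integral>v. taylor_gauge v \<partial>scaled_law P A Y n) = expectation (g n)"
    by (rule eventually_mono[OF eventually_gt_at_top[of 0]])
  ultimately show ?thesis by (simp add: tendsto_cong)
qed

lemma consistent_scaled_law:
  assumes "finite J" "J \<noteq> {}"
    and P: "\<And>k. k \<in> J \<Longrightarrow> prob_space (P k)"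
    and A: "\<And>k. k \<in> J \<Longrightarrow> A k \<in> borel_measurable (P k)"
    and Y: "\<And>k. k \<in> J \<Longrightarrow> Y k \<in> borel_measurable (P k)"
    and A2: "\<And>k. k \<in> J \<Longrightarrow> integrable (P k) (\<lambda>\<omega>. (A k \<omega>)\<^sup>2)"
    and Y2: "\<And>k. k \<in> J \<Longrightarrow> integrable (P k) (\<lambda>\<omega>. (Y k \<omega>)\<^sup>2)"
    and m: "\<And>k. k \<in> J \<Longrightarrow> (\<integral>\<omega>. Y k \<omega> \<partial>P k) = 0"
      "\<And>k. k \<in> J \<Longrightarrow> m k = (\<integral>\<omega>. A k \<omega> \<partial>P k, \<integral>\<omega>. (Y k \<omega>)\<^sup>2 \<partial>P k)"
  shows "consistent J m (\<lambda>n k. scaled_law (P k) (A k) (Y k) n)"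
proof -
  have "borel_prob (scaled_law (P k) (A k) (Y k) n) \<and>
      integrable (scaled_law (P k) (A k) (Y k) n) (\<lambda>v. (fst v)\<^sup>2) \<and>
      integrable (scaled_law (P k) (A k) (Y k) n) (\<lambda>v. (snd v)\<^sup>2) \<and>
      (\<integral>v. fst v \<partial>scaled_law (P k) (A k) (Y k) n) = fst (m k) / n \<and>
      (\<integral>v. snd v \<partial>scaled_law (P k) (A k) (Y k) n) = 0 \<and>
      (\<integral>v. (snd v)\<^sup>2 \<partial>scaled_law (P k) (A k) (Y k) n) = snd (m k) / n"
    if n: "0 < n" and k: "k \<in> J" for n k
  proof -
    have [measurable]: "A k \<in> borel_measurable (P k)" "Y k \<in> borel_measurable (P k)"
      using A[OF k] Y[OF k] .
    let ?v = "\<lambda>\<omega>. (A k \<omega> / n, Y k \<omega> / sqrt n)"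
    have v: "?v \<in> measurable (P k) borel" unfolding borel_prod[symmetric] by measurable
    have i: "integrable (distr (P k) borel ?v) f \<longleftrightarrow> integrable (P k) (\<lambda>\<omega>. f (?v \<omega>))"
      "(\<integral>v. f v \<partial>distr (P k) borel ?v) = (\<integral>\<omega>. f (?v \<omega>) \<partial>P k)"
      if "f \<in> borel_measurable borel" for f :: "real \<times> real \<Rightarrow> real"
      using integrable_distr_eq[OF v that] integral_distr[OF v that] by auto
    have f: "(\<lambda>v. (fst v)\<^sup>2) \<in> borel_measurable (borel :: (real \<times> real) measure)"
      "(\<lambda>v. (snd v)\<^sup>2) \<in> borel_measurable (borel :: (real \<times> real) measure)"
      "fst \<in> borel_measurable (borel :: (real \<times> real) measure)"
      "snd \<in> borel_measurable (borel :: (real \<times> real) measure)"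
      unfolding borel_prod[symmetric] by measurable
    show ?thesis
      unfolding scaled_law_def i[OF f(1)] i[OF f(2)] i[OF f(3)] i[OF f(4)]
      using borel_prob_distr[OF P[OF k] v] A2[OF k] Y2[OF k] m(1)[OF k] m(2)[OF k] n
      by (simp add: power_divide)
  qed
  moreover have "(\<lambda>n. n * (\<integral>v. taylor_gauge v \<partial>scaled_law (P k) (A k) (Y k) n)) \<longlonglongrightarrow> 0" if "k \<in> J" for k
    by (rule scaled_law_gauge_tendsto[OF P A Y A2 Y2]) fact+
  ultimately show ?thesis unfolding consistent_def using assms(1,2) by blast
qed

lemma (in prob_space) indep_of_expectation_mult:
  fixes Y :: "'a \<Rightarrow> real"
  assumes F: "subalgebra M F" and Y: "indep_of M F Y" and \<eta>: "\<eta> \<in> borel_measurable F"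
    and int: "integrable M \<eta>" "integrable M Y"
  shows "integrable M (\<lambda>\<omega>. \<eta> \<omega> * Y \<omega>)" "expectation (\<lambda>\<omega>. \<eta> \<omega> * Y \<omega>) = expectation \<eta> * expectation Y"
proof -
  have "indep_var borel \<eta> borel Y"
    unfolding indep_var_distribution_eq
    using indep_of_joint_law[OF F Y \<eta>] int by auto
  from indep_var_integrable[OF this int] indep_var_lebesgue_integral[OF this int]
  show "integrable M (\<lambda>\<omega>. \<eta> \<omega> * Y \<omega>)" "expectation (\<lambda>\<omega>. \<eta> \<omega> * Y \<omega>) = expectation \<eta> * expectation Y" .
qed

section \<open>The bandit problem\<close>

lemma integral_distr_eq:
  fixes f :: "'b \<Rightarrow> real"
  assumes "distr M N X = distr M N Y" "X \<in> measurable M N" "Y \<in> measurable M N" "f \<in> borel_measurable N"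
  shows "integrable M (\<lambda>\<omega>. f (X \<omega>)) \<longleftrightarrow> integrable M (\<lambda>\<omega>. f (Y \<omega>))"
    "(\<integral>\<omega>. f (X \<omega>) \<partial>M) = (\<integral>\<omega>. f (Y \<omega>) \<partial>M)"
  using assms integrable_distr_eq[OF assms(2,4)] integrable_distr_eq[OF assms(3,4)]
    integral_distr[OF assms(2,4)] integral_distr[OF assms(3,4)] by simp_all

lemma indep_of_mono: "indep_of M G Y \<Longrightarrow> sets F \<subseteq> sets G \<Longrightarrow> indep_of M F Y"
  unfolding indep_of_def by (meson subsetD)

section \<open>Histories as generated sigma-algebras\<close>

lemma history_generators_subset:
  "{reward X \<theta> i -` S \<inter> space M | i S. i \<in> {1..n} \<and> S \<in> sets borel} \<union>
    {\<theta> i -` S \<inter> space M | i S. i \<in> {1..n} \<and> S \<in> sets (count_space UNIV)} \<subseteq> Pow (space M)"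
  by auto

lemma space_history [simp]: "space (history M X \<theta> n) = space M"
  unfolding history_def by (rule space_measure_of[OF history_generators_subset])

lemma sets_history:
  "sets (history M X \<theta> n) = sigma_sets (space M)
     ({reward X \<theta> i -` S \<inter> space M | i S. i \<in> {1..n} \<and> S \<in> sets borel} \<union>
      {\<theta> i -` S \<inter> space M | i S. i \<in> {1..n} \<and> S \<in> sets (count_space UNIV)})"
  unfolding history_def by (rule sets_measure_of[OF history_generators_subset])

lemma reward_measurable_history:
  assumes "i \<in> {1..n}"
  shows "reward X \<theta> i \<in> borel_measurable (history M X \<theta> n)"
  by (rule measurableI) (use assms in \<open>auto simp: sets_history intro!: sigma_sets.Basic\<close>)

lemma choice_measurable_history:
  assumes "i \<in> {1..n}" "\<And>\<omega>. \<omega> \<in> space M \<Longrightarrow> \<theta> i \<omega> \<in> A"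
  shows "\<theta> i \<in> measurable (history M X \<theta> n) (count_space A)"
proof (rule measurableI)
  fix S assume "S \<in> sets (count_space A)"
  show "\<theta> i -` S \<inter> space (history M X \<theta> n) \<in> sets (history M X \<theta> n)"
    unfolding sets_history space_history using assms(1)
    by (intro sigma_sets.Basic UnI2) auto
qed (use assms(2) in auto)

text \<open>The history uses all sets of naturals as targets, whereas choices are measurable into
  \<open>count_space A\<close>. Intersecting a target with \<open>A\<close> leaves the preimage
  unchanged, because the choices take values in \<open>A\<close>.\<close>

lemma history_least:
  assumes "space N = space M"
    and "\<And>i. i \<in> {1..n} \<Longrightarrow> reward X \<theta> i \<in> borel_measurable N"
    and "\<And>i. i \<in> {1..n} \<Longrightarrow> \<theta> i \<in> measurable N (count_space A)"
  shows "sets (history M X \<theta> n) \<subseteq> sets N"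
  unfolding sets_history
proof (rule sets.sigma_sets_subset'[of _ N, simplified assms(1)])
  have "\<theta> i -` S \<inter> space N \<in> sets N" if "i \<in> {1..n}" for i S
  proof -
    have "\<theta> i -` (S \<inter> A) \<inter> space N \<in> sets N"
      by (rule measurable_sets[OF assms(3)[OF that]]) auto
    moreover have "\<theta> i -` (S \<inter> A) \<inter> space N = \<theta> i -` S \<inter> space N"
      using measurable_space[OF assms(3)[OF that]] by auto
    ultimately show ?thesis by simp
  qed
  moreover have "reward X \<theta> i -` S \<inter> space N \<in> sets N" if "i \<in> {1..n}" "S \<in> sets borel" for i S
    by (rule measurable_sets[OF assms(2)[OF that(1)] that(2)])
  ultimately show "{reward X \<theta> i -` S \<inter> space M | i S. i \<in> {1..n} \<and> S \<in> sets borel} \<union>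
      {\<theta> i -` S \<inter> space M | i S. i \<in> {1..n} \<and> S \<in> sets (count_space UNIV)} \<subseteq> sets N"
    using assms(1) by auto
qed (metis assms(1) sets.top)

lemma history_mono:
  assumes "n \<le> n'"
  shows "sets (history M X \<theta> n) \<subseteq> sets (history M X \<theta> n')"
proof -
  have "{1..n} \<subseteq> {1..n'}" using assms by simp
  then show ?thesis unfolding sets_history by (intro sigma_sets_mono' Un_mono) blast+
qed

locale bandit = prob_space M for M :: "'w measure" +
  fixes K :: nat and X :: "nat \<Rightarrow> 'w \<Rightarrow> real" and Xs :: "nat \<Rightarrow> nat \<Rightarrow> 'w \<Rightarrow> real"
  assumes K: "K \<ge> 1"
    and finite_mean: "\<And>k. k \<in> {1..K} \<Longrightarrow> integrable M (X k)"
    and finite_variance: "\<And>k. k \<in> {1..K} \<Longrightarrow> integrable M (\<lambda>\<omega>. (X k \<omega> - expectation (X k))\<^sup>2)"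
    and copies: "\<And>k n. k \<in> {1..K} \<Longrightarrow> n \<ge> 1 \<Longrightarrow> distr M borel (Xs k n) = distr M borel (X k)"
    and indep: "indep_vars (\<lambda>_. borel) (\<lambda>(k, n). Xs k n) ({1..K} \<times> {1..})"
begin

abbreviation "H \<equiv> history M Xs"

lemma Xs_measurable [measurable]: "k \<in> {1..K} \<Longrightarrow> n \<ge> 1 \<Longrightarrow> Xs k n \<in> borel_measurable M"
  using indep by (auto simp: indep_vars_def2)

lemma X_measurable [measurable]: "k \<in> {1..K} \<Longrightarrow> X k \<in> borel_measurable M"
  using finite_mean by auto

lemma Xs_integrable:
  assumes "k \<in> {1..K}" "n \<ge> 1"
  shows "integrable M (Xs k n)" "expectation (Xs k n) = expectation (X k)"
  using integral_distr_eq[OF copies[OF assms] Xs_measurable[OF assms] X_measurable[OF assms(1)], of "\<lambda>x. x"]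
    finite_mean[OF assms(1)] by auto

lemma reward_compose:
  assumes "i \<ge> 1" and \<theta>: "\<theta> i \<in> measurable N (count_space {1..K})"
    and "\<And>k. k \<in> {1..K} \<Longrightarrow> Xs k i \<in> borel_measurable N"
  shows "reward Xs \<theta> i \<in> borel_measurable N"
  unfolding reward_def[abs_def]
  by (rule measurable_compose_countable'[OF assms(3) \<theta>]) auto

lemma strategyD:
  assumes "\<theta> \<in> strategies M K Xs" "i \<ge> 1"
  shows "\<theta> i \<in> measurable M (count_space {1..K})" "\<theta> i \<in> measurable (H \<theta> (i - 1)) (count_space {1..K})"
    "\<omega> \<in> space M \<Longrightarrow> \<theta> i \<omega> \<in> {1..K}"
proof -
  show *: "\<theta> i \<in> measurable M (count_space {1..K})" "\<theta> i \<in> measurable (H \<theta> (i - 1)) (count_space {1..K})"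
    using assms unfolding strategies_def by auto
  show "\<omega> \<in> space M \<Longrightarrow> \<theta> i \<omega> \<in> {1..K}" using measurable_space[OF *(1)] by simp
qed

lemma reward_measurable:
  "\<theta> \<in> strategies M K Xs \<Longrightarrow> i \<ge> 1 \<Longrightarrow> reward Xs \<theta> i \<in> borel_measurable M"
  by (rule reward_compose[where \<theta>=\<theta>]) (rule strategyD(1) Xs_measurable | assumption)+

lemma history_subalgebra:
  assumes "\<theta> \<in> strategies M K Xs"
  shows "subalgebra M (H \<theta> n)"
  unfolding subalgebra_def
  using history_least[where N=M and A="{1..K}" and M=M and X=Xs and \<theta>=\<theta> and n=n]
    reward_measurable[OF assms] strategyD(1)[OF assms] by simp

text \<open>The payoffs of all arms up to stage \<open>n\<close>, observed or not. Unlike a history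
  it does not depend on a strategy, so the independence assumption on the payoffs applies to it
  directly.\<close>

abbreviation past :: "nat \<Rightarrow> 'w measure" where
  "past n \<equiv> generated_by M (\<lambda>(k, i). Xs k i) ({1..K} \<times> {1..n})"

lemma past_mono: "n \<le> n' \<Longrightarrow> sets (past n) \<subseteq> sets (past n')"
  by (intro generated_by_mono Sigma_mono) auto

lemma Xs_past: "k \<in> {1..K} \<Longrightarrow> i \<in> {1..n} \<Longrightarrow> Xs k i \<in> borel_measurable (past n)"
  using measurable_generated_by[of "(k, i)" "{1..K} \<times> {1..n}" "\<lambda>(k, i). Xs k i" M] by simp

text \<open>Induction: a choice at stage \<open>i\<close> is a function of the history up to
  \<open>i - 1\<close>, hence of earlier payoffs, and the reward then picks one of the payoffs of
  stage \<open>i\<close>.\<close>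

lemma history_past:
  assumes \<theta>: "\<theta> \<in> strategies M K Xs"
  shows "sets (H \<theta> n) \<subseteq> sets (past n)"
proof (induction n)
  case 0
  show ?case by (rule history_least[where A="{1..K}"]) simp_all
next
  case (Suc n)
  have ch: "\<theta> i \<in> measurable (past (Suc n)) (count_space {1..K})" if "i \<in> {1..Suc n}" for i
  proof -
    have "i - 1 \<le> n" "1 \<le> i" using that by auto
    have "sets (H \<theta> (i - 1)) \<subseteq> sets (past (Suc n))"
      using history_mono[OF \<open>i - 1 \<le> n\<close>, of M Xs \<theta>] Suc past_mono[OF le_SucI[OF order_refl], of n]
      by (meson order_trans)
    then have "subalgebra (past (Suc n)) (H \<theta> (i - 1))"
      unfolding subalgebra_def by simp
    from measurable_from_subalg[OF this strategyD(2)[OF \<theta> \<open>1 \<le> i\<close>]] show ?thesis .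
  qed
  show ?case
  proof (rule history_least[where A="{1..K}"])
    fix i assume i: "i \<in> {1..Suc n}"
    show "\<theta> i \<in> measurable (past (Suc n)) (count_space {1..K})" by (rule ch[OF i])
    show "reward Xs \<theta> i \<in> borel_measurable (past (Suc n))"
    proof (rule reward_compose)
      show "\<theta> i \<in> measurable (past (Suc n)) (count_space {1..K})" by (rule ch[OF i])
      show "Xs k i \<in> borel_measurable (past (Suc n))" if "k \<in> {1..K}" for k by (rule Xs_past[OF that i])
    qed (use i in simp)
  qed simp
qed

lemma indep_of_past:
  assumes "k \<in> {1..K}"
  shows "indep_of M (past n) (Xs k (Suc n))"
proof -
  have "{1..K} \<times> {1..n} \<subseteq> {1..K} \<times> {1..}" "(k, Suc n) \<in> {1..K} \<times> {1..} - {1..K} \<times> {1..n}"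
    using assms by auto
  from indep_of_generated_by[OF indep this] show ?thesis by simp
qed

lemma indep_of_history:
  "\<theta> \<in> strategies M K Xs \<Longrightarrow> k \<in> {1..K} \<Longrightarrow> indep_of M (H \<theta> n) (Xs k (Suc n))"
  by (rule indep_of_mono[OF indep_of_past history_past])

lemma reward_eq_sum:
  assumes "\<theta> i \<omega> \<in> {1..K}"
  shows "reward Xs \<theta> i \<omega> = (\<Sum>k\<in>{1..K}. indicator {\<omega>. \<theta> i \<omega> = k} \<omega> * Xs k i \<omega>)"
proof -
  have "(\<Sum>k\<in>{1..K}. indicator {\<omega>. \<theta> i \<omega> = k} \<omega> * Xs k i \<omega>)
      = (\<Sum>k\<in>{1..K}. if k = \<theta> i \<omega> then Xs k i \<omega> else 0)"
    by (rule sum.cong) (auto simp: indicator_def)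
  also have "\<dots> = reward Xs \<theta> i \<omega>" using assms unfolding reward_def by (subst sum.delta) auto
  finally show ?thesis by (rule sym)
qed

text \<open>Given the history the next arm is known while its payoff is still independent, so the
  conditional mean is that of the chosen arm. The reward is split by arms to make this
  usable.\<close>

lemma cond_exp_reward:
  assumes \<theta>: "\<theta> \<in> strategies M K Xs"
  shows "AE \<omega> in M. real_cond_exp M (H \<theta> n) (reward Xs \<theta> (Suc n)) \<omega> = expectation (X (\<theta> (Suc n) \<omega>))"
proof -
  interpret S: finite_measure_subalgebra M "H \<theta> n"
    by unfold_locales (rule history_subalgebra[OF \<theta>])
  note sub = history_subalgebra[OF \<theta>, of n]
  have ch: "\<theta> (Suc n) \<in> measurable (H \<theta> n) (count_space {1..K})"
    using strategyD(2)[OF \<theta>, of "Suc n"] by simp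
  have in_K: "\<theta> (Suc n) \<omega> \<in> {1..K}" if "\<omega> \<in> space M" for \<omega>
    using strategyD(3)[OF \<theta> _ that, of "Suc n"] by simp
  let ?I = "\<lambda>k \<omega>. indicator {\<omega>. \<theta> (Suc n) \<omega> = k} \<omega> :: real"
  have I: "?I k \<in> borel_measurable (H \<theta> n)" for k
  proof -
    have "(\<lambda>\<omega>. indicator {k} (\<theta> (Suc n) \<omega>) :: real) \<in> borel_measurable (H \<theta> n)"
      by (rule measurable_compose[OF ch]) simp
    then show ?thesis by (simp add: indicator_def)
  qed
  have int: "integrable M \<eta>" if "\<eta> \<in> borel_measurable (H \<theta> n)" "\<And>\<omega>. \<bar>\<eta> \<omega>\<bar> \<le> 1" for \<eta> :: "'w \<Rightarrow> real"
    by (rule integrable_const_bound[where B=1]) (use that measurable_from_subalg[OF sub] in auto)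
  have mult: "integrable M (\<lambda>\<omega>. \<eta> \<omega> * Xs k (Suc n) \<omega>)"
    "expectation (\<lambda>\<omega>. \<eta> \<omega> * Xs k (Suc n) \<omega>) = expectation (\<lambda>\<omega>. \<eta> \<omega> * expectation (X k))"
    if "\<eta> \<in> borel_measurable (H \<theta> n)" "\<And>\<omega>. \<bar>\<eta> \<omega>\<bar> \<le> 1" "k \<in> {1..K}" for \<eta> k
    using indep_of_expectation_mult[OF sub indep_of_history[OF \<theta> that(3)] that(1) int[OF that(1,2)]]
      Xs_integrable[OF that(3), of "Suc n"] by auto
  have \<mu>_sum: "expectation (X (\<theta> (Suc n) \<omega>)) = (\<Sum>k\<in>{1..K}. ?I k \<omega> * expectation (X k))" if "\<omega> \<in> space M" for \<omega>
  proof -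
    have "(\<Sum>k\<in>{1..K}. ?I k \<omega> * expectation (X k))
        = (\<Sum>k\<in>{1..K}. if k = \<theta> (Suc n) \<omega> then expectation (X k) else 0)"
      by (rule sum.cong) (auto simp: indicator_def)
    then show ?thesis using in_K[OF that] by simp
  qed
  \<comment> \<open>Test functions bounded by 1 cover both later uses: the indicator of an event of
    the history gives the defining equation, and the constant 1 gives integrability.\<close>
  have int_reward: "integrable M (\<lambda>\<omega>. \<eta> \<omega> * reward Xs \<theta> (Suc n) \<omega>)"
    and int_\<mu>: "integrable M (\<lambda>\<omega>. \<eta> \<omega> * expectation (X (\<theta> (Suc n) \<omega>)))"
    and eq: "expectation (\<lambda>\<omega>. \<eta> \<omega> * reward Xs \<theta> (Suc n) \<omega>) = expectation (\<lambda>\<omega>. \<eta> \<omega> * expectation (X (\<theta> (Suc n) \<omega>)))"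
    if \<eta>: "\<eta> \<in> borel_measurable (H \<theta> n)" "\<And>\<omega>. \<bar>\<eta> \<omega>\<bar> \<le> 1" for \<eta>
  proof -
    have \<eta>I: "(\<lambda>\<omega>. \<eta> \<omega> * ?I k \<omega>) \<in> borel_measurable (H \<theta> n)" "\<bar>\<eta> \<omega> * ?I k \<omega>\<bar> \<le> 1" for k \<omega>
      using I[of k] \<eta> by (auto simp: indicator_def intro: borel_measurable_times)
    have r: "\<eta> \<omega> * reward Xs \<theta> (Suc n) \<omega> = (\<Sum>k\<in>{1..K}. (\<eta> \<omega> * ?I k \<omega>) * Xs k (Suc n) \<omega>)"
      and m: "\<eta> \<omega> * expectation (X (\<theta> (Suc n) \<omega>)) = (\<Sum>k\<in>{1..K}. (\<eta> \<omega> * ?I k \<omega>) * expectation (X k))"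
      if "\<omega> \<in> space M" for \<omega>
      unfolding \<mu>_sum[OF that] reward_eq_sum[where \<theta>=\<theta>, OF in_K[OF that]]
      by (simp_all only: sum_distrib_left mult.assoc)
    have i1: "integrable M (\<lambda>\<omega>. (\<eta> \<omega> * ?I k \<omega>) * Xs k (Suc n) \<omega>)"
      and i2: "integrable M (\<lambda>\<omega>. (\<eta> \<omega> * ?I k \<omega>) * expectation (X k))" if "k \<in> {1..K}" for k
      using mult(1)[OF \<eta>I that] int[OF \<eta>I] by auto
    show "integrable M (\<lambda>\<omega>. \<eta> \<omega> * reward Xs \<theta> (Suc n) \<omega>)"
      by (subst Bochner_Integration.integrable_cong[OF refl r]) (assumption, rule Bochner_Integration.integrable_sum, rule i1)
    show "integrable M (\<lambda>\<omega>. \<eta> \<omega> * expectation (X (\<theta> (Suc n) \<omega>)))"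
      by (subst Bochner_Integration.integrable_cong[OF refl m]) (assumption, rule Bochner_Integration.integrable_sum, rule i2)
    have "expectation (\<lambda>\<omega>. \<eta> \<omega> * reward Xs \<theta> (Suc n) \<omega>)
        = (\<Sum>k\<in>{1..K}. expectation (\<lambda>\<omega>. (\<eta> \<omega> * ?I k \<omega>) * Xs k (Suc n) \<omega>))"
      by (subst Bochner_Integration.integral_cong[OF refl r]) (assumption, rule Bochner_Integration.integral_sum, rule i1)
    also have "\<dots> = (\<Sum>k\<in>{1..K}. expectation (\<lambda>\<omega>. (\<eta> \<omega> * ?I k \<omega>) * expectation (X k)))"
      by (rule sum.cong[OF refl]) (rule mult(2)[OF \<eta>I])
    also have "\<dots> = expectation (\<lambda>\<omega>. \<eta> \<omega> * expectation (X (\<theta> (Suc n) \<omega>)))"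
      by (subst Bochner_Integration.integral_cong[OF refl m])
        (assumption, rule Bochner_Integration.integral_sum[symmetric], rule i2)
    finally show "expectation (\<lambda>\<omega>. \<eta> \<omega> * reward Xs \<theta> (Suc n) \<omega>)
      = expectation (\<lambda>\<omega>. \<eta> \<omega> * expectation (X (\<theta> (Suc n) \<omega>)))" .
  qed
  show ?thesis
  proof (rule S.real_cond_exp_charact)
    fix A assume "A \<in> sets (H \<theta> n)"
    then show "(\<integral>\<omega>\<in>A. reward Xs \<theta> (Suc n) \<omega> \<partial>M) = (\<integral>\<omega>\<in>A. expectation (X (\<theta> (Suc n) \<omega>)) \<partial>M)"
      using eq[of "indicator A"] unfolding set_lebesgue_integral_def by (simp add: indicator_def)
  next
    show "integrable M (reward Xs \<theta> (Suc n))" "integrable M (\<lambda>\<omega>. expectation (X (\<theta> (Suc n) \<omega>)))"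
      using int_reward[of "\<lambda>_. 1"] int_\<mu>[of "\<lambda>_. 1"] by simp_all
    show "(\<lambda>\<omega>. expectation (X (\<theta> (Suc n) \<omega>))) \<in> borel_measurable (H \<theta> n)"
      by (rule measurable_compose[OF ch, where g="\<lambda>k. expectation (X k)"]) simp
  qed
qed

text \<open>Both coordinates come from the same payoff, so they are correlated and the first one is
  random. Neither matters in the limit: the mixed term of the gauge is of order n^(-3/2) and the
  square of the first coordinate of order n^(-2).\<close>

definition arm_law :: "nat \<Rightarrow> nat \<Rightarrow> (real \<times> real) measure" where
  "arm_law n k = scaled_law M (X k) (\<lambda>\<omega>. X k \<omega> - expectation (X k)) n"

text \<open>Steps are counted from 0 and stages from 1, hence the payoff of stage
  \<open>Suc i\<close>.\<close>

definition arm_step :: "nat \<Rightarrow> nat \<Rightarrow> nat \<Rightarrow> 'w \<Rightarrow> real \<times> real" where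
  "arm_step n i k \<omega> = (Xs k (Suc i) \<omega> / n, (Xs k (Suc i) \<omega> - expectation (X k)) / sqrt n)"

lemma consistent_arm_law: "consistent {1..K} (\<lambda>k. mean_variance M (X k)) arm_law"
  unfolding arm_law_def
proof (rule consistent_scaled_law)
  fix k assume k: "k \<in> {1..K}"
  note [measurable] = X_measurable[OF k]
  let ?Y = "\<lambda>\<omega>. X k \<omega> - expectation (X k)"
  show "integrable M (\<lambda>\<omega>. (?Y \<omega>)\<^sup>2)" by (rule finite_variance[OF k])
  show "expectation ?Y = 0" using finite_mean[OF k] by (simp add: prob_space)
  show "integrable M (\<lambda>\<omega>. (X k \<omega>)\<^sup>2)"
  proof -
    have "integrable M (\<lambda>\<omega>. (?Y \<omega>)\<^sup>2 + 2 * expectation (X k) * X k \<omega> - (expectation (X k))\<^sup>2)"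
      using finite_variance[OF k] finite_mean[OF k] by simp
    then show ?thesis by (simp add: power2_eq_square algebra_simps)
  qed
qed (use K prob_space_axioms X_measurable in \<open>auto simp: mean_variance_def\<close>)

lemma arm_step_law:
  assumes "k \<in> {1..K}"
  shows "distr M borel (arm_step n i k) = arm_law n k"
proof -
  have g: "(\<lambda>x. (x / n, (x - expectation (X k)) / sqrt n)) \<in> measurable borel (borel :: (real \<times> real) measure)"
    unfolding borel_prod[symmetric] by measurable
  show ?thesis
    unfolding arm_law_def scaled_law_def arm_step_def
    using distr_distr[OF g Xs_measurable[OF assms, of "Suc i"]] distr_distr[OF g X_measurable[OF assms]]
      copies[OF assms, of "Suc i"] by (simp add: comp_def)
qed

lemma arm_step_indep:
  assumes "\<theta> \<in> strategies M K Xs" "k \<in> {1..K}"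
  shows "indep_of M (H \<theta> i) (arm_step n i k)"
  unfolding arm_step_def
  by (rule indep_of_compose[OF indep_of_history[OF assms], where g="\<lambda>x. (x / n, (x - expectation (X k)) / sqrt n)"])
    (unfold borel_prod[symmetric], measurable)

text \<open>The payoffs of arms not chosen need not be in the history. The step taken is
  nevertheless observable, since it can be rewritten in terms of the reward and the choice.\<close>

lemma arm_step_measurable_history:
  assumes "i < j" and \<theta>: "\<And>i. i \<ge> 1 \<Longrightarrow> \<theta> i \<in> measurable M (count_space {1..K})"
  shows "(\<lambda>\<omega>. arm_step n i (\<theta> (Suc i) \<omega>) \<omega>) \<in> borel_measurable (H \<theta> j)"
proof -
  have [measurable]: "reward Xs \<theta> (Suc i) \<in> borel_measurable (H \<theta> j)"
    by (rule reward_measurable_history) (use \<open>i < j\<close> in auto)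
  have "\<theta> (Suc i) \<in> measurable (H \<theta> j) (count_space {1..K})"
    using measurable_space[OF \<theta>[of "Suc i"]] \<open>i < j\<close> by (intro choice_measurable_history) auto
  then have [measurable]: "(\<lambda>\<omega>. expectation (X (\<theta> (Suc i) \<omega>))) \<in> borel_measurable (H \<theta> j)"
    by (rule measurable_compose) simp
  have "(\<lambda>\<omega>. (reward Xs \<theta> (Suc i) \<omega> / n, (reward Xs \<theta> (Suc i) \<omega> - expectation (X (\<theta> (Suc i) \<omega>))) / sqrt n))
      \<in> borel_measurable (H \<theta> j)"
    unfolding borel_prod[symmetric] by measurable
  then show ?thesis unfolding arm_step_def reward_def .
qed

section \<open>The walk driven by a strategy and the value of the bandit problem\<close>

definition walk :: "nat \<Rightarrow> (nat \<Rightarrow> 'w \<Rightarrow> nat) \<Rightarrow> nat \<Rightarrow> 'w \<Rightarrow> real \<times> real" where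
  "walk n \<theta> i \<omega> = (\<Sum>j<i. arm_step n j (\<theta> (Suc j) \<omega>) \<omega>)"

lemma walk_measurable:
  "(\<And>i. i \<ge> 1 \<Longrightarrow> \<theta> i \<in> measurable M (count_space {1..K})) \<Longrightarrow> walk n \<theta> i \<in> borel_measurable (H \<theta> i)"
  unfolding walk_def[abs_def]
  by (intro borel_measurable_sum arm_step_measurable_history) auto

lemma controlled_walk_strategy:
  assumes \<theta>: "\<theta> \<in> strategies M K Xs" and "0 < n"
  shows "controlled_walk M {1..K} (arm_law n) n (H \<theta>) (walk n \<theta>) (\<lambda>i. \<theta> (Suc i)) (arm_step n)"
proof -
  interpret control_family "{1..K}" "arm_law n"
    by (rule consistent_control_family[OF consistent_arm_law \<open>0 < n\<close>])
  show ?thesis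
  proof unfold_locales
    fix i k assume "k \<in> {1..K}"
    then show "indep_of M (H \<theta> i) (arm_step n i k)" "distr M borel (arm_step n i k) = arm_law n k"
      by (rule arm_step_indep[OF \<theta>] arm_step_law)+
  next
    fix i
    show "subalgebra M (H \<theta> i)" by (rule history_subalgebra[OF \<theta>])
    show "walk n \<theta> i \<in> borel_measurable (H \<theta> i)" by (rule walk_measurable) (rule strategyD(1)[OF \<theta>])
    show "\<theta> (Suc i) \<in> measurable (H \<theta> i) (count_space {1..K})"
      using strategyD(2)[OF \<theta>, of "Suc i"] by simp
  qed (simp_all add: walk_def)
qed

text \<open>At each of the finitely many stages the conditional mean may be replaced by the mean of
  the chosen arm outside a null set, so the argument of \<open>u\<close> is almost surely the
  endpoint of the walk.\<close>

lemma horizon_utility_eq_walk: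
  assumes \<theta>: "\<theta> \<in> strategies M K Xs" and u: "u \<in> borel_measurable borel"
  shows "horizon_utility M Xs u n \<theta> = expectation (\<lambda>\<omega>. u (walk n \<theta> n \<omega>))"
  unfolding horizon_utility_def
proof (rule integral_cong_AE)
  let ?P = "\<lambda>\<omega>. ((1 / real n) * (\<Sum>i=1..n. reward Xs \<theta> i \<omega>),
        (1 / sqrt (real n)) *
          (\<Sum>i=1..n. reward Xs \<theta> i \<omega> - real_cond_exp M (H \<theta> (i - 1)) (reward Xs \<theta> i) \<omega>))"
  have "?P \<in> borel_measurable M"
    unfolding borel_prod[symmetric]
    by (intro measurable_Pair borel_measurable_times borel_measurable_const borel_measurable_sum
        borel_measurable_diff borel_measurable_cond_exp2 reward_measurable[OF \<theta>]) auto
  then show "(\<lambda>\<omega>. u (?P \<omega>)) \<in> borel_measurable M" by (rule measurable_compose) (rule u)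
  show "(\<lambda>\<omega>. u (walk n \<theta> n \<omega>)) \<in> borel_measurable M"
    by (rule measurable_compose[OF measurable_from_subalg[OF history_subalgebra[OF \<theta>] walk_measurable] u])
      (rule strategyD[OF \<theta>])
  have "AE \<omega> in M. \<forall>i\<in>{..<n}. real_cond_exp M (H \<theta> i) (reward Xs \<theta> (Suc i)) \<omega> = expectation (X (\<theta> (Suc i) \<omega>))"
    by (intro AE_finite_allI cond_exp_reward[OF \<theta>]) auto
  then show "AE \<omega> in M. u (?P \<omega>) = u (walk n \<theta> n \<omega>)"
  proof eventually_elim
    case (elim \<omega>)
    have "walk n \<theta> n \<omega> = (\<Sum>j<n. (reward Xs \<theta> (Suc j) \<omega> / n,
        (reward Xs \<theta> (Suc j) \<omega> - real_cond_exp M (H \<theta> j) (reward Xs \<theta> (Suc j)) \<omega>) / sqrt n))"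
      unfolding walk_def
    proof (rule sum.cong[OF refl])
      fix j assume "j \<in> {..<n}"
      with elim have "real_cond_exp M (H \<theta> j) (reward Xs \<theta> (Suc j)) \<omega> = expectation (X (\<theta> (Suc j) \<omega>))" by blast
      then show "arm_step n j (\<theta> (Suc j) \<omega>) \<omega> = (reward Xs \<theta> (Suc j) \<omega> / n,
        (reward Xs \<theta> (Suc j) \<omega> - real_cond_exp M (H \<theta> j) (reward Xs \<theta> (Suc j)) \<omega>) / sqrt n)"
        by (simp only: arm_step_def reward_def)
    qed
    also have "\<dots> = ?P \<omega>"
      unfolding sum_prod by (simp add: sum_divide_distrib sum.atLeast1_atMost_eq)
    finally show ?case by simp
  qed
qed

text \<open>A strategy known in advance: through it \<open>arm_step_indep\<close> yields
  measurability of the steps while the optimal strategy is still being constructed.\<close>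

lemma constant_strategy: "(\<lambda>_ _. 1) \<in> strategies M K Xs"
  unfolding strategies_def using K by auto

lemma horizon_utility_le_bellman:
  assumes "\<theta> \<in> strategies M K Xs" "0 < n" "bounded_lipschitz C L u"
  shows "horizon_utility M Xs u n \<theta> \<le> (bellman {1..K} (arm_law n) ^^ n) u 0"
  unfolding horizon_utility_eq_walk[OF assms(1) bounded_lipschitz_measurable[OF assms(3)]]
  by (rule controlled_walk.expectation_le_bellman[OF controlled_walk_strategy[OF assms(1,2)] assms(3)])

lemma exists_optimal_strategy:
  assumes "0 < n" and u: "bounded_lipschitz C L u"
  shows "\<exists>\<theta>\<in>strategies M K Xs. horizon_utility M Xs u n \<theta> = (bellman {1..K} (arm_law n) ^^ n) u 0"
proof -
  interpret A: control_family "{1..K}" "arm_law n"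
    by (rule consistent_control_family[OF consistent_arm_law \<open>0 < n\<close>])
  define f where "f j = (bellman {1..K} (arm_law n) ^^ j) u" for j
  have "\<forall>j. \<exists>sel. sel \<in> measurable borel (count_space {1..K}) \<and>
      (\<forall>s. average (arm_law n (sel s)) (f j) s = f (Suc j) s)"
    using A.bellman_selector[OF A.bounded_lipschitz_bellman_funpow[OF u]] unfolding f_def funpow.simps comp_def by blast
  from choice[OF this] obtain sel where sel: "\<And>j. sel j \<in> measurable borel (count_space {1..K})"
    "\<And>j s. average (arm_law n (sel j s)) (f j) s = f (Suc j) s" by blast
  \<comment> \<open>The walk refers to the strategy and the optimal strategy to the position of the
    walk. The position is therefore defined first by recursion and identified with the walk
    afterwards.\<close>
  define S where "S = rec_nat (\<lambda>_. 0) (\<lambda>i S \<omega>. S \<omega> + arm_step n i (sel (n - Suc i) (S \<omega>)) \<omega>)"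
  have S_0: "S 0 \<omega> = 0" and S_Suc: "S (Suc i) \<omega> = S i \<omega> + arm_step n i (sel (n - Suc i) (S i \<omega>)) \<omega>" for i \<omega>
    unfolding S_def by simp_all
  \<comment> \<open>At stage \<open>i\<close> the position after \<open>i - 1\<close> steps is known
    and \<open>n - i\<close> stages remain after the present one. Beyond the horizon the subtraction
    gives 0, which still defines admissible choices.\<close>
  define \<theta> where "\<theta> i \<omega> = sel (n - i) (S (i - 1) \<omega>)" for i \<omega>
  have S: "S = walk n \<theta>"
  proof (rule ext, rule ext)
    show "S i \<omega> = walk n \<theta> i \<omega>" for i \<omega>
    proof (induction i)
      case 0
      show ?case by (simp add: walk_def S_0)
    next
      case (Suc i)
      have "S (Suc i) \<omega> = S i \<omega> + arm_step n i (\<theta> (Suc i) \<omega>) \<omega>"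
        unfolding S_Suc \<theta>_def by simp
      then show ?case using Suc by (simp add: walk_def)
    qed
  qed
  have \<theta>_K: "\<theta> i \<omega> \<in> {1..K}" for i \<omega>
    unfolding \<theta>_def using measurable_space[OF sel(1)] by simp
  \<comment> \<open>Measurability with respect to \<open>M\<close> has to come first:
    \<open>walk_measurable\<close>, which gives measurability with respect to the history,
    presupposes it for the choices.\<close>
  have SM: "S i \<in> borel_measurable M" for i
  proof (induction i)
    case (Suc i)
    have [measurable]: "(\<lambda>\<omega>. arm_step n i (sel (n - Suc i) (S i \<omega>)) \<omega>) \<in> borel_measurable M"
    proof (rule measurable_compose_countable'[OF _ measurable_compose[OF Suc sel(1)]])
      show "arm_step n i k \<in> borel_measurable M" if "k \<in> {1..K}" for k
        using arm_step_indep[OF constant_strategy that, of i n] unfolding indep_of_def by blast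
    qed simp
    note Suc[measurable]
    show ?case unfolding S_Suc[abs_def] by measurable
  next
    case 0
    show ?case by (simp add: S_0[abs_def])
  qed
  have \<theta>M: "\<theta> i \<in> measurable M (count_space {1..K})" for i
    unfolding \<theta>_def[abs_def] by (rule measurable_compose[OF SM sel(1)])
  have \<theta>: "\<theta> \<in> strategies M K Xs"
    unfolding strategies_def
  proof (intro CollectI allI impI conjI \<theta>M)
    fix i :: nat assume "1 \<le> i"
    show "\<theta> i \<in> measurable (H \<theta> (i - 1)) (count_space {1..K})"
      unfolding \<theta>_def[of i, abs_def] S
      by (rule measurable_compose[OF walk_measurable sel(1)]) (rule \<theta>M)
  qed
  have "expectation (\<lambda>\<omega>. u (walk n \<theta> n \<omega>)) = (bellman {1..K} (arm_law n) ^^ n) u 0"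
  proof (rule controlled_walk.expectation_eq_bellman[OF controlled_walk_strategy[OF \<theta> \<open>0 < n\<close>] u])
    fix i \<omega> assume "i < n"
    then have "n - i = Suc (n - Suc i)" by simp
    then show "average (arm_law n (\<theta> (Suc i) \<omega>)) ((bellman {1..K} (arm_law n) ^^ (n - Suc i)) u) (walk n \<theta> i \<omega>)
        = (bellman {1..K} (arm_law n) ^^ (n - i)) u (walk n \<theta> i \<omega>)"
      using sel(2)[of "n - Suc i" "S i \<omega>"] unfolding f_def by (simp add: \<theta>_def S[symmetric])
  qed
  then show ?thesis
    unfolding horizon_utility_eq_walk[OF \<theta> bounded_lipschitz_measurable[OF u], symmetric]
    by (rule bexI[OF _ \<theta>])
qed

text \<open>The upper bound is attained by the greedy strategy, so the supremum is a
  maximum.\<close>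

lemma horizon_value_eq_bellman:
  assumes "0 < n" "bounded_lipschitz C L u"
  shows "horizon_value M K Xs u n = (bellman {1..K} (arm_law n) ^^ n) u 0"
  unfolding horizon_value_def
proof (rule cSup_eq_maximum)
  show "(bellman {1..K} (arm_law n) ^^ n) u 0 \<in> horizon_utility M Xs u n ` strategies M K Xs"
    using exists_optimal_strategy[OF assms] by force
qed (use horizon_utility_le_bellman[OF _ assms] in auto)

end

section \<open>Brownian motion\<close>

lemma space_natural_filtration [simp]: "space (natural_filtration M B t) = space M"
  unfolding natural_filtration_def by (rule space_measure_of) auto

lemma sets_natural_filtration:
  "sets (natural_filtration M B t)
    = sigma_sets (space M) {B s -` S \<inter> space M | s S. s \<in> {0..t} \<and> S \<in> sets borel}"
  unfolding natural_filtration_def by (rule sets_measure_of) auto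

lemma measurable_natural_filtration:
  "0 \<le> s \<Longrightarrow> s \<le> t \<Longrightarrow> B s \<in> borel_measurable (natural_filtration M B t)"
  by (rule measurableI) (auto simp: sets_natural_filtration)

lemma natural_filtration_mono:
  assumes "s \<le> t"
  shows "subalgebra (natural_filtration M B t) (natural_filtration M B s)"
proof -
  have "{0..s} \<subseteq> {0..t}" using assms by auto
  then show ?thesis
    unfolding subalgebra_def sets_natural_filtration by (intro conjI sigma_sets_mono') (simp, blast)
qed

locale brownian = prob_space M for M :: "'w measure" +
  fixes B :: "real \<Rightarrow> 'w \<Rightarrow> real \<times> real"
  assumes brownian: "brownian_motion_2d M B"
begin

abbreviation "F \<equiv> natural_filtration M B"

lemma B_measurable: "0 \<le> t \<Longrightarrow> B t \<in> borel_measurable M"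
  using brownian unfolding brownian_motion_2d_def by blast

lemma subalgebra_F: "subalgebra M (F t)"
  unfolding subalgebra_def
proof
  show "sets (F t) \<subseteq> sets M"
    unfolding sets_natural_filtration
    by (rule sets.sigma_sets_subset) (auto intro!: measurable_sets[OF B_measurable])
qed simp

lemma increments_indep:
  assumes "0 \<le> \<tau> 0" "\<And>i. i < n \<Longrightarrow> \<tau> i < \<tau> (Suc i)"
  shows "indep_vars (\<lambda>_. borel) (\<lambda>i \<omega>. B (\<tau> (Suc i)) \<omega> - B (\<tau> i) \<omega>) {..<n}"
  using brownian assms unfolding brownian_motion_2d_def by blast

text \<open>
  As \<open>B 0 = 0\<close> almost surely, the values of \<open>B\<close> at finitely many times up to \<open>s\<close> are almost surely sums
  of increments before \<open>s\<close>; the raw filtration makes a detour through null sets necessary.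
\<close>

lemma finite_dim_indep:
  assumes s: "0 \<le> s" "s < t" and R: "finite R" "R \<subseteq> {0..s}"
    and D: "\<And>r. r \<in> R \<Longrightarrow> D r \<in> sets borel" and C: "C \<in> sets borel"
  shows "prob ({\<omega>\<in>space M. \<forall>r\<in>R. B r \<omega> \<in> D r} \<inter> ((\<lambda>\<omega>. B t \<omega> - B s \<omega>) -` C \<inter> space M))
    = prob {\<omega>\<in>space M. \<forall>r\<in>R. B r \<omega> \<in> D r} * prob ((\<lambda>\<omega>. B t \<omega> - B s \<omega>) -` C \<inter> space M)"
proof -
  \<comment> \<open>Adding 0 makes all values sums of increments, and adding \<open>s\<close> makes
    \<open>B t - B s\<close> exactly the last increment.\<close>
  define T where "T = R \<union> {0, s}"
  have T: "finite T" "T \<subseteq> {0..s}" "0 \<in> T" "s \<in> T" "T \<noteq> {}" using R s unfolding T_def by auto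
  define l where "l = sorted_list_of_set T @ [t]"
  define n where "n = card T"
  have n: "0 < n" using T unfolding n_def by (simp add: card_gt_0_iff)
  define \<tau> where "\<tau> i = l ! i" for i
  have len: "length (sorted_list_of_set T) = n" by (simp add: n_def)
  have set_l: "set (sorted_list_of_set T) = T" using T by simp
  have \<tau>_T: "\<tau> i = sorted_list_of_set T ! i" if "i < n" for i
    using that len by (simp add: \<tau>_def l_def nth_append)
  have \<tau>_n: "\<tau> n = t" using len by (simp add: \<tau>_def l_def nth_append)
  have "sorted_wrt (<) l"
    using T s strict_sorted_list_of_set[of T] set_l by (auto simp: l_def sorted_wrt_append)
  then have \<tau>_less: "\<tau> i < \<tau> j" if "i < j" "j \<le> n" for i j
    using sorted_wrt_nth_less[of "(<)" l i j] that len by (simp add: \<tau>_def l_def)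
  have \<tau>_in: "\<tau> i \<in> T" if "i < n" for i
    using that \<tau>_T[OF that] len set_l nth_mem by metis
  have \<tau>_ex: "\<exists>i<n. \<tau> i = r" if "r \<in> T" for r
    using that set_l len \<tau>_T in_set_conv_nth[of r "sorted_list_of_set T"] by auto
  have \<tau>_0: "\<tau> 0 = 0"
  proof -
    obtain i where i: "i < n" "\<tau> i = 0" using \<tau>_ex T(3) by blast
    have "0 \<le> \<tau> 0" using \<tau>_in[OF n] T(2) by auto
    then show ?thesis using \<tau>_less[of 0 i] i by (cases "i = 0") auto
  qed
  have \<tau>_last: "\<tau> (n - 1) = s"
  proof -
    obtain i where i: "i < n" "\<tau> i = s" using \<tau>_ex T(4) by blast
    have "\<tau> (n - 1) \<le> s" using \<tau>_in[of "n - 1"] n T(2) by auto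
    moreover have "i < n - 1 \<or> i = n - 1" using i(1) by linarith
    ultimately show ?thesis using \<tau>_less[of i "n - 1"] i by auto
  qed
  define Z where "Z i \<omega> = B (\<tau> (Suc i)) \<omega> - B (\<tau> i) \<omega>" for i \<omega>
  have Zlast: "Z (n - 1) = (\<lambda>\<omega>. B t \<omega> - B s \<omega>)"
    unfolding Z_def using \<tau>_last \<tau>_n n by simp
  have ind: "indep_vars (\<lambda>_. borel) Z {..<n}"
    unfolding Z_def[abs_def] by (rule increments_indep) (use \<tau>_0 \<tau>_less in auto)
  \<comment> \<open>The sigma-algebra of all increments except the last one, which is the increment
    from \<open>s\<close> to \<open>t\<close>.\<close>
  let ?G = "generated_by M Z {..<n - 1}"
  have "n - 1 \<in> {..<n} - {..<n - 1}" using n by auto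
  from indep_of_generated_by[OF ind _ this]
  have G: "indep_of M ?G (Z (n - 1))" by auto
  define A' where "A' = {\<omega>\<in>space M. \<forall>i\<in>{i. i < n \<and> \<tau> i \<in> R}. (\<Sum>j<i. Z j \<omega>) \<in> D (\<tau> i)}"
  have "A' = {\<omega>\<in>space ?G. \<forall>i\<in>{i. i < n \<and> \<tau> i \<in> R}. (\<Sum>j<i. Z j \<omega>) \<in> D (\<tau> i)}"
    by (simp add: A'_def)
  also have "\<dots> \<in> sets ?G"
  proof (rule sets.sets_Collect_finite_All)
    fix i assume i: "i \<in> {i. i < n \<and> \<tau> i \<in> R}"
    have [measurable]: "(\<lambda>\<omega>. \<Sum>j<i. Z j \<omega>) \<in> borel_measurable ?G"
      by (intro borel_measurable_sum measurable_generated_by) (use i in auto)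
    have [measurable]: "D (\<tau> i) \<in> sets borel" using i D by blast
    show "{\<omega> \<in> space ?G. (\<Sum>j<i. Z j \<omega>) \<in> D (\<tau> i)} \<in> sets ?G" by measurable
  qed simp
  finally have A': "A' \<in> sets ?G" .
  have ZM: "Z i \<in> borel_measurable M" if "i < n" for i
    using ind that unfolding indep_vars_def2 by blast
  have "subalgebra M ?G"
    unfolding subalgebra_def sets_generated_by
    by (intro conjI sets.sigma_sets_subset) (auto intro!: measurable_sets[OF ZM])
  then have A'M: "A' \<in> events" using A' by (auto simp: subalgebra_def)
  let ?A = "{\<omega>\<in>space M. \<forall>r\<in>R. B r \<omega> \<in> D r}"
  have AM: "?A \<in> events"
  proof (rule sets.sets_Collect_finite_All[OF _ R(1)])
    fix r assume "r \<in> R"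
    then have "0 \<le> r" "D r \<in> sets borel" using R(2) D by auto
    then show "{\<omega>\<in>space M. B r \<omega> \<in> D r} \<in> events"
      using measurable_sets[OF B_measurable, of r "D r"] by (simp add: vimage_def Int_def conj_commute)
  qed
  have eq: "AE \<omega> in M. \<omega> \<in> ?A \<longleftrightarrow> \<omega> \<in> A'"
  proof -
    have "AE \<omega> in M. B 0 \<omega> = 0" using brownian unfolding brownian_motion_2d_def by blast
    then show ?thesis
    proof (eventually_elim, goal_cases)
      case (1 \<omega>)
      have sum: "(\<Sum>j<i. Z j \<omega>) = B (\<tau> i) \<omega>" for i
      proof (induction i)
        case 0
        then show ?case using 1 \<tau>_0 by simp
      qed (simp add: Z_def)
      have "(\<forall>r\<in>R. B r \<omega> \<in> D r) \<longleftrightarrow> (\<forall>i\<in>{i. i < n \<and> \<tau> i \<in> R}. B (\<tau> i) \<omega> \<in> D (\<tau> i))"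
      proof
        assume *: "\<forall>i\<in>{i. i < n \<and> \<tau> i \<in> R}. B (\<tau> i) \<omega> \<in> D (\<tau> i)"
        show "\<forall>r\<in>R. B r \<omega> \<in> D r"
        proof
          fix r assume "r \<in> R"
          then obtain i where "i < n" "\<tau> i = r" using \<tau>_ex[of r] unfolding T_def by blast
          then show "B r \<omega> \<in> D r" using * \<open>r \<in> R\<close> by blast
        qed
      qed blast
      then show ?case unfolding A'_def by (simp add: sum)
    qed
  qed
  let ?E = "(\<lambda>\<omega>. B t \<omega> - B s \<omega>) -` C \<inter> space M"
  have EM: "?E \<in> events"
    using measurable_sets[OF ZM[of "n - 1"] C] n unfolding Zlast by simp
  have "prob (?A \<inter> ?E) = prob (A' \<inter> ?E)"
    by (rule finite_measure_eq_AE) (use eq AM A'M EM in auto)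
  also have "\<dots> = prob A' * prob ?E"
    using G A' C unfolding Zlast indep_of_def by blast
  also have "prob A' = prob ?A"
    by (rule finite_measure_eq_AE) (use eq AM A'M in auto)
  finally show ?thesis .
qed

text \<open>Cylinder events at finitely many times up to \<open>s\<close> are stable under
  intersection and generate the filtration, so independence from them extends to all of
  \<open>F s\<close>.\<close>

lemma increment_indep_of:
  assumes s: "0 \<le> s" "s < t"
  shows "indep_of M (F s) (\<lambda>\<omega>. B t \<omega> - B s \<omega>)"
proof -
  define Y where "Y = (\<lambda>\<omega>. B t \<omega> - B s \<omega>)"
  have Y: "Y \<in> borel_measurable M"
    unfolding Y_def using s by (intro borel_measurable_diff B_measurable) auto
  define G where "G = {{\<omega>\<in>space M. \<forall>r\<in>R. B r \<omega> \<in> D r} | R D. finite R \<and> R \<subseteq> {0..s} \<and> (\<forall>r\<in>R. D r \<in> sets (borel :: (real \<times> real) measure))}"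
  define Q where "Q = {Y -` C \<inter> space M | C. C \<in> sets (borel :: (real \<times> real) measure)}"
  have Gev: "G \<subseteq> events"
  proof
    fix A assume "A \<in> G"
    then obtain R D where A: "A = {\<omega>\<in>space M. \<forall>r\<in>R. B r \<omega> \<in> D r}" "finite R" "R \<subseteq> {0..s}" "\<forall>r\<in>R. D r \<in> sets borel"
      unfolding G_def by blast
    show "A \<in> events" unfolding A(1)
    proof (rule sets.sets_Collect_finite_All[OF _ A(2)])
      fix r assume "r \<in> R"
      then have "0 \<le> r" "D r \<in> sets borel" using A by auto
      then show "{\<omega>\<in>space M. B r \<omega> \<in> D r} \<in> events"
        using measurable_sets[OF B_measurable, of r "D r"] by (simp add: vimage_def Int_def conj_commute)
    qed
  qed
  have "indep_set (sigma_sets (space M) G) (sigma_sets (space M) Q)"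
  proof (rule indep_set_sigma_sets)
    show "indep_set G Q"
      unfolding indep_sets2_eq
    proof (intro conjI ballI)
      show "G \<subseteq> events" by (rule Gev)
      show "Q \<subseteq> events" unfolding Q_def using measurable_sets[OF Y] by blast
      fix a b assume "a \<in> G" "b \<in> Q"
      then obtain R D C where "a = {\<omega>\<in>space M. \<forall>r\<in>R. B r \<omega> \<in> D r}" "finite R" "R \<subseteq> {0..s}"
        "\<forall>r\<in>R. D r \<in> sets borel" "C \<in> sets borel" "b = Y -` C \<inter> space M"
        unfolding G_def Q_def by blast
      then show "prob (a \<inter> b) = prob a * prob b"
        using finite_dim_indep[OF s, of R D C] unfolding Y_def by simp
    qed
    show "Int_stable G"
    proof (rule Int_stableI)
      fix a b assume "a \<in> G" "b \<in> G"
      then obtain R D R' D' where *: "a = {\<omega>\<in>space M. \<forall>r\<in>R. B r \<omega> \<in> D r}" "finite R" "R \<subseteq> {0..s}"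
        "\<forall>r\<in>R. D r \<in> sets borel" "b = {\<omega>\<in>space M. \<forall>r\<in>R'. B r \<omega> \<in> D' r}" "finite R'" "R' \<subseteq> {0..s}"
        "\<forall>r\<in>R'. D' r \<in> sets borel"
        unfolding G_def by blast
      \<comment> \<open>A time that occurs in only one of the two cylinders is left unconstrained by
        the other, hence \<open>UNIV\<close>.\<close>
      define D'' where "D'' r = (if r \<in> R then D r else UNIV) \<inter> (if r \<in> R' then D' r else UNIV)" for r
      have "a \<inter> b = {\<omega>\<in>space M. \<forall>r\<in>R \<union> R'. B r \<omega> \<in> D'' r}"
        unfolding *(1,5) D''_def by auto
      moreover have "finite (R \<union> R')" "R \<union> R' \<subseteq> {0..s}" "\<forall>r\<in>R \<union> R'. D'' r \<in> sets borel"
        using * unfolding D''_def by (simp_all add: sets.Int)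
      ultimately show "a \<inter> b \<in> G"
        unfolding G_def by (intro CollectI exI[of _ "R \<union> R'"] exI[of _ D''] conjI)
    qed
    show "Int_stable Q"
    proof (rule Int_stableI)
      fix a b assume "a \<in> Q" "b \<in> Q"
      then obtain S T where ST: "S \<in> sets borel" "T \<in> sets borel" "a = Y -` S \<inter> space M" "b = Y -` T \<inter> space M"
        unfolding Q_def by blast
      then have "a \<inter> b = Y -` (S \<inter> T) \<inter> space M" by auto
      with ST(1,2) show "a \<inter> b \<in> Q" unfolding Q_def by blast
    qed
  qed
  then have *: "prob (a \<inter> b) = prob a * prob b" if "a \<in> sigma_sets (space M) G" "b \<in> Q" for a b
    using that unfolding indep_sets2_eq by blast
  have "sets (F s) \<subseteq> sigma_sets (space M) G"
    unfolding sets_natural_filtration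
  proof (rule sigma_sets_mono, rule subsetI)
    fix A assume "A \<in> {B r -` S \<inter> space M |r S. r \<in> {0..s} \<and> S \<in> sets borel}"
    then obtain r S where "A = B r -` S \<inter> space M" "r \<in> {0..s}" "S \<in> sets borel" by blast
    then have "A = {\<omega>\<in>space M. \<forall>r'\<in>{r}. B r' \<omega> \<in> (\<lambda>_. S) r'}" "finite {r}" "{r} \<subseteq> {0..s}"
      "\<forall>r'\<in>{r}. (\<lambda>_. S) r' \<in> sets (borel :: (real \<times> real) measure)" by auto
    then have "A \<in> G" unfolding G_def by (intro CollectI exI[of _ "{r}"] exI[of _ "\<lambda>_. S"] conjI)
    then show "A \<in> sigma_sets (space M) G" ..
  qed
  then have "prob (a \<inter> (Y -` C \<inter> space M)) = prob a * prob (Y -` C \<inter> space M)"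
    if "a \<in> sets (F s)" "C \<in> sets borel" for a C
    by (intro *) (use that in \<open>auto simp: Q_def\<close>)
  then show ?thesis
    using Y unfolding indep_of_def Y_def[symmetric] by simp
qed

section \<open>The integrator and the moments of its increments\<close>

definition W :: "real \<Rightarrow> 'w \<Rightarrow> real" where
  "W t \<omega> = snd (B t \<omega>)"

lemma W_measurable_F:
  assumes "0 \<le> s" "s \<le> t"
  shows "W s \<in> borel_measurable (F t)"
proof -
  have "(snd :: real \<times> real \<Rightarrow> real) \<in> borel_measurable borel"
    by (intro borel_measurable_continuous_onI continuous_intros)
  from measurable_compose[OF measurable_natural_filtration[OF assms] this]
  show ?thesis unfolding W_def[abs_def] .
qed

lemma W_measurable: "0 \<le> s \<Longrightarrow> W s \<in> borel_measurable M"
  by (rule measurable_from_subalg[OF subalgebra_F W_measurable_F]) auto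

lemma W_increment_indep:
  assumes "0 \<le> s" "s < t"
  shows "indep_of M (F s) (\<lambda>\<omega>. W t \<omega> - W s \<omega>)"
proof -
  have "(snd :: real \<times> real \<Rightarrow> real) \<in> borel_measurable borel"
    by (intro borel_measurable_continuous_onI continuous_intros)
  from indep_of_compose[OF increment_indep_of[OF assms] this]
  show ?thesis by (simp add: W_def)
qed

text \<open>Marginal of a product density: the first coordinate integrates to one by Tonelli and
  leaves the density of the second.\<close>

lemma W_increment_normal:
  assumes s: "0 \<le> s" "s < t"
  shows "distributed M lborel (\<lambda>\<omega>. W t \<omega> - W s \<omega>) (normal_density 0 (sqrt (t - s)))"
proof -
  let ?Y = "\<lambda>\<omega>. B t \<omega> - B s \<omega>" and ?n = "normal_density 0 (sqrt (t - s))"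
  let ?f = "\<lambda>(x, y). ennreal (?n x * ?n y)"
  have "distributed M lborel ?Y ?f"
    using brownian s unfolding brownian_motion_2d_def by blast
  then have law: "distr M lborel ?Y = density lborel ?f" and Y: "?Y \<in> measurable M lborel"
    by (auto simp: distributed_def)
  have snd: "snd \<in> measurable (lborel :: (real \<times> real) measure) (lborel :: real measure)"
    unfolding lborel_prod[symmetric] by measurable
  have "0 < sqrt (t - s)" using s by simp
  have "distr M lborel (\<lambda>\<omega>. W t \<omega> - W s \<omega>) = distr (density lborel ?f) lborel snd"
    unfolding law[symmetric] by (subst distr_distr[OF snd Y]) (simp add: comp_def W_def)
  also have "\<dots> = density lborel ?n"
  proof (rule measure_eqI)
    fix A assume "A \<in> sets (distr (density lborel ?f) lborel (snd :: real \<times> real \<Rightarrow> real))"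
    then have [measurable]: "A \<in> sets borel" by simp
    have fm: "?f \<in> borel_measurable (lborel \<Otimes>\<^sub>M lborel)" by measurable
    have snd': "snd \<in> measurable (density lborel ?f) (lborel :: real measure)" using snd by simp
    have "emeasure (distr (density lborel ?f) lborel snd) A = emeasure (density lborel ?f) (snd -` A \<inter> space (density lborel ?f))"
      by (rule emeasure_distr[OF snd']) simp
    also have "\<dots> = (\<integral>\<^sup>+p. ?f p * indicator (snd -` A) p \<partial>lborel)"
      using measurable_sets[OF snd, of A] fm unfolding lborel_prod
      by (subst emeasure_density) auto
    also have "\<dots> = (\<integral>\<^sup>+p. ?f p * indicator (snd -` A) p \<partial>(lborel \<Otimes>\<^sub>M lborel))"
      unfolding lborel_prod ..
    also have "\<dots> = (\<integral>\<^sup>+y. \<integral>\<^sup>+x. ?f (x, y) * indicator (snd -` A) (x, y) \<partial>lborel \<partial>lborel)"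
    proof (rule lborel_pair.nn_integral_snd[symmetric])
      have ind: "(\<lambda>p. indicator (snd -` A) p :: ennreal) = (\<lambda>p. indicator A (snd p))"
        by (simp add: indicator_def)
      show "(\<lambda>p. ?f p * indicator (snd -` A) p) \<in> borel_measurable (lborel \<Otimes>\<^sub>M lborel)"
        unfolding ind by measurable
    qed
    also have "\<dots> = (\<integral>\<^sup>+y. (\<integral>\<^sup>+x. ennreal (?n x) \<partial>lborel) * (ennreal (?n y) * indicator A y) \<partial>lborel)"
    proof (rule nn_integral_cong)
      fix y :: real
      have "(\<integral>\<^sup>+x. ?f (x, y) * indicator (snd -` A) (x, y) \<partial>lborel)
          = (\<integral>\<^sup>+x. ennreal (?n x) * (ennreal (?n y) * indicator A y) \<partial>lborel)"
        by (rule nn_integral_cong) (simp add: ennreal_mult mult.assoc indicator_def)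
      also have "\<dots> = (\<integral>\<^sup>+x. ennreal (?n x) \<partial>lborel) * (ennreal (?n y) * indicator A y)"
        by (rule nn_integral_multc) simp
      finally show "(\<integral>\<^sup>+x. ?f (x, y) * indicator (snd -` A) (x, y) \<partial>lborel)
          = (\<integral>\<^sup>+x. ennreal (?n x) \<partial>lborel) * (ennreal (?n y) * indicator A y)" .
    qed
    also have "(\<integral>\<^sup>+x. ennreal (?n x) \<partial>lborel) = 1"
      using \<open>0 < sqrt (t - s)\<close> by (simp add: nn_integral_eq_integral)
    also have "(\<integral>\<^sup>+y. 1 * (ennreal (?n y) * indicator A y) \<partial>lborel) = emeasure (density lborel ?n) A"
      by (subst emeasure_density) auto
    finally show "emeasure (distr (density lborel ?f) lborel snd) A = emeasure (density lborel ?n) A" .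
  qed simp
  finally show ?thesis
    using W_measurable[of t] W_measurable[of s] s by (simp add: distributed_def)
qed

lemma W_increment_moments:
  assumes s: "0 \<le> s" "s < t"
  shows "integrable M (\<lambda>\<omega>. W t \<omega> - W s \<omega>)" "expectation (\<lambda>\<omega>. W t \<omega> - W s \<omega>) = 0"
    "integrable M (\<lambda>\<omega>. (W t \<omega> - W s \<omega>)\<^sup>2)" "expectation (\<lambda>\<omega>. (W t \<omega> - W s \<omega>)\<^sup>2) = t - s"
proof -
  have \<sigma>: "0 < sqrt (t - s)" using s by simp
  note D = W_increment_normal[OF s]
  note i = distributed_integrable[OF D, symmetric] distributed_integral[OF D, symmetric]
  show "integrable M (\<lambda>\<omega>. W t \<omega> - W s \<omega>)" "expectation (\<lambda>\<omega>. W t \<omega> - W s \<omega>) = 0"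
    using i(1)[of "\<lambda>x. x"] i(2)[of "\<lambda>x. x"] integrable_normal_moment_nz_1[OF \<sigma>, of 0] integral_normal_moment_nz_1[OF \<sigma>, of 0]
    by simp_all
  have "integrable lborel (\<lambda>x. normal_density 0 (sqrt (t - s)) x * x\<^sup>2)"
    "(\<integral>x. normal_density 0 (sqrt (t - s)) x * x\<^sup>2 \<partial>lborel) = t - s"
    using integrable_normal_moment[OF \<sigma>, of 0 2] integral_normal_moment_even[OF \<sigma>, of 0 1] s by simp_all
  then show "integrable M (\<lambda>\<omega>. (W t \<omega> - W s \<omega>)\<^sup>2)" "expectation (\<lambda>\<omega>. (W t \<omega> - W s \<omega>)\<^sup>2) = t - s"
    using i(1)[of "\<lambda>x. x\<^sup>2"] i(2)[of "\<lambda>x. x\<^sup>2"] by simp_all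
qed

end

section \<open>The Ito isometry and existence of Ito integrals\<close>

text \<open>Since 4/8 = 1/2, the increments weighted by \<open>4^j\<close> have summable integrals,
  so almost surely they are eventually at most \<open>(1/2)^j\<close> and the sequence converges
  pointwise. Fatou then passes the bound to the limit with the rate intact.\<close>

lemma nn_integral_L2_complete:
  fixes Y :: "nat \<Rightarrow> 'w \<Rightarrow> real"
  assumes [measurable]: "\<And>j. Y j \<in> borel_measurable M"
    and cauchy: "\<And>j k. j \<le> k \<Longrightarrow> (\<integral>\<^sup>+\<omega>. ennreal ((Y j \<omega> - Y k \<omega>)\<^sup>2) \<partial>M) \<le> ennreal ((1/8)^j)"
  shows "\<exists>I\<in>borel_measurable M. \<forall>j. (\<integral>\<^sup>+\<omega>. ennreal ((Y j \<omega> - I \<omega>)\<^sup>2) \<partial>M) \<le> ennreal ((1/8)^j)"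
proof -
  define d where "d j \<omega> = Y (Suc j) \<omega> - Y j \<omega>" for j \<omega>
  have [measurable]: "d j \<in> borel_measurable M" for j unfolding d_def by measurable
  have "(\<integral>\<^sup>+\<omega>. (\<Sum>j. ennreal (4^j * (d j \<omega>)\<^sup>2)) \<partial>M) = (\<Sum>j. \<integral>\<^sup>+\<omega>. ennreal (4^j * (d j \<omega>)\<^sup>2) \<partial>M)"
    by (rule nn_integral_suminf) measurable
  also have "\<dots> \<le> (\<Sum>j. ennreal ((1/2)^j))"
  proof (rule suminf_le)
    fix j
    have "(\<integral>\<^sup>+\<omega>. ennreal (4^j * (d j \<omega>)\<^sup>2) \<partial>M) = ennreal (4^j) * (\<integral>\<^sup>+\<omega>. ennreal ((Y j \<omega> - Y (Suc j) \<omega>)\<^sup>2) \<partial>M)"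
      unfolding d_def by (subst nn_integral_cmult[symmetric]) (auto simp: ennreal_mult power2_commute)
    also have "\<dots> \<le> ennreal (4^j) * ennreal ((1/8)^j)"
      by (rule mult_left_mono[OF cauchy]) auto
    also have "\<dots> = ennreal ((1/2)^j)"
      by (subst ennreal_mult[symmetric]) (auto simp flip: power_mult_distrib)
    finally show "(\<integral>\<^sup>+\<omega>. ennreal (4^j * (d j \<omega>)\<^sup>2) \<partial>M) \<le> ennreal ((1/2)^j)" .
  qed auto
  also have "\<dots> < \<infinity>"
    by (subst suminf_ennreal2) (auto intro: summable_geometric)
  finally have "AE \<omega> in M. (\<Sum>j. ennreal (4^j * (d j \<omega>)\<^sup>2)) \<noteq> \<infinity>"
    by (intro nn_integral_PInf_AE) auto
  then have conv: "AE \<omega> in M. convergent (\<lambda>j. Y j \<omega>)"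
  proof eventually_elim
    case (elim \<omega>)
    have "summable (\<lambda>j. 4^j * (d j \<omega>)\<^sup>2)"
      by (rule summable_suminf_not_top) (use elim in auto)
    then have "(\<lambda>j. 4^j * (d j \<omega>)\<^sup>2) \<longlonglongrightarrow> 0" by (rule summable_LIMSEQ_zero)
    then have "\<forall>\<^sub>F j in sequentially. 4^j * (d j \<omega>)\<^sup>2 < 1"
      by (rule order_tendstoD) simp
    then have "\<forall>\<^sub>F j in sequentially. norm (d j \<omega>) \<le> (1/2)^j"
    proof eventually_elim
      case (elim j)
      have "(4::real)^j = (2^j)\<^sup>2" by (simp add: power2_eq_square flip: power_mult_distrib)
      then have "(2^j * \<bar>d j \<omega>\<bar>)\<^sup>2 < 1\<^sup>2" using elim by (simp add: power_mult_distrib)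
      then have "2^j * \<bar>d j \<omega>\<bar> < 1" by (rule power_less_imp_less_base) simp
      then show ?case by (simp add: field_simps power_one_over)
    qed
    then have "summable (\<lambda>j. d j \<omega>)"
      by (rule summable_comparison_test_ev) (simp add: summable_geometric)
    moreover have "(\<Sum>j<n. d j \<omega>) = Y n \<omega> - Y 0 \<omega>" for n
      unfolding d_def by (rule sum_lessThan_telescope)
    ultimately have "convergent (\<lambda>n. Y n \<omega> - Y 0 \<omega>)" by (simp add: summable_iff_convergent)
    then show ?case by (simp add: convergent_diff_const_right_iff)
  qed
  define I where "I \<omega> = lim (\<lambda>j. Y j \<omega>)" for \<omega>
  have [measurable]: "I \<in> borel_measurable M" unfolding I_def by measurable
  have "(\<integral>\<^sup>+\<omega>. ennreal ((Y j \<omega> - I \<omega>)\<^sup>2) \<partial>M) \<le> ennreal ((1/8)^j)" for j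
  proof -
    have "(\<integral>\<^sup>+\<omega>. ennreal ((Y j \<omega> - I \<omega>)\<^sup>2) \<partial>M) = (\<integral>\<^sup>+\<omega>. liminf (\<lambda>k. ennreal ((Y j \<omega> - Y k \<omega>)\<^sup>2)) \<partial>M)"
    proof (rule nn_integral_cong_AE)
      show "AE \<omega> in M. ennreal ((Y j \<omega> - I \<omega>)\<^sup>2) = liminf (\<lambda>k. ennreal ((Y j \<omega> - Y k \<omega>)\<^sup>2))"
        using conv
      proof eventually_elim
        case (elim \<omega>)
        then have "(\<lambda>k. Y k \<omega>) \<longlonglongrightarrow> I \<omega>" unfolding I_def by (simp add: convergent_LIMSEQ_iff)
        then have "(\<lambda>k. ennreal ((Y j \<omega> - Y k \<omega>)\<^sup>2)) \<longlonglongrightarrow> ennreal ((Y j \<omega> - I \<omega>)\<^sup>2)"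
          by (intro tendsto_intros)
        then show ?case by (rule lim_imp_Liminf[symmetric, rotated]) simp
      qed
    qed
    also have "\<dots> \<le> liminf (\<lambda>k. \<integral>\<^sup>+\<omega>. ennreal ((Y j \<omega> - Y k \<omega>)\<^sup>2) \<partial>M)"
      by (rule nn_integral_liminf) measurable
    also have "\<dots> \<le> ennreal ((1/8)^j)"
    proof (rule Liminf_le)
      show "\<forall>\<^sub>F k in sequentially. (\<integral>\<^sup>+\<omega>. ennreal ((Y j \<omega> - Y k \<omega>)\<^sup>2) \<partial>M) \<le> ennreal ((1/8)^j)"
        using eventually_ge_at_top[of j] by eventually_elim (rule cauchy)
    qed simp
    finally show ?thesis .
  qed
  then show ?thesis by (intro bexI[of _ I]) auto
qed

lemma power2_sum_le: "(x + y)\<^sup>2 \<le> 2 * x\<^sup>2 + 2 * (y::real)\<^sup>2"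
  using sum_squares_bound[of x y] by (simp add: power2_sum)

lemma ennreal_square_diff_le:
  "ennreal ((x - z)\<^sup>2) \<le> 2 * ennreal ((x - y)\<^sup>2) + 2 * ennreal ((y - z)\<^sup>2)"
proof -
  have "ennreal ((x - z)\<^sup>2) \<le> ennreal (2 * (x - y)\<^sup>2 + 2 * (y - z)\<^sup>2)"
    using power2_sum_le[of "x - y" "y - z"] by (intro ennreal_leI) simp
  also have "\<dots> = 2 * ennreal ((x - y)\<^sup>2) + 2 * ennreal ((y - z)\<^sup>2)"
    by (subst ennreal_plus) (auto simp: ennreal_mult)
  finally show ?thesis .
qed

text \<open>A triangle inequality for squared distances. The factor 2 is harmless, and all estimates
  stay in \<open>ennreal\<close> without square roots.\<close>

lemma nn_integral_square_diff_le:
  assumes [measurable]: "f \<in> borel_measurable M" "g \<in> borel_measurable M" "h \<in> borel_measurable M"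
  shows "(\<integral>\<^sup>+x. ennreal ((f x - h x)\<^sup>2) \<partial>M)
    \<le> 2 * (\<integral>\<^sup>+x. ennreal ((f x - g x)\<^sup>2) \<partial>M) + 2 * (\<integral>\<^sup>+x. ennreal ((g x - h x)\<^sup>2) \<partial>M)"
proof -
  have "(\<integral>\<^sup>+x. ennreal ((f x - h x)\<^sup>2) \<partial>M)
      \<le> (\<integral>\<^sup>+x. 2 * ennreal ((f x - g x)\<^sup>2) + 2 * ennreal ((g x - h x)\<^sup>2) \<partial>M)"
    by (intro nn_integral_mono ennreal_square_diff_le)
  also have "\<dots> = 2 * (\<integral>\<^sup>+x. ennreal ((f x - g x)\<^sup>2) \<partial>M) + 2 * (\<integral>\<^sup>+x. ennreal ((g x - h x)\<^sup>2) \<partial>M)"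
    by (simp add: nn_integral_add nn_integral_cmult)
  finally show ?thesis .
qed

lemma has_bochner_integral_Ioc_Int:
  fixes a b c d :: real
  shows "has_bochner_integral lborel (\<lambda>r. indicator {a<..b} r * indicator {c<..d} r :: real)
    (max 0 (min b d - max a c))"
proof -
  have "{a<..b} \<inter> {c<..d} = {max a c<..min b d}" by auto
  then have "(\<lambda>r. indicator {a<..b} r * indicator {c<..d} r :: real) = indicator {max a c<..min b d}"
    by (auto simp: indicator_inter_arith[symmetric])
  moreover have "measure lborel {max a c<..min b d} = max 0 (min b d - max a c)"
    by (cases "max a c \<le> min b d") (auto simp: measure_def)
  moreover have "emeasure lborel {max a c<..min b d} < \<infinity>"
    by (cases "max a c \<le> min b d") auto
  ultimately show ?thesis
    using has_bochner_integral_real_indicator[of "{max a c<..min b d}" lborel] by simp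
qed

context brownian
begin

lemma bounded_measurable_integrable:
  assumes "\<eta> \<in> borel_measurable (F s)" "\<And>\<omega>. \<omega> \<in> space M \<Longrightarrow> \<bar>\<eta> \<omega>\<bar> \<le> C" "integrable M Y"
  shows "integrable M (\<lambda>\<omega>. \<eta> \<omega> * Y \<omega> :: real)"
proof (rule Bochner_Integration.integrable_bound)
  have [measurable]: "\<eta> \<in> borel_measurable M" by (rule measurable_from_subalg[OF subalgebra_F assms(1)])
  have [measurable]: "Y \<in> borel_measurable M" using assms(3) by auto
  show "integrable M (\<lambda>\<omega>. C * Y \<omega>)" using assms(3) by simp
  show "(\<lambda>\<omega>. \<eta> \<omega> * Y \<omega>) \<in> borel_measurable M" by measurable
  show "AE \<omega> in M. norm (\<eta> \<omega> * Y \<omega>) \<le> norm (C * Y \<omega>)"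
  proof (rule AE_I2)
    fix \<omega> assume "\<omega> \<in> space M"
    from assms(2)[OF this] have "\<bar>\<eta> \<omega>\<bar> \<le> \<bar>C\<bar>" by simp
    then show "norm (\<eta> \<omega> * Y \<omega>) \<le> norm (C * Y \<omega>)" by (simp add: abs_mult mult_right_mono)
  qed
qed

lemma measurable_F_mono: "s \<le> t \<Longrightarrow> \<eta> \<in> measurable (F s) N \<Longrightarrow> \<eta> \<in> measurable (F t) N"
  by (rule measurable_from_subalg[OF natural_filtration_mono])

text \<open>The coefficient is known at the start of the increment, so the product has mean zero.
  Empty intervals are included because the subdivision points below may coincide.\<close>

lemma martingale_term:
  assumes "0 \<le> s" "s \<le> t" "\<phi> \<in> borel_measurable (F s)" "integrable M \<phi>"
  shows "has_bochner_integral M (\<lambda>\<omega>. \<phi> \<omega> * (W t \<omega> - W s \<omega>)) 0"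
proof (cases "s < t")
  case True
  note m = W_increment_moments[OF assms(1) True]
  from indep_of_expectation_mult[OF subalgebra_F W_increment_indep[OF assms(1) True] assms(3,4) m(1)] m(2)
  show ?thesis by (simp add: has_bochner_integral_iff)
next
  case False
  then show ?thesis using assms by (simp add: has_bochner_integral_zero)
qed

lemma square_term:
  assumes "0 \<le> s" "s \<le> t" "\<phi> \<in> borel_measurable (F s)" "integrable M \<phi>"
  shows "has_bochner_integral M (\<lambda>\<omega>. \<phi> \<omega> * (W t \<omega> - W s \<omega>)\<^sup>2) (expectation \<phi> * (t - s))"
proof (cases "s < t")
  case True
  note m = W_increment_moments[OF assms(1) True]
  have "indep_of M (F s) (\<lambda>\<omega>. (W t \<omega> - W s \<omega>)\<^sup>2)"
    by (rule indep_of_compose[OF W_increment_indep[OF assms(1) True]]) simp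
  from indep_of_expectation_mult[OF subalgebra_F this assms(3,4) m(3)] m(4)
  show ?thesis by (simp add: has_bochner_integral_iff)
next
  case False
  then show ?thesis using assms by (simp add: has_bochner_integral_zero)
qed

text \<open>Both intervals are cut at \<open>c\<close> and at the smaller of the two right ends.
  Every mixed product contains an increment whose coefficient is known at its start and averages to
  zero; only the squared increment over the overlap survives.\<close>

lemma increment_product_le:
  assumes "0 \<le> a" "a \<le> b" "a \<le> c" "c \<le> d"
    and \<eta>: "\<eta> \<in> borel_measurable (F a)" "\<And>\<omega>. \<omega> \<in> space M \<Longrightarrow> \<bar>\<eta> \<omega>\<bar> \<le> C"
    and \<zeta>: "\<zeta> \<in> borel_measurable (F c)" "\<And>\<omega>. \<omega> \<in> space M \<Longrightarrow> \<bar>\<zeta> \<omega>\<bar> \<le> D"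
  shows "has_bochner_integral M (\<lambda>\<omega>. (\<eta> \<omega> * (W b \<omega> - W a \<omega>)) * (\<zeta> \<omega> * (W d \<omega> - W c \<omega>)))
    (expectation (\<lambda>\<omega>. \<eta> \<omega> * \<zeta> \<omega>) * max 0 (min b d - max a c))"
proof -
  have inc: "integrable M (\<lambda>\<omega>. W t \<omega> - W s \<omega>)" if "0 \<le> s" "s \<le> t" for s t
    using W_increment_moments(1)[of s t] that by (cases "s = t") auto
  note \<eta>F = measurable_F_mono[OF _ \<eta>(1)] and \<zeta>F = measurable_F_mono[OF _ \<zeta>(1)]
  have WF: "(\<lambda>\<omega>. W t \<omega> - W s \<omega>) \<in> borel_measurable (F r)" if "0 \<le> s" "s \<le> r" "0 \<le> t" "t \<le> r" for s t r
    using that by (intro borel_measurable_diff W_measurable_F)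
  have \<eta>\<zeta>_int: "integrable M (\<lambda>\<omega>. \<eta> \<omega> * \<zeta> \<omega>)"
    by (rule bounded_measurable_integrable[OF \<eta>])
      (assumption, rule integrable_const_bound[where B=D], use \<zeta>(2) measurable_from_subalg[OF subalgebra_F \<zeta>(1)] in auto)
  have int: "integrable M (\<lambda>\<omega>. \<eta> \<omega> * (\<zeta> \<omega> * (W t \<omega> - W s \<omega>)))" if "0 \<le> s" "s \<le> t" for s t
    by (intro bounded_measurable_integrable[OF \<eta>] bounded_measurable_integrable[OF \<zeta>] inc that)
  show ?thesis
  proof (cases "b \<le> c")
    case True
    have "has_bochner_integral M (\<lambda>\<omega>. (\<eta> \<omega> * (\<zeta> \<omega> * (W b \<omega> - W a \<omega>))) * (W d \<omega> - W c \<omega>)) 0"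
      using assms(1-4) True
      by (intro martingale_term int borel_measurable_times \<eta>F \<zeta>F WF) auto
    moreover have "max 0 (min b d - max a c) = 0" using True assms(2,3) by auto
    ultimately show ?thesis by (simp add: mult_ac)
  next
    case False
    define m where "m = min b d"
    have m: "c \<le> m" "m \<le> b" "m \<le> d" "0 \<le> c" "0 \<le> m" using False assms by (auto simp: m_def)
    have t1: "has_bochner_integral M (\<lambda>\<omega>. (\<eta> \<omega> * (\<zeta> \<omega> * (W c \<omega> - W a \<omega>))) * (W m \<omega> - W c \<omega>)) 0"
      using assms(1-4) m by (intro martingale_term int borel_measurable_times \<eta>F \<zeta>F WF) auto
    have t2: "has_bochner_integral M (\<lambda>\<omega>. (\<eta> \<omega> * (\<zeta> \<omega> * (W c \<omega> - W a \<omega>))) * (W d \<omega> - W m \<omega>)) 0"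
      using assms(1-4) m by (intro martingale_term int borel_measurable_times \<eta>F \<zeta>F WF) auto
    have t3: "has_bochner_integral M (\<lambda>\<omega>. (\<eta> \<omega> * (\<zeta> \<omega> * (W m \<omega> - W c \<omega>))) * (W d \<omega> - W m \<omega>)) 0"
      using assms(1-4) m by (intro martingale_term int borel_measurable_times \<eta>F \<zeta>F WF) auto
    have t4: "has_bochner_integral M (\<lambda>\<omega>. (\<eta> \<omega> * (\<zeta> \<omega> * (W m \<omega> - W c \<omega>))) * (W b \<omega> - W m \<omega>)) 0"
      using assms(1-4) m by (intro martingale_term int borel_measurable_times \<eta>F \<zeta>F WF) auto
    have t5: "has_bochner_integral M (\<lambda>\<omega>. (\<eta> \<omega> * \<zeta> \<omega>) * (W m \<omega> - W c \<omega>)\<^sup>2) (expectation (\<lambda>\<omega>. \<eta> \<omega> * \<zeta> \<omega>) * (m - c))"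
      using assms(1-4) m by (intro square_term \<eta>\<zeta>_int borel_measurable_times \<eta>F \<zeta>F) auto
    \<comment> \<open>One of the two intervals ends at \<open>m\<close>, so one factor is zero and
      nothing remains beyond the overlap.\<close>
    have "(W b \<omega> - W m \<omega>) * (W d \<omega> - W m \<omega>) = 0" for \<omega> by (simp add: m_def min_def)
    then have cross: "\<eta> \<omega> * \<zeta> \<omega> * ((W b \<omega> - W m \<omega>) * (W d \<omega> - W m \<omega>)) = 0" for \<omega> by simp
    have "(\<eta> \<omega> * (W b \<omega> - W a \<omega>)) * (\<zeta> \<omega> * (W d \<omega> - W c \<omega>))
       = (\<eta> \<omega> * (\<zeta> \<omega> * (W c \<omega> - W a \<omega>))) * (W m \<omega> - W c \<omega>)
       + (\<eta> \<omega> * (\<zeta> \<omega> * (W c \<omega> - W a \<omega>))) * (W d \<omega> - W m \<omega>)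
       + (\<eta> \<omega> * (\<zeta> \<omega> * (W m \<omega> - W c \<omega>))) * (W d \<omega> - W m \<omega>)
       + (\<eta> \<omega> * (\<zeta> \<omega> * (W m \<omega> - W c \<omega>))) * (W b \<omega> - W m \<omega>)
       + (\<eta> \<omega> * \<zeta> \<omega>) * (W m \<omega> - W c \<omega>)\<^sup>2" for \<omega>
      using cross[of \<omega>] by (simp add: algebra_simps power2_eq_square)
    moreover have "max 0 (min b d - max a c) = m - c" using m assms(3) by (auto simp: m_def)
    ultimately show ?thesis
      using has_bochner_integral_add[OF has_bochner_integral_add[OF has_bochner_integral_add[OF
            has_bochner_integral_add[OF t1 t2] t3] t4] t5] by simp
  qed
qed

lemma increment_product:
  assumes "0 \<le> a" "a \<le> b" "0 \<le> c" "c \<le> d"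
    and \<eta>: "\<eta> \<in> borel_measurable (F a)" "\<And>\<omega>. \<omega> \<in> space M \<Longrightarrow> \<bar>\<eta> \<omega>\<bar> \<le> C"
    and \<zeta>: "\<zeta> \<in> borel_measurable (F c)" "\<And>\<omega>. \<omega> \<in> space M \<Longrightarrow> \<bar>\<zeta> \<omega>\<bar> \<le> D"
  shows "has_bochner_integral M (\<lambda>\<omega>. (\<eta> \<omega> * (W b \<omega> - W a \<omega>)) * (\<zeta> \<omega> * (W d \<omega> - W c \<omega>)))
    (expectation (\<lambda>\<omega>. \<eta> \<omega> * \<zeta> \<omega>) * max 0 (min b d - max a c))"
proof (cases "a \<le> c")
  case True
  then show ?thesis using increment_product_le[OF assms(1,2) True assms(4) \<eta> \<zeta>] by simp
next
  case False
  then have "c \<le> a" by simp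
  from increment_product_le[OF assms(3,4) this assms(2) \<zeta> \<eta>]
  show ?thesis by (simp add: mult.commute min.commute max.commute)
qed

text \<open>The family of weighted intervals is arbitrary and may overlap. This covers the
  difference of two simple integrals on unrelated partitions without a common refinement.\<close>

lemma ito_isometry:
  fixes a b :: "'e \<Rightarrow> real" and \<xi> :: "'e \<Rightarrow> 'w \<Rightarrow> real"
  assumes "finite E" and ab: "\<And>e. e \<in> E \<Longrightarrow> 0 \<le> a e \<and> a e \<le> b e \<and> b e \<le> 1"
    and \<xi>: "\<And>e. e \<in> E \<Longrightarrow> \<xi> e \<in> borel_measurable (F (a e))"
      "\<And>e \<omega>. e \<in> E \<Longrightarrow> \<omega> \<in> space M \<Longrightarrow> \<bar>\<xi> e \<omega>\<bar> \<le> C"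
  shows "(\<integral>\<^sup>+\<omega>. ennreal ((\<Sum>e\<in>E. \<xi> e \<omega> * (W (b e) \<omega> - W (a e) \<omega>))\<^sup>2) \<partial>M)
    = (\<integral>\<^sup>+\<omega>. (\<integral>\<^sup>+s\<in>{0..1}. ennreal ((\<Sum>e\<in>E. \<xi> e \<omega> * indicator {a e<..b e} s)\<^sup>2) \<partial>lborel) \<partial>M)"
proof -
  \<comment> \<open>The length of the overlap of two intervals; both sides of the isometry are the
    same double sum weighted by it.\<close>
  define ov where "ov e e' = max 0 (min (b e) (b e') - max (a e) (a e'))" for e e'
  have sq: "(\<Sum>e\<in>E. f e)\<^sup>2 = (\<Sum>e\<in>E. \<Sum>e'\<in>E. f e * f e')" for f :: "'e \<Rightarrow> real"
    by (simp add: power2_eq_square sum_product)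
  have \<xi>M: "\<xi> e \<in> borel_measurable M" if "e \<in> E" for e
    by (rule measurable_from_subalg[OF subalgebra_F \<xi>(1)[OF that]])
  have int: "integrable M (\<lambda>\<omega>. \<xi> e \<omega> * \<xi> e' \<omega>)" if "e \<in> E" "e' \<in> E" for e e'
    by (rule bounded_measurable_integrable[OF \<xi>[OF that(1)]])
      (assumption, rule integrable_const_bound[where B=C], use \<xi>(2) \<xi>M that in auto)
  have L: "has_bochner_integral M (\<lambda>\<omega>. (\<Sum>e\<in>E. \<xi> e \<omega> * (W (b e) \<omega> - W (a e) \<omega>))\<^sup>2)
      (\<Sum>e\<in>E. \<Sum>e'\<in>E. expectation (\<lambda>\<omega>. \<xi> e \<omega> * \<xi> e' \<omega>) * ov e e')"
    unfolding sq ov_def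
    by (intro has_bochner_integral_sum increment_product[where C=C and D=C]) (use ab \<xi> in auto)
  have R: "has_bochner_integral M (\<lambda>\<omega>. \<Sum>e\<in>E. \<Sum>e'\<in>E. \<xi> e \<omega> * \<xi> e' \<omega> * ov e e')
      (\<Sum>e\<in>E. \<Sum>e'\<in>E. expectation (\<lambda>\<omega>. \<xi> e \<omega> * \<xi> e' \<omega>) * ov e e')"
    by (intro has_bochner_integral_sum has_bochner_integral_mult_left has_bochner_integral_integrable int)
  have inner: "(\<integral>\<^sup>+s\<in>{0..1}. ennreal ((\<Sum>e\<in>E. \<xi> e \<omega> * indicator {a e<..b e} s)\<^sup>2) \<partial>lborel)
      = ennreal (\<Sum>e\<in>E. \<Sum>e'\<in>E. \<xi> e \<omega> * \<xi> e' \<omega> * ov e e')"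
    "0 \<le> (\<Sum>e\<in>E. \<Sum>e'\<in>E. \<xi> e \<omega> * \<xi> e' \<omega> * ov e e')" for \<omega>
  proof -
    have "has_bochner_integral lborel
        (\<lambda>s. \<Sum>e\<in>E. \<Sum>e'\<in>E. \<xi> e \<omega> * \<xi> e' \<omega> * (indicator {a e<..b e} s * indicator {a e'<..b e'} s))
        (\<Sum>e\<in>E. \<Sum>e'\<in>E. \<xi> e \<omega> * \<xi> e' \<omega> * ov e e')"
      unfolding ov_def
      by (intro has_bochner_integral_sum has_bochner_integral_mult_right has_bochner_integral_Ioc_Int)
    moreover have "(\<lambda>s. \<Sum>e\<in>E. \<Sum>e'\<in>E. \<xi> e \<omega> * \<xi> e' \<omega> * (indicator {a e<..b e} s * indicator {a e'<..b e'} s))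
        = (\<lambda>s. (\<Sum>e\<in>E. \<xi> e \<omega> * indicator {a e<..b e} s)\<^sup>2)"
      unfolding sq by (intro ext sum.cong refl) (simp add: mult_ac)
    ultimately have h: "has_bochner_integral lborel (\<lambda>s. (\<Sum>e\<in>E. \<xi> e \<omega> * indicator {a e<..b e} s)\<^sup>2)
        (\<Sum>e\<in>E. \<Sum>e'\<in>E. \<xi> e \<omega> * \<xi> e' \<omega> * ov e e')" by simp
    have "(\<integral>\<^sup>+s\<in>{0..1}. ennreal ((\<Sum>e\<in>E. \<xi> e \<omega> * indicator {a e<..b e} s)\<^sup>2) \<partial>lborel)
        = (\<integral>\<^sup>+s. ennreal ((\<Sum>e\<in>E. \<xi> e \<omega> * indicator {a e<..b e} s)\<^sup>2) \<partial>lborel)"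
    proof (rule nn_integral_cong)
      fix s :: real
      have "(\<Sum>e\<in>E. \<xi> e \<omega> * indicator {a e<..b e} s) = 0" if "s \<notin> {0..1}"
      proof (rule sum.neutral, rule ballI)
        fix e assume "e \<in> E"
        then have "s \<notin> {a e<..b e}" using ab[of e] that by auto
        then show "\<xi> e \<omega> * indicator {a e<..b e} s = 0" by simp
      qed
      then show "ennreal ((\<Sum>e\<in>E. \<xi> e \<omega> * indicator {a e<..b e} s)\<^sup>2) * indicator {0..1} s
          = ennreal ((\<Sum>e\<in>E. \<xi> e \<omega> * indicator {a e<..b e} s)\<^sup>2)"
        by (cases "s \<in> {0..1}") auto
    qed
    also have "\<dots> = ennreal (\<Sum>e\<in>E. \<Sum>e'\<in>E. \<xi> e \<omega> * \<xi> e' \<omega> * ov e e')"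
      using h by (subst nn_integral_eq_integral) (auto simp: has_bochner_integral_iff)
    finally show "(\<integral>\<^sup>+s\<in>{0..1}. ennreal ((\<Sum>e\<in>E. \<xi> e \<omega> * indicator {a e<..b e} s)\<^sup>2) \<partial>lborel)
      = ennreal (\<Sum>e\<in>E. \<Sum>e'\<in>E. \<xi> e \<omega> * \<xi> e' \<omega> * ov e e')" .
    show "0 \<le> (\<Sum>e\<in>E. \<Sum>e'\<in>E. \<xi> e \<omega> * \<xi> e' \<omega> * ov e e')"
    proof -
      have "0 \<le> (\<integral>s. (\<Sum>e\<in>E. \<xi> e \<omega> * indicator {a e<..b e} s)\<^sup>2 \<partial>lborel)" by simp
      then show ?thesis using h by (simp only: has_bochner_integral_iff)
    qed
  qed
  show ?thesis
    unfolding inner(1)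
    using L R inner(2) by (subst (1 2) nn_integral_eq_integral) (auto simp: has_bochner_integral_iff)
qed

lemma simple_integrand_bounds:
  assumes "simple_integrand M F 0 1 m \<tau> \<xi>" "i < m"
  shows "0 \<le> \<tau> i" "\<tau> i \<le> \<tau> (Suc i)" "\<tau> (Suc i) \<le> 1"
proof -
  have \<tau>: "\<tau> 0 = 0" "\<tau> m = 1" "\<And>i. i < m \<Longrightarrow> \<tau> i < \<tau> (Suc i)"
    using assms(1) unfolding simple_integrand_def by auto
  have mono: "\<tau> i \<le> \<tau> j" if "i \<le> j" "j \<le> m" for i j
    using that
  proof (induction j rule: dec_induct)
    case (step j)
    then show ?case using \<tau>(3)[of j] by simp
  qed simp
  show "0 \<le> \<tau> i" "\<tau> i \<le> \<tau> (Suc i)" "\<tau> (Suc i) \<le> 1"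
    using mono[of 0 i] mono[of i "Suc i"] mono[of "Suc i" m] \<tau> assms(2) by auto
qed

lemma simple_ito_integral_diff:
  assumes 1: "simple_integrand M F 0 1 m \<tau> \<xi>" and 2: "simple_integrand M F 0 1 m' \<tau>' \<xi>'"
  shows "(\<integral>\<^sup>+\<omega>. ennreal ((simple_ito_integral W m \<tau> \<xi> \<omega> - simple_ito_integral W m' \<tau>' \<xi>' \<omega>)\<^sup>2) \<partial>M)
    = (\<integral>\<^sup>+\<omega>. (\<integral>\<^sup>+s\<in>{0..1}. ennreal ((simple_process m \<tau> \<xi> s \<omega> - simple_process m' \<tau>' \<xi>' s \<omega>)\<^sup>2) \<partial>lborel) \<partial>M)"
proof -
  \<comment> \<open>The disjoint union of the two partitions, with the weights of the second one
    negated in \<open>x\<close>.\<close>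
  define E where "E = {..<m} <+> {..<m'}"
  define a where "a = case_sum \<tau> \<tau>'"
  define b where "b = case_sum (\<lambda>i. \<tau> (Suc i)) (\<lambda>i. \<tau>' (Suc i))"
  define x where "x = case_sum \<xi> (\<lambda>i \<omega>. - \<xi>' i \<omega>)"
  obtain C1 C2 where C: "\<And>i \<omega>. i < m \<Longrightarrow> \<omega> \<in> space M \<Longrightarrow> \<bar>\<xi> i \<omega>\<bar> \<le> C1"
    "\<And>i \<omega>. i < m' \<Longrightarrow> \<omega> \<in> space M \<Longrightarrow> \<bar>\<xi>' i \<omega>\<bar> \<le> C2"
    using 1 2 unfolding simple_integrand_def by blast
  have m: "\<And>i. i < m \<Longrightarrow> \<xi> i \<in> borel_measurable (F (\<tau> i))" "\<And>i. i < m' \<Longrightarrow> \<xi>' i \<in> borel_measurable (F (\<tau>' i))"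
    using 1 2 unfolding simple_integrand_def by auto
  have "(\<integral>\<^sup>+\<omega>. ennreal ((\<Sum>e\<in>E. x e \<omega> * (W (b e) \<omega> - W (a e) \<omega>))\<^sup>2) \<partial>M)
    = (\<integral>\<^sup>+\<omega>. (\<integral>\<^sup>+s\<in>{0..1}. ennreal ((\<Sum>e\<in>E. x e \<omega> * indicator {a e<..b e} s)\<^sup>2) \<partial>lborel) \<partial>M)"
  proof (rule ito_isometry[where C="max C1 C2"])
    fix e assume e: "e \<in> E"
    show "0 \<le> a e \<and> a e \<le> b e \<and> b e \<le> 1"
      using e simple_integrand_bounds[OF 1] simple_integrand_bounds[OF 2]
      by (auto simp: E_def a_def b_def)
    show "x e \<in> borel_measurable (F (a e))"
      using e m by (auto simp: E_def a_def x_def)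
    show "\<bar>x e \<omega>\<bar> \<le> max C1 C2" if "\<omega> \<in> space M" for \<omega>
      using e C[OF _ that] by (auto simp: E_def x_def le_max_iff_disj)
  qed (simp add: E_def)
  moreover have "(\<Sum>e\<in>E. x e \<omega> * (W (b e) \<omega> - W (a e) \<omega>))
      = simple_ito_integral W m \<tau> \<xi> \<omega> - simple_ito_integral W m' \<tau>' \<xi>' \<omega>" for \<omega>
    unfolding E_def by (subst sum.Plus) (simp_all add: x_def a_def b_def simple_ito_integral_def sum_negf)
  moreover have "(\<Sum>e\<in>E. x e \<omega> * indicator {a e<..b e} s)
      = simple_process m \<tau> \<xi> s \<omega> - simple_process m' \<tau>' \<xi>' s \<omega>" for \<omega> s
    unfolding E_def by (subst sum.Plus) (simp_all add: x_def a_def b_def simple_process_def sum_negf)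
  ultimately show ?thesis by simp
qed

section \<open>From simple to general integrands\<close>

lemma simple_ito_integral_measurable:
  assumes 1: "simple_integrand M F 0 1 m \<tau> \<xi>"
  shows "simple_ito_integral W m \<tau> \<xi> \<in> borel_measurable M"
  unfolding simple_ito_integral_def[abs_def]
proof (intro borel_measurable_sum borel_measurable_times borel_measurable_diff)
  fix i assume "i \<in> {..<m}"
  then have i: "i < m" by simp
  show "\<xi> i \<in> borel_measurable M"
    using 1 i measurable_from_subalg[OF subalgebra_F] unfolding simple_integrand_def by blast
  show "W (\<tau> (Suc i)) \<in> borel_measurable M" "W (\<tau> i) \<in> borel_measurable M"
    using simple_integrand_bounds[OF 1 i] by (auto intro!: W_measurable)
qed

text \<open>The squared distance in L2 of time and chance, in the iterated form of
  \<open>has_ito_integral\<close>, so that convergence can be transferred by unfolding.\<close>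

definition sq_dist :: "(real \<Rightarrow> 'w \<Rightarrow> real) \<Rightarrow> (real \<Rightarrow> 'w \<Rightarrow> real) \<Rightarrow> ennreal" where
  "sq_dist f g = (\<integral>\<^sup>+\<omega>. (\<integral>\<^sup>+s\<in>{0..1}. ennreal ((f s \<omega> - g s \<omega>)\<^sup>2) \<partial>lborel) \<partial>M)"

text \<open>The indicator discards times outside the unit interval, where a control is arbitrary and
  need not be measurable.\<close>

definition jointly_measurable :: "(real \<Rightarrow> 'w \<Rightarrow> real) \<Rightarrow> bool" where
  "jointly_measurable f \<longleftrightarrow> (\<lambda>(\<omega>, s). f s \<omega> * indicator {0..1} s) \<in> borel_measurable (M \<Otimes>\<^sub>M lborel)"

lemma simple_process_jointly_measurable:
  assumes 1: "simple_integrand M F 0 1 m \<tau> \<xi>"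
  shows "jointly_measurable (simple_process m \<tau> \<xi>)"
proof -
  have "\<xi> i \<in> borel_measurable M" if "i < m" for i
    using 1 that measurable_from_subalg[OF subalgebra_F] unfolding simple_integrand_def by blast
  note this[measurable]
  show ?thesis
    unfolding jointly_measurable_def simple_process_def case_prod_beta' by measurable
qed

lemma sq_dist_pair:
  assumes "jointly_measurable f" "jointly_measurable g"
  shows "sq_dist f g = (\<integral>\<^sup>+p. ennreal (((case p of (\<omega>, s) \<Rightarrow> f s \<omega> * indicator {0..1} s)
      - (case p of (\<omega>, s) \<Rightarrow> g s \<omega> * indicator {0..1} s))\<^sup>2) \<partial>(M \<Otimes>\<^sub>M lborel))"
proof -
  note [measurable] = assms[unfolded jointly_measurable_def]
  have "sq_dist f g = (\<integral>\<^sup>+\<omega>. \<integral>\<^sup>+s. ennreal ((f s \<omega> * indicator {0..1} s - g s \<omega> * indicator {0..1} s)\<^sup>2) \<partial>lborel \<partial>M)"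
    unfolding sq_dist_def by (intro nn_integral_cong) (auto simp: indicator_def)
  also have "\<dots> = (\<integral>\<^sup>+p. (\<lambda>(\<omega>, s). ennreal ((f s \<omega> * indicator {0..1} s - g s \<omega> * indicator {0..1} s)\<^sup>2)) p \<partial>(M \<Otimes>\<^sub>M lborel))"
    by (subst lborel.nn_integral_fst[symmetric]) (use assms in \<open>auto simp: jointly_measurable_def case_prod_beta'\<close>)
  also have "\<dots> = (\<integral>\<^sup>+p. ennreal (((case p of (\<omega>, s) \<Rightarrow> f s \<omega> * indicator {0..1} s)
      - (case p of (\<omega>, s) \<Rightarrow> g s \<omega> * indicator {0..1} s))\<^sup>2) \<partial>(M \<Otimes>\<^sub>M lborel))"
    by (simp only: case_prod_beta')
  finally show ?thesis .
qed

lemma sq_dist_triangle: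
  assumes "jointly_measurable f" "jointly_measurable g" "jointly_measurable h"
  shows "sq_dist f h \<le> 2 * sq_dist f g + 2 * sq_dist g h"
  unfolding sq_dist_pair[OF assms(1,3)] sq_dist_pair[OF assms(1,2)] sq_dist_pair[OF assms(2,3)]
  by (rule nn_integral_square_diff_le) (use assms in \<open>auto simp: jointly_measurable_def\<close>)

lemma sq_dist_commute: "sq_dist f g = sq_dist g f"
  unfolding sq_dist_def by (simp add: power2_commute)

text \<open>The estimate holds for every version \<open>I\<close>, whatever approximating sequence
  certifies it, and so for the one selected by \<open>ito_integral\<close>. The triangle inequality
  with factor 2 is used once for the integrals and once for the integrands, whence 4.\<close>

lemma has_ito_integral_dist:
  assumes I: "has_ito_integral M F W 0 1 f I" and f: "jointly_measurable f"
    and s: "simple_integrand M F 0 1 m \<tau> \<xi>"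
  shows "(\<integral>\<^sup>+\<omega>. ennreal ((simple_ito_integral W m \<tau> \<xi> \<omega> - I \<omega>)\<^sup>2) \<partial>M) \<le> 4 * sq_dist (simple_process m \<tau> \<xi>) f"
proof -
  obtain m' \<tau>' \<xi>' where s': "\<And>j::nat. simple_integrand M F 0 1 (m' j) (\<tau>' j) (\<xi>' j)"
    and A: "(\<lambda>j. sq_dist (simple_process (m' j) (\<tau>' j) (\<xi>' j)) f) \<longlonglongrightarrow> 0"
    and D: "(\<lambda>j. \<integral>\<^sup>+\<omega>. ennreal ((simple_ito_integral W (m' j) (\<tau>' j) (\<xi>' j) \<omega> - I \<omega>)\<^sup>2) \<partial>M) \<longlonglongrightarrow> 0"
    using I unfolding has_ito_integral_def sq_dist_def by blast
  have IM: "I \<in> borel_measurable M" using I unfolding has_ito_integral_def by blast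
  let ?s = "simple_process m \<tau> \<xi>" and ?s' = "\<lambda>j. simple_process (m' j) (\<tau>' j) (\<xi>' j)"
  let ?Y = "simple_ito_integral W m \<tau> \<xi>" and ?Y' = "\<lambda>j. simple_ito_integral W (m' j) (\<tau>' j) (\<xi>' j)"
  have bound: "(\<integral>\<^sup>+\<omega>. ennreal ((?Y \<omega> - I \<omega>)\<^sup>2) \<partial>M)
      \<le> 2 * (2 * sq_dist ?s f + 2 * sq_dist (?s' j) f) + 2 * (\<integral>\<^sup>+\<omega>. ennreal ((?Y' j \<omega> - I \<omega>)\<^sup>2) \<partial>M)" for j
  proof -
    have "(\<integral>\<^sup>+\<omega>. ennreal ((?Y \<omega> - I \<omega>)\<^sup>2) \<partial>M)
      \<le> 2 * (\<integral>\<^sup>+\<omega>. ennreal ((?Y \<omega> - ?Y' j \<omega>)\<^sup>2) \<partial>M) + 2 * (\<integral>\<^sup>+\<omega>. ennreal ((?Y' j \<omega> - I \<omega>)\<^sup>2) \<partial>M)"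
      by (rule nn_integral_square_diff_le[OF simple_ito_integral_measurable[OF s] simple_ito_integral_measurable[OF s'] IM])
    also have "(\<integral>\<^sup>+\<omega>. ennreal ((?Y \<omega> - ?Y' j \<omega>)\<^sup>2) \<partial>M) = sq_dist ?s (?s' j)"
      unfolding sq_dist_def by (rule simple_ito_integral_diff[OF s s'])
    also have "2 * sq_dist ?s (?s' j) + 2 * (\<integral>\<^sup>+\<omega>. ennreal ((?Y' j \<omega> - I \<omega>)\<^sup>2) \<partial>M)
      \<le> 2 * (2 * sq_dist ?s f + 2 * sq_dist f (?s' j)) + 2 * (\<integral>\<^sup>+\<omega>. ennreal ((?Y' j \<omega> - I \<omega>)\<^sup>2) \<partial>M)"
      by (intro add_right_mono mult_left_mono sq_dist_triangle f simple_process_jointly_measurable[OF s]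
          simple_process_jointly_measurable[OF s']) simp
    finally show ?thesis by (simp only: sq_dist_commute[of f])
  qed
  have "(\<lambda>j. 2 * (2 * sq_dist ?s f + 2 * sq_dist (?s' j) f) + 2 * (\<integral>\<^sup>+\<omega>. ennreal ((?Y' j \<omega> - I \<omega>)\<^sup>2) \<partial>M))
      \<longlonglongrightarrow> 2 * (2 * sq_dist ?s f + 2 * 0) + 2 * 0"
    by (intro tendsto_add tendsto_const ennreal_tendsto_cmult A D) simp_all
  then have "(\<integral>\<^sup>+\<omega>. ennreal ((?Y \<omega> - I \<omega>)\<^sup>2) \<partial>M) \<le> 2 * (2 * sq_dist ?s f + 2 * 0) + 2 * 0"
    by (rule LIMSEQ_le_const) (use bound in blast)
  also have "\<dots> = 4 * sq_dist ?s f" by (simp add: mult.assoc[symmetric])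
  finally show ?thesis .
qed

text \<open>The isometry makes the simple integrals Cauchy along a fast subsequence; completeness
  supplies the limit.\<close>

lemma has_ito_integral_exists:
  assumes f: "jointly_measurable f"
    and s: "\<And>j::nat. simple_integrand M F 0 1 (m j) (\<tau> j) (\<xi> j)"
    and A: "(\<lambda>j. sq_dist (simple_process (m j) (\<tau> j) (\<xi> j)) f) \<longlonglongrightarrow> 0"
  shows "\<exists>I. has_ito_integral M F W 0 1 f I"
proof -
  let ?s = "\<lambda>j. simple_process (m j) (\<tau> j) (\<xi> j)" and ?Y = "\<lambda>j. simple_ito_integral W (m j) (\<tau> j) (\<xi> j)"
  \<comment> \<open>The extra quarter compensates the factor 2 in front of each of the two terms of
    the triangle inequality, leaving the rate \<open>(1/8)^j\<close>.\<close>
  have "\<exists>r. sq_dist (?s r) f < ennreal ((1/8)^j / 4)" for j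
  proof -
    have "\<forall>\<^sub>F r in sequentially. sq_dist (?s r) f < ennreal ((1/8)^j / 4)"
      by (rule order_tendstoD[OF A]) simp
    then show ?thesis by (rule eventually_happens'[OF sequentially_bot])
  qed
  then have "\<exists>r. \<forall>j. sq_dist (?s (r j)) f < ennreal ((1/8)^j / 4)" by (intro choice allI)
  then obtain r where r: "\<And>j. sq_dist (?s (r j)) f < ennreal ((1/8)^j / 4)" by blast
  have "(\<integral>\<^sup>+\<omega>. ennreal ((?Y (r j) \<omega> - ?Y (r k) \<omega>)\<^sup>2) \<partial>M) \<le> ennreal ((1/8)^j)" if "j \<le> k" for j k
  proof -
    have "(\<integral>\<^sup>+\<omega>. ennreal ((?Y (r j) \<omega> - ?Y (r k) \<omega>)\<^sup>2) \<partial>M) = sq_dist (?s (r j)) (?s (r k))"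
      unfolding sq_dist_def by (rule simple_ito_integral_diff[OF s s])
    also have "\<dots> \<le> 2 * sq_dist (?s (r j)) f + 2 * sq_dist f (?s (r k))"
      by (rule sq_dist_triangle[OF simple_process_jointly_measurable[OF s] f simple_process_jointly_measurable[OF s]])
    also have "\<dots> \<le> 2 * ennreal ((1/8)^j / 4) + 2 * ennreal ((1/8)^j / 4)"
    proof (intro add_mono mult_left_mono)
      show "sq_dist (?s (r j)) f \<le> ennreal ((1/8)^j / 4)" using r[of j] by simp
      have "sq_dist f (?s (r k)) \<le> ennreal ((1/8)^k / 4)" using r[of k] by (simp add: sq_dist_commute[of f])
      also have "\<dots> \<le> ennreal ((1/8)^j / 4)"
        using power_decreasing[OF that, of "1/8::real"] by (intro ennreal_leI) simp
      finally show "sq_dist f (?s (r k)) \<le> ennreal ((1/8)^j / 4)" .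
    qed simp_all
    also have "\<dots> = ennreal ((1/8)^j)"
    proof -
      define y :: real where "y = (1/8)^j / 4"
      have y: "0 \<le> y" "(1/8)^j = 2 * y + 2 * y" by (simp_all add: y_def)
      have "ennreal (2 * y + 2 * y) = ennreal (2 * y) + ennreal (2 * y)"
        by (rule ennreal_plus) (use y(1) in simp_all)
      also have "ennreal (2 * y) = 2 * ennreal y" using y(1) by (simp add: ennreal_mult)
      finally have "2 * ennreal y + 2 * ennreal y = ennreal ((1/8)^j)" unfolding y(2) by (rule sym)
      then show ?thesis unfolding y_def .
    qed
    finally show ?thesis .
  qed
  from nn_integral_L2_complete[where Y="\<lambda>j. ?Y (r j)", OF simple_ito_integral_measurable[OF s] this]
  obtain I where I: "I \<in> borel_measurable M"
    "\<And>j. (\<integral>\<^sup>+\<omega>. ennreal ((?Y (r j) \<omega> - I \<omega>)\<^sup>2) \<partial>M) \<le> ennreal ((1/8)^j)" by blast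
  have lim: "(\<lambda>j. ennreal ((1/8)^j)) \<longlonglongrightarrow> 0"
    using tendsto_ennrealI[OF LIMSEQ_realpow_zero[of "1/8"]] by simp
  have "has_ito_integral M F W 0 1 f I"
    unfolding has_ito_integral_def
  proof (intro conjI exI[of _ "\<lambda>j. m (r j)"] exI[of _ "\<lambda>j. \<tau> (r j)"] exI[of _ "\<lambda>j. \<xi> (r j)"] allI s I(1))
    show "(\<lambda>j. \<integral>\<^sup>+\<omega>. (\<integral>\<^sup>+s\<in>{0..1}. ennreal ((?s (r j) s \<omega> - f s \<omega>)\<^sup>2) \<partial>lborel) \<partial>M) \<longlonglongrightarrow> 0"
    proof (rule tendsto_sandwich[OF _ _ tendsto_const lim])
      show "\<forall>\<^sub>F j in sequentially. (\<integral>\<^sup>+\<omega>. (\<integral>\<^sup>+s\<in>{0..1}. ennreal ((?s (r j) s \<omega> - f s \<omega>)\<^sup>2) \<partial>lborel) \<partial>M) \<le> ennreal ((1/8)^j)"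
      proof (rule always_eventually, rule allI)
        fix j
        have "ennreal ((1/8)^j / 4) \<le> ennreal ((1/8)^j)" by (intro ennreal_leI) simp
        then show "(\<integral>\<^sup>+\<omega>. (\<integral>\<^sup>+s\<in>{0..1}. ennreal ((?s (r j) s \<omega> - f s \<omega>)\<^sup>2) \<partial>lborel) \<partial>M) \<le> ennreal ((1/8)^j)"
          by (rule less_imp_le[OF order_less_le_trans[OF r[of j, unfolded sq_dist_def]]])
      qed
    qed simp
    show "(\<lambda>j. \<integral>\<^sup>+\<omega>. ennreal ((?Y (r j) \<omega> - I \<omega>)\<^sup>2) \<partial>M) \<longlonglongrightarrow> 0"
      by (rule tendsto_sandwich[OF _ _ tendsto_const lim]) (use I(2) in auto)
  qed
  then show ?thesis by blast
qed

end

section \<open>Approximation by lagged averages over a grid\<close>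

text \<open>Half-open on the left, as in simple processes. Hence 0 lies in no slot, a null set that
  is excluded through \<open>AE_unit_time\<close>.\<close>

definition slot :: "nat \<Rightarrow> nat \<Rightarrow> real set" where
  "slot n i = {real i / n<..real (Suc i) / n}"

text \<open>For \<open>i = 0\<close> this lies to the left of 0. No special treatment arises,
  because controls are extended to negative times by clamping.\<close>

definition previous_slot :: "nat \<Rightarrow> nat \<Rightarrow> real set" where
  "previous_slot n i = {(real i - 1) / n<..real i / n}"

text \<open>On each slot, the fraction of the preceding slot spent in \<open>A\<close>: an
  approximation of the indicator that uses only the past.\<close>

definition lagged_average :: "nat \<Rightarrow> real set \<Rightarrow> real \<Rightarrow> real" where
  "lagged_average n A s = (\<Sum>i<n. indicator (slot n i) s * (n * measure lborel (A \<inter> previous_slot n i)))"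

lemma slot_borel [measurable]: "slot n i \<in> sets borel" "previous_slot n i \<in> sets borel"
  unfolding slot_def previous_slot_def by auto

lemma measure_slots:
  assumes "0 < n"
  shows "measure lborel (slot n i) = 1 / n" "measure lborel (previous_slot n i) = 1 / n"
    "emeasure lborel (slot n i) = ennreal (1 / n)" "emeasure lborel (previous_slot n i) = ennreal (1 / n)"
proof -
  have "real (Suc i) / n - real i / n = 1 / n" "real i / n - (real i - 1) / n = 1 / n"
    by (simp_all add: diff_divide_distrib add_divide_distrib)
  moreover have "real i / n \<le> real (Suc i) / n" "(real i - 1) / n \<le> real i / n"
    using assms by (auto intro!: divide_right_mono)
  ultimately show "measure lborel (slot n i) = 1 / n" "measure lborel (previous_slot n i) = 1 / n"
    "emeasure lborel (slot n i) = ennreal (1 / n)" "emeasure lborel (previous_slot n i) = ennreal (1 / n)"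
    unfolding slot_def previous_slot_def by (simp_all only: emeasure_lborel_Ioc measure_lborel_Ioc)
qed

lemma slot_index:
  assumes "0 < n" "0 < s" "s \<le> 1"
  shows "\<exists>i<n. s \<in> slot n i"
proof -
  define i where "i = nat (\<lceil>s * n\<rceil> - 1)"
  have "0 < s * n" using assms by simp
  then have pos: "0 < \<lceil>s * n\<rceil>" by simp
  then have i: "real i = of_int \<lceil>s * n\<rceil> - 1" unfolding i_def by simp
  have "s * real n \<le> 1 * real n" by (rule mult_right_mono) (use assms in auto)
  then have "\<lceil>s * n\<rceil> \<le> int n" by (simp add: ceiling_le_iff)
  then have "i < n" using pos unfolding i_def by linarith
  moreover have "real i < s * n" "s * n \<le> real (Suc i)"
    using i le_of_int_ceiling[of "s * n"] ceiling_correct[of "s * n"] by linarith+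
  then have "s \<in> slot n i" unfolding slot_def using assms(1) by (simp add: pos_divide_less_eq pos_le_divide_eq)
  ultimately show ?thesis by blast
qed

lemma slot_unique:
  assumes "s \<in> slot n i" "s \<in> slot n j"
  shows "i = j"
proof (rule ccontr)
  assume "i \<noteq> j"
  have *: False if "i < j" "s \<in> slot n i" "s \<in> slot n j" for i j
  proof -
    have "real (Suc i) / n \<le> real j / n" using that(1) by (intro divide_right_mono) auto
    then show False using that(2,3) unfolding slot_def by auto
  qed
  show False using \<open>i \<noteq> j\<close> *[of i j] *[of j i] assms by (cases i j rule: linorder_cases) auto
qed

lemma sum_slot:
  assumes "s \<in> slot n i" "i < n"
  shows "(\<Sum>j<n. indicator (slot n j) s * f j) = (f i :: real)"
proof -
  have "(\<Sum>j<n. indicator (slot n j) s * f j) = (\<Sum>j<n. if j = i then f j else 0)"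
  proof (rule sum.cong[OF refl])
    fix j
    show "indicator (slot n j) s * f j = (if j = i then f j else 0)"
    proof (cases "j = i")
      case False
      then have "s \<notin> slot n j" using slot_unique[OF assms(1), of j] by blast
      then show ?thesis using False by simp
    qed (use assms(1) in simp)
  qed
  then show ?thesis using assms(2) by simp
qed

lemma lagged_average_slot:
  "s \<in> slot n i \<Longrightarrow> i < n \<Longrightarrow> lagged_average n A s = n * measure lborel (A \<inter> previous_slot n i)"
  unfolding lagged_average_def by (rule sum_slot)

text \<open>Integration over the unit interval as a probability measure on the whole line: bounded
  Borel functions are integrable, and sections need no restricted spaces.\<close>

definition unit_time :: "real measure" where
  "unit_time = uniform_measure lborel {0..1}"

lemma prob_space_unit_time: "prob_space unit_time"
  unfolding unit_time_def by (rule prob_space_uniform_measure) auto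

lemma sets_unit_time [measurable_cong, simp]: "sets unit_time = sets borel"
  unfolding unit_time_def by simp

lemma space_unit_time [simp]: "space unit_time = UNIV"
  unfolding unit_time_def by simp

lemma nn_integral_unit_time:
  "f \<in> borel_measurable borel \<Longrightarrow> (\<integral>\<^sup>+s. f s \<partial>unit_time) = (\<integral>\<^sup>+s\<in>{0..1}. f s \<partial>lborel)"
  unfolding unit_time_def by (subst nn_integral_uniform_measure) (auto simp: divide_ennreal_def)

lemma unit_time_density: "unit_time = density lborel (\<lambda>s. ennreal (indicator {0..1} s))"
  unfolding unit_time_def uniform_measure_def by (simp add: divide_ennreal_def ennreal_indicator)

lemma integral_unit_time:
  fixes f :: "real \<Rightarrow> real"
  assumes "f \<in> borel_measurable borel"
  shows "(\<integral>s. f s \<partial>unit_time) = (LINT s:{0..1}|lborel. f s)"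
  unfolding unit_time_density set_lebesgue_integral_def
  by (rule integral_density) (use assms in auto)

lemma AE_unit_time: "AE s in unit_time. 0 < s \<and> s \<le> 1"
proof -
  have "AE s in lborel. s \<noteq> (0::real)" by (rule AE_lborel_singleton)
  then have "AE s in lborel. s \<in> {0..1} \<longrightarrow> 0 < s \<and> s \<le> (1::real)" by eventually_elim auto
  then show ?thesis unfolding unit_time_def by (intro AE_uniform_measureI) auto
qed

lemma unit_time_measure:
  assumes "A \<in> sets borel"
  shows "measure unit_time A = measure lborel ({0..1} \<inter> A)"
  unfolding unit_time_def using assms by (subst measure_uniform_measure) auto

interpretation unit_time: prob_space unit_time
  by (rule prob_space_unit_time)

lemma unit_time_measure_Icc_le:
  assumes "a \<le> b"
  shows "measure unit_time {a..b} \<le> b - a"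
proof -
  have "measure lborel ({0..1} \<inter> {a..b}) \<le> measure lborel {a..b}"
    by (rule measure_mono_fmeasurable) (use assms in \<open>auto simp: fmeasurable_def\<close>)
  then show ?thesis using assms by (simp add: unit_time_measure)
qed

lemma measure_slot_le:
  assumes "0 < n" "A \<in> sets borel"
  shows "n * measure lborel (A \<inter> previous_slot n i) \<le> 1"
proof -
  have "measure lborel (A \<inter> previous_slot n i) \<le> measure lborel (previous_slot n i)"
    using assms measure_slots(4)[OF assms(1), of i] by (intro measure_mono_fmeasurable) (auto simp: fmeasurable_def)
  then show ?thesis using measure_slots(2)[OF assms(1), of i] assms(1) by (simp add: field_simps)
qed

lemma lagged_average_measurable [measurable]: "lagged_average n A \<in> borel_measurable borel"
  unfolding lagged_average_def[abs_def] by measurable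

lemma lagged_average_bounds:
  assumes "A \<in> sets borel" "0 < n" "0 < s" "s \<le> 1"
  shows "0 \<le> lagged_average n A s" "lagged_average n A s \<le> 1"
proof -
  obtain i where i: "i < n" "s \<in> slot n i" using slot_index[OF assms(2-4)] by blast
  show "0 \<le> lagged_average n A s" "lagged_average n A s \<le> 1"
    unfolding lagged_average_slot[OF i(2,1)] using measure_slot_le[OF assms(2,1)] by simp_all
qed

definition lag_error :: "nat \<Rightarrow> real set \<Rightarrow> real" where
  "lag_error n A = (\<integral>s. \<bar>lagged_average n A s - indicator A s\<bar> \<partial>unit_time)"

lemma lag_error_integrable:
  assumes A: "A \<in> sets borel" and "0 < n"
  shows "integrable unit_time (\<lambda>s. \<bar>lagged_average n A s - indicator A s\<bar>)"
    "integrable unit_time (lagged_average n A)"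
proof -
  note [measurable] = A
  show "integrable unit_time (lagged_average n A)"
  proof (rule unit_time.integrable_const_bound[where B=1])
    show "AE s in unit_time. norm (lagged_average n A s) \<le> 1"
      using AE_unit_time by eventually_elim (use lagged_average_bounds[OF A \<open>0 < n\<close>] in simp)
  qed measurable
  moreover have "integrable unit_time (indicator A :: real \<Rightarrow> real)"
    by (rule unit_time.integrable_const_bound[where B=1]) (auto simp: indicator_def)
  ultimately show "integrable unit_time (\<lambda>s. \<bar>lagged_average n A s - indicator A s\<bar>)" by simp
qed

text \<open>Integrating over a slot of length 1/n undoes the normalisation by \<open>n\<close>; the
  preceding slots are disjoint and lie in the window from -1 to 1.\<close>

lemma lagged_average_integral_le:
  assumes A: "A \<in> sets borel" and "0 < n"
  shows "(\<integral>s. lagged_average n A s \<partial>unit_time) \<le> measure lborel (A \<inter> {-1..1})"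
proof -
  note [measurable] = A
  have fin: "A \<inter> previous_slot n i \<in> fmeasurable lborel" for i
  proof -
    have "emeasure lborel (A \<inter> previous_slot n i) \<le> emeasure lborel (previous_slot n i)"
      by (rule emeasure_mono) auto
    then show ?thesis
      unfolding measure_slots(4)[OF \<open>0 < n\<close>] fmeasurable_def by (auto simp: ennreal_less_top le_less_trans)
  qed
  have int: "integrable unit_time (indicator (slot n i) :: real \<Rightarrow> real)" for i
    by (rule unit_time.integrable_const_bound[where B=1]) (auto simp: indicator_def)
  have "(\<integral>s. lagged_average n A s \<partial>unit_time)
      = (\<Sum>i<n. measure unit_time (slot n i) * (n * measure lborel (A \<inter> previous_slot n i)))"
    unfolding lagged_average_def by (subst Bochner_Integration.integral_sum) (use int in auto)
  also have "\<dots> \<le> (\<Sum>i<n. measure lborel (A \<inter> previous_slot n i))"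
  proof (rule sum_mono)
    fix i
    have "measure unit_time (slot n i) \<le> measure lborel (slot n i)"
      unfolding unit_time_measure[OF slot_borel(1)]
      by (rule measure_mono_fmeasurable) (use measure_slots(3)[OF \<open>0 < n\<close>, of i] in \<open>auto simp: fmeasurable_def\<close>)
    then have "measure unit_time (slot n i) * (n * measure lborel (A \<inter> previous_slot n i))
        \<le> 1 / n * (n * measure lborel (A \<inter> previous_slot n i))"
      unfolding measure_slots(1)[OF \<open>0 < n\<close>] by (rule mult_right_mono) simp
    then show "measure unit_time (slot n i) * (n * measure lborel (A \<inter> previous_slot n i))
        \<le> measure lborel (A \<inter> previous_slot n i)" using \<open>0 < n\<close> by simp
  qed
  also have "\<dots> = measure lborel (\<Union>i<n. A \<inter> previous_slot n i)"
  proof (rule measure_finite_Union[symmetric])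
    show "disjoint_family_on (\<lambda>i. A \<inter> previous_slot n i) {..<n}"
    proof -
      \<comment> \<open>Shifting by one slot reduces disjointness of the preceding slots to that of
        the slots.\<close>
      have "x + 1 / n \<in> slot n i" if "x \<in> previous_slot n i" for x i
        using that \<open>0 < n\<close> unfolding slot_def previous_slot_def by (auto simp: diff_divide_distrib add_divide_distrib)
      then show ?thesis unfolding disjoint_family_on_def using slot_unique by blast
    qed
    show "emeasure lborel (A \<inter> previous_slot n i) \<noteq> \<infinity>" for i
      using fin[of i] by (auto simp: fmeasurable_def)
  qed auto
  also have "\<dots> \<le> measure lborel (A \<inter> {-1..1})"
  proof (rule measure_mono_fmeasurable)
    have "previous_slot n i \<subseteq> {-1..1}" if "i < n" for i
    proof
      fix x assume x: "x \<in> previous_slot n i"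
      have n: "0 < real n" using \<open>0 < n\<close> by simp
      have "-1 \<le> (real i - 1) / n" using n by (simp add: pos_le_divide_eq)
      moreover have "real i / n \<le> 1" using n that by (simp add: pos_divide_le_eq)
      ultimately show "x \<in> {-1..1}" using x unfolding previous_slot_def by auto
    qed
    then show "(\<Union>i<n. A \<inter> previous_slot n i) \<subseteq> A \<inter> {-1..1}" by blast
    have "emeasure lborel (A \<inter> {-1..1}) \<le> emeasure lborel {-1..1::real}" by (rule emeasure_mono) auto
    also have "\<dots> < \<infinity>" by simp
    finally show "A \<inter> {-1..1} \<in> fmeasurable lborel" by (auto simp: fmeasurable_def)
  qed auto
  finally show ?thesis .
qed

text \<open>A bound uniform in \<open>n\<close>, which later discards the tail of a countable union.
  The window reaches left of 0 because the first preceding slot does.\<close>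

lemma lag_error_le:
  assumes A: "A \<in> sets borel" and "0 < n"
  shows "lag_error n A \<le> 2 * measure lborel (A \<inter> {-1..1})"
proof -
  note [measurable] = A
  have i: "integrable unit_time (indicator A :: real \<Rightarrow> real)"
    by (rule unit_time.integrable_const_bound[where B=1]) (auto simp: indicator_def)
  have "lag_error n A \<le> (\<integral>s. lagged_average n A s + indicator A s \<partial>unit_time)"
    unfolding lag_error_def
  proof (rule integral_mono_AE)
    show "AE s in unit_time. \<bar>lagged_average n A s - indicator A s\<bar> \<le> lagged_average n A s + indicator A s"
      using AE_unit_time
    proof eventually_elim
      case (elim s)
      then have "0 \<le> lagged_average n A s" using lagged_average_bounds(1)[OF A \<open>0 < n\<close>] by blast
      moreover have "0 \<le> (indicator A s :: real)" by simp
      ultimately show ?case by linarith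
    qed
  qed (use lag_error_integrable[OF assms] i in auto)
  also have "\<dots> = (\<integral>s. lagged_average n A s \<partial>unit_time) + measure unit_time A"
    using lag_error_integrable[OF assms] i by simp
  also have "measure unit_time A \<le> measure lborel (A \<inter> {-1..1})"
  proof -
    have "emeasure lborel (A \<inter> {-1..1}) \<le> emeasure lborel {-1..1::real}" by (rule emeasure_mono) auto
    also have "\<dots> < \<infinity>" by simp
    finally have "A \<inter> {-1..1} \<in> fmeasurable lborel" by (auto simp: fmeasurable_def)
    then show ?thesis
      unfolding unit_time_measure[OF A] by (intro measure_mono_fmeasurable) auto
  qed
  finally show ?thesis using lagged_average_integral_le[OF assms] by simp
qed

lemma lag_error_nonneg: "0 \<le> lag_error n A"
  unfolding lag_error_def by simp

lemma lag_error_Un: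
  assumes A: "A \<in> sets borel" and D: "D \<in> sets borel" and "A \<inter> D = {}" "0 < n"
  shows "lag_error n (A \<union> D) \<le> lag_error n A + lag_error n D"
proof -
  have AD: "A \<union> D \<in> sets borel" using A D by auto
  have fin: "emeasure lborel (C \<inter> previous_slot n i) \<noteq> \<infinity>" if [measurable]: "C \<in> sets borel" for C i
  proof -
    have "emeasure lborel (C \<inter> previous_slot n i) \<le> emeasure lborel (previous_slot n i)"
      by (rule emeasure_mono) auto
    then show ?thesis unfolding measure_slots(4)[OF \<open>0 < n\<close>] by (auto simp: top_unique)
  qed
  have add: "lagged_average n (A \<union> D) s = lagged_average n A s + lagged_average n D s" for s
  proof -
    have "measure lborel ((A \<union> D) \<inter> previous_slot n i)
        = measure lborel (A \<inter> previous_slot n i) + measure lborel (D \<inter> previous_slot n i)" for i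
      unfolding Int_Un_distrib2
      by (rule measure_Union[OF fin[OF A] fin[OF D]]) (use A D \<open>A \<inter> D = {}\<close> in auto)
    then show ?thesis unfolding lagged_average_def by (simp add: sum.distrib distrib_left)
  qed
  have "lag_error n (A \<union> D)
      \<le> (\<integral>s. \<bar>lagged_average n A s - indicator A s\<bar> + \<bar>lagged_average n D s - indicator D s\<bar> \<partial>unit_time)"
    unfolding lag_error_def
  proof (rule integral_mono)
    fix s
    have "indicator (A \<union> D) s = (indicator A s + indicator D s :: real)"
      using \<open>A \<inter> D = {}\<close> by (auto simp: indicator_def)
    then show "\<bar>lagged_average n (A \<union> D) s - indicator (A \<union> D) s\<bar>
        \<le> \<bar>lagged_average n A s - indicator A s\<bar> + \<bar>lagged_average n D s - indicator D s\<bar>"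
      unfolding add by simp
  qed (use lag_error_integrable[OF AD \<open>0 < n\<close>] lag_error_integrable[OF A \<open>0 < n\<close>] lag_error_integrable[OF D \<open>0 < n\<close>] in auto)
  also have "\<dots> = lag_error n A + lag_error n D"
    unfolding lag_error_def
    using lag_error_integrable[OF A \<open>0 < n\<close>] lag_error_integrable[OF D \<open>0 < n\<close>] by simp
  finally show ?thesis .
qed

text \<open>The slot of \<open>s\<close> and the one before it start at most 2/n before
  \<open>s\<close>. Further than that from \<open>a\<close> both lie on one side, and the average
  agrees with the indicator.\<close>

lemma lag_error_atMost: "(\<lambda>n. lag_error n {..a}) \<longlonglongrightarrow> 0"
proof (rule tendsto_sandwich[OF _ _ tendsto_const])
  show "\<forall>\<^sub>F n in sequentially. lag_error n {..a} \<le> 4 / real n"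
    using eventually_gt_at_top[of 0]
  proof eventually_elim
    case (elim n)
    let ?I = "{a - 2 / n..a + 2 / n}"
    have n: "0 < 1 / real n" using elim by simp
    have "lag_error n {..a} \<le> (\<integral>s. indicator ?I s \<partial>unit_time)"
      unfolding lag_error_def
    proof (rule integral_mono_AE)
      show "AE s in unit_time. \<bar>lagged_average n {..a} s - indicator {..a} s\<bar> \<le> indicator ?I s"
        using AE_unit_time
      proof eventually_elim
        case (elim s)
        then obtain i where i: "i < n" "s \<in> slot n i" using slot_index[OF \<open>0 < n\<close>] by blast
        have s: "real i / n < s" "s \<le> real i / n + 1 / n"
          using i(2) unfolding slot_def by (auto simp: add_divide_distrib)
        have p: "previous_slot n i = {real i / n - 1 / n<..real i / n}"
          unfolding previous_slot_def by (simp add: diff_divide_distrib)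
        note L = lagged_average_slot[OF i(2,1), of "{..a}"]
        consider "s \<in> ?I" | "a + 2 / n < s" | "s < a - 2 / n" by force
        then show ?case
        proof cases
          case 1
          have "0 \<le> lagged_average n {..a} s" "lagged_average n {..a} s \<le> 1"
            using lagged_average_bounds[of "{..a}" n s] \<open>0 < n\<close> elim by auto
          then show ?thesis using 1 by (auto simp: indicator_def)
        next
          case 2
          then have "a < real i / n - 1 / n" using s n by linarith
          then have "{..a} \<inter> previous_slot n i = {}" unfolding p by auto
          then have "lagged_average n {..a} s = 0" unfolding L by simp
          moreover have "a < s" using 2 n by linarith
          ultimately show ?thesis by (simp add: indicator_def)
        next
          case 3
          then have "real i / n \<le> a" using s n by linarith
          then have "{..a} \<inter> previous_slot n i = previous_slot n i" unfolding p by auto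
          then have "lagged_average n {..a} s = 1"
            unfolding L using measure_slots(2)[OF \<open>0 < n\<close>] \<open>0 < n\<close> by simp
          moreover have "s \<le> a" using 3 n by linarith
          ultimately show ?thesis by (simp add: indicator_def)
        qed
      qed
      show "integrable unit_time (indicator ?I :: real \<Rightarrow> real)"
        by (rule unit_time.integrable_const_bound[where B=1]) (auto simp: indicator_def)
    qed (use lag_error_integrable[of "{..a}" n] elim in auto)
    also have "\<dots> = measure unit_time ?I" by simp
    also have "\<dots> \<le> (a + 2 / n) - (a - 2 / n)" by (rule unit_time_measure_Icc_le) (use n in simp)
    finally show ?case by simp
  qed
  show "(\<lambda>n. 4 / real n) \<longlonglongrightarrow> 0" by (rule lim_const_over_n)
qed (simp add: lag_error_nonneg)

lemma lag_error_Compl: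
  assumes A: "A \<in> sets borel" and "0 < n"
  shows "lag_error n (- A) = lag_error n A"
  unfolding lag_error_def
proof (rule integral_cong_AE)
  note [measurable] = A
  have C: "- A \<in> sets borel" using A by auto
  note [measurable] = C
  show "AE s in unit_time. \<bar>lagged_average n (- A) s - indicator (- A) s\<bar> = \<bar>lagged_average n A s - indicator A s\<bar>"
    using AE_unit_time
  proof eventually_elim
    case (elim s)
    then obtain i where i: "i < n" "s \<in> slot n i" using slot_index[OF \<open>0 < n\<close>] by blast
    have fin: "emeasure lborel (D \<inter> previous_slot n i) \<noteq> \<infinity>" if [measurable]: "D \<in> sets borel" for D
    proof -
      have "emeasure lborel (D \<inter> previous_slot n i) \<le> emeasure lborel (previous_slot n i)"
        by (rule emeasure_mono) auto
      then show ?thesis unfolding measure_slots(4)[OF \<open>0 < n\<close>] by (auto simp: top_unique)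
    qed
    have "measure lborel (previous_slot n i) = measure lborel ((A \<inter> previous_slot n i) \<union> (- A \<inter> previous_slot n i))"
      by (rule arg_cong[where f="measure lborel"]) auto
    also have "\<dots> = measure lborel (A \<inter> previous_slot n i) + measure lborel (- A \<inter> previous_slot n i)"
      by (rule measure_Union[OF fin[OF A] fin[OF C]]) auto
    finally have "n * (1 / n) = lagged_average n A s + lagged_average n (- A) s"
      unfolding lagged_average_slot[OF i(2,1)] measure_slots(2)[OF \<open>0 < n\<close>] by (simp only: distrib_left)
    then have "lagged_average n (- A) s = 1 - lagged_average n A s" using \<open>0 < n\<close> by simp
    then show ?case by (simp add: indicator_def abs_minus_commute)
  qed
qed (use A in auto)

text \<open>The sets with vanishing lag error form a Dynkin class containing the half-lines; this
  takes the place of a differentiation theorem. Complements have the same error, and countable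
  disjoint unions are handled by finite subadditivity together with the uniform bound on the
  tail.\<close>

lemma lag_error_tendsto:
  assumes "A \<in> sets borel"
  shows "(\<lambda>n. lag_error n A) \<longlonglongrightarrow> 0"
proof -
  have gen: "A \<in> sigma_sets UNIV (range (\<lambda>a::real. {..a}))"
    using assms unfolding borel_eq_atMost by simp
  have sig: "sigma_sets UNIV (range (\<lambda>a::real. {..a})) = sets borel"
    unfolding borel_eq_atMost by simp
  have stable: "Int_stable (range (\<lambda>a::real. {..a}))"
  proof (rule Int_stableI)
    fix A D assume "A \<in> range (\<lambda>a::real. {..a})" "D \<in> range (\<lambda>a::real. {..a})"
    then obtain a d where "A = {..a}" "D = {..d}" by blast
    then have "A \<inter> D = {..min a d}" by auto
    then show "A \<inter> D \<in> range (\<lambda>a::real. {..a})" by blast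
  qed
  have closed: "range (\<lambda>a::real. {..a}) \<subseteq> Pow UNIV" by simp
  from stable closed gen show ?thesis
  proof (induction rule: sigma_sets_induct_disjoint)
    case (basic A)
    then show ?case using lag_error_atMost by auto
  next
    case empty
    have "lag_error n {} = 0" for n unfolding lag_error_def lagged_average_def by simp
    then show ?case by simp
  next
    case (compl A)
    then have "A \<in> sets borel" unfolding sig by simp
    have "\<forall>\<^sub>F n in sequentially. lag_error n A = lag_error n (UNIV - A)"
      using eventually_gt_at_top[of 0]
      by eventually_elim (use lag_error_Compl[OF \<open>A \<in> sets borel\<close>] in \<open>simp add: Compl_eq_Diff_UNIV\<close>)
    with compl(2) show ?case by (rule Lim_transform_eventually)
  next
    case (union A)
    then have A: "A i \<in> sets borel" for i using sig by auto
    note [measurable] = A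
    \<comment> \<open>The tails of the union. They decrease to the empty set by disjointness, so
      their measure in the window tends to 0.\<close>
    define R where "R m = (\<Union>i. A (i + m))" for m
    have R: "R m \<in> sets borel" for m unfolding R_def by auto
    have fin: "emeasure lborel (D \<inter> {-1..1}) < \<infinity>" if [measurable]: "D \<in> sets borel" for D :: "real set"
    proof -
      have "emeasure lborel (D \<inter> {-1..1}) \<le> emeasure lborel {-1..1::real}" by (rule emeasure_mono) auto
      also have "\<dots> < \<infinity>" by simp
      finally show ?thesis .
    qed
    have tail: "(\<lambda>m. measure lborel (R m \<inter> {-1..1})) \<longlonglongrightarrow> measure lborel (\<Inter>m. R m \<inter> {-1..1})"
    proof (rule Lim_measure_decseq)
      show "range (\<lambda>m. R m \<inter> {-1..1}) \<subseteq> sets lborel" using R by auto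
      show "decseq (\<lambda>m. R m \<inter> {-1..1})"
      proof (rule decseq_SucI)
        fix m
        have "R (Suc m) \<subseteq> R m" unfolding R_def
        proof
          fix x assume "x \<in> (\<Union>i. A (i + Suc m))"
          then obtain i where "x \<in> A (i + Suc m)" by blast
          then have "x \<in> A (Suc i + m)" by simp
          then show "x \<in> (\<Union>i. A (i + m))" by blast
        qed
        then show "R (Suc m) \<inter> {-1..1} \<subseteq> R m \<inter> {-1..1}" by blast
      qed
      show "emeasure lborel (R m \<inter> {-1..1}) \<noteq> \<infinity>" for m using fin[OF R, of m] by simp
    qed
    have "(\<Inter>m. R m) = {}"
    proof -
      have False if x: "\<And>m. x \<in> R m" for x
      proof -
        obtain i where i: "x \<in> A (i + 0)" using x[of 0] unfolding R_def by blast
        obtain j where j: "x \<in> A (j + Suc i)" using x[of "Suc i"] unfolding R_def by blast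
        have "A (i + 0) \<inter> A (j + Suc i) = {}" using union(1) unfolding disjoint_family_on_def by simp
        then show False using i j by blast
      qed
      then show ?thesis by blast
    qed
    then have tail0: "(\<lambda>m. measure lborel (R m \<inter> {-1..1})) \<longlonglongrightarrow> 0" using tail by simp
    have le: "lag_error n (\<Union>i. A i) \<le> (\<Sum>i<m. lag_error n (A i)) + lag_error n (R m)" if "0 < n" for n m
    proof (induction m)
      case 0
      then show ?case by (simp add: R_def)
    next
      case (Suc m)
      have "R m = A m \<union> R (Suc m)"
      proof (intro set_eqI iffI)
        fix x assume "x \<in> R m"
        then obtain i where i: "x \<in> A (i + m)" unfolding R_def by blast
        show "x \<in> A m \<union> R (Suc m)"
        proof (cases i)
          case (Suc k)
          then have "x \<in> A (k + Suc m)" using i by simp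
          then show ?thesis unfolding R_def by blast
        qed (use i in simp)
      next
        fix x assume "x \<in> A m \<union> R (Suc m)"
        then consider "x \<in> A (0 + m)" | i where "x \<in> A (Suc i + m)" unfolding R_def by auto
        then show "x \<in> R m" unfolding R_def by cases blast+
      qed
      moreover have "A m \<inter> R (Suc m) = {}"
      proof -
        have "A m \<inter> A (i + Suc m) = {}" for i
          using union(1) unfolding disjoint_family_on_def by simp
        then show ?thesis unfolding R_def by blast
      qed
      ultimately have "lag_error n (R m) \<le> lag_error n (A m) + lag_error n (R (Suc m))"
        using lag_error_Un[OF A R _ that] by metis
      with Suc show ?case by simp
    qed
    show ?case
    proof (rule LIMSEQ_I)
      fix e :: real assume "0 < e"
      \<comment> \<open>A quarter of \<open>e\<close>, since \<open>lag_error_le\<close> doubles the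
        measure of the tail.\<close>
      then obtain m where m: "measure lborel (R m \<inter> {-1..1}) < e / 4"
        using order_tendstoD(2)[OF tail0, of "e / 4"] by (auto simp: eventually_sequentially)
      have "(\<lambda>n. \<Sum>i<m. lag_error n (A i)) \<longlonglongrightarrow> (\<Sum>i<m. 0)"
        by (rule tendsto_sum) (rule union(3))
      then have "\<forall>\<^sub>F n in sequentially. (\<Sum>i<m. lag_error n (A i)) < e / 2"
        by (rule order_tendstoD) (use \<open>0 < e\<close> in simp)
      then have "\<forall>\<^sub>F n in sequentially. norm (lag_error n (\<Union>i. A i) - 0) < e"
        using eventually_gt_at_top[of 0]
      proof eventually_elim
        case (elim n)
        then have "lag_error n (\<Union>i. A i) < e / 2 + e / 2"
          using le[of n m] lag_error_le[OF R, of n m] m by simp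
        then show ?case using lag_error_nonneg[of n "\<Union>i. A i"] by simp
      qed
      then show "\<exists>no. \<forall>n\<ge>no. norm (lag_error n (\<Union> (range A)) - 0) < e"
        by (simp add: eventually_sequentially)
    qed
  qed
qed

section \<open>Piecewise constant controls\<close>

text \<open>Here \<open>p\<close> is a pair (mean, standard deviation): the drift is deterministic,
  and the noise is centred with variance \<open>(snd p)\<^sup>2 / n\<close>, like a grid increment
  of Brownian motion times \<open>snd p\<close>.\<close>

definition gauss_law :: "nat \<Rightarrow> real \<times> real \<Rightarrow> (real \<times> real) measure" where
  "gauss_law n p = scaled_law (density lborel std_normal_density) (\<lambda>_. fst p) (\<lambda>z. snd p * z) n"

lemma std_normal_integrals:
  "prob_space (density lborel std_normal_density)"
  "(\<integral>z. z \<partial>density lborel std_normal_density) = 0"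
  "integrable (density lborel std_normal_density) (\<lambda>z. z\<^sup>2)"
  "(\<integral>z. z\<^sup>2 \<partial>density lborel std_normal_density) = 1"
proof -
  show "prob_space (density lborel std_normal_density)" by (rule prob_space_normal_density) simp
  show "(\<integral>z. z \<partial>density lborel std_normal_density) = 0"
    using integral_std_normal_moment_odd[of 0] by (subst integral_density) auto
  show "integrable (density lborel std_normal_density) (\<lambda>z. z\<^sup>2)"
    using integrable_std_normal_moment[of 2] by (subst integrable_density) auto
  show "(\<integral>z. z\<^sup>2 \<partial>density lborel std_normal_density) = 1"
    using integral_std_normal_moment_even[of 1] by (subst integral_density) auto
qed

lemma consistent_gauss_law:
  assumes "finite P" "P \<noteq> {}"
  shows "consistent P (\<lambda>p. (fst p, (snd p)\<^sup>2)) gauss_law"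
  unfolding gauss_law_def
proof (rule consistent_scaled_law[OF assms])
  interpret N: prob_space "density lborel std_normal_density" by (rule std_normal_integrals)
  fix p :: "real \<times> real"
  show "(\<integral>z. snd p * z \<partial>density lborel std_normal_density) = 0"
    using std_normal_integrals(2) by simp
  show "(fst p, (snd p)\<^sup>2) = (\<integral>z. fst p \<partial>density lborel std_normal_density,
      \<integral>z. (snd p * z)\<^sup>2 \<partial>density lborel std_normal_density)"
    using std_normal_integrals(4) N.prob_space by (simp add: power_mult_distrib)
  show "integrable (density lborel std_normal_density) (\<lambda>z. (snd p * z)\<^sup>2)"
    using std_normal_integrals(3) by (simp add: power_mult_distrib)
  show "integrable (density lborel std_normal_density) (\<lambda>z. (fst p)\<^sup>2)" by (rule N.integrable_const)
qed (use std_normal_integrals(1) in auto)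

text \<open>Freezing a process outside \<open>{0..t}\<close> at its boundary values makes it a Borel
  function of a real time, so that arbitrary values off the interval never enter.\<close>

definition clamp_time :: "real \<Rightarrow> real \<Rightarrow> real" where
  "clamp_time t s = max 0 (min t s)"

lemma clamp_time [simp]: "s \<in> {0..t} \<Longrightarrow> clamp_time t s = s"
  unfolding clamp_time_def by auto

lemma clamp_time_in: "0 \<le> t \<Longrightarrow> clamp_time t s \<in> {0..t}"
  unfolding clamp_time_def by auto

lemma grid_index_measurable:
  "(\<lambda>r. nat (\<lceil>r * real n\<rceil> - 1)) \<in> measurable borel (count_space UNIV)"
proof -
  have "(\<lambda>r. \<lceil>r * real n\<rceil>) \<in> measurable borel (count_space UNIV)"
    by (rule measurable_compose[OF _ measurable_real_ceiling]) simp
  from measurable_compose[OF this, of "\<lambda>z. nat (z - 1)"] show ?thesis by simp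
qed

context brownian
begin

definition gauss_step :: "nat \<Rightarrow> nat \<Rightarrow> real \<times> real \<Rightarrow> 'w \<Rightarrow> real \<times> real" where
  "gauss_step n i p \<omega> = (fst p / n, snd p * (W (real (Suc i) / n) \<omega> - W (real i / n) \<omega>))"

lemma grid_times:
  fixes n i :: nat
  assumes "0 < n"
  shows "0 \<le> real i / n" "real i / n < real (Suc i) / n" "real (Suc i) / n - real i / n = 1 / n"
  using assms by (simp_all add: divide_strict_right_mono add_divide_distrib)

lemma gauss_step_law:
  assumes "0 < n"
  shows "distr M borel (gauss_step n i p) = gauss_law n p"
proof -
  define d where "d \<omega> = W (real (Suc i) / n) \<omega> - W (real i / n) \<omega>" for \<omega>
  have n: "0 < real n" using assms by simp
  have "distributed M lborel d (normal_density 0 (sqrt (1 / n)))"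
    using W_increment_normal[OF grid_times(1,2)[OF assms], of i] unfolding grid_times(3)[OF assms] d_def[abs_def] .
  then have D: "distributed M lborel (\<lambda>\<omega>. (d \<omega> - 0) / sqrt (1 / n)) std_normal_density"
    by (subst (asm) normal_standard_normal_convert) (use n in auto)
  then have law: "density lborel std_normal_density = distr M lborel (\<lambda>\<omega>. d \<omega> / sqrt (1 / n))"
    and m: "(\<lambda>\<omega>. d \<omega> / sqrt (1 / n)) \<in> measurable M lborel"
    by (auto simp: distributed_def)
  have g: "(\<lambda>z. (fst p / n, snd p * z / sqrt n)) \<in> measurable lborel (borel :: (real \<times> real) measure)"
    unfolding borel_prod[symmetric] by measurable
  have "x / sqrt (1 / n) / sqrt n = x" for x
    using n by (simp add: real_sqrt_divide)
  then have "gauss_step n i p = (\<lambda>z. (fst p / n, snd p * z / sqrt n)) \<circ> (\<lambda>\<omega>. d \<omega> / sqrt (1 / n))"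
    by (auto simp: gauss_step_def d_def times_divide_eq_right[symmetric] simp del: times_divide_eq_right)
  then show ?thesis
    unfolding gauss_law_def scaled_law_def law by (subst distr_distr[OF g m]) simp
qed

lemma gauss_step_indep:
  assumes "0 < n"
  shows "indep_of M (F (real i / n)) (gauss_step n i p)"
proof -
  have g: "(\<lambda>x. (fst p / n, snd p * x)) \<in> measurable borel (borel :: (real \<times> real) measure)"
    unfolding borel_prod[symmetric] by measurable
  show ?thesis
    unfolding gauss_step_def[abs_def]
    by (rule indep_of_compose[OF W_increment_indep[OF grid_times(1,2)[OF assms]] g])
qed

text \<open>
  On \<open>slot n i\<close> the index below is \<open>i\<close>; at \<open>s = 0\<close>, which belongs to no slot, \<open>nat\<close> truncates it to \<open>0\<close>.
\<close>

definition grid_control :: "nat \<Rightarrow> (nat \<Rightarrow> 'w \<Rightarrow> real \<times> real) \<Rightarrow> real \<Rightarrow> 'w \<Rightarrow> real \<times> real" where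
  "grid_control n \<kappa> s \<omega> = \<kappa> (nat (\<lceil>s * n\<rceil> - 1)) \<omega>"

lemma grid_control_slot:
  assumes "0 < n" "s \<in> slot n i"
  shows "grid_control n \<kappa> s \<omega> = \<kappa> i \<omega>"
proof -
  have "real i < s * n" "s * n \<le> real (Suc i)"
    using assms unfolding slot_def by (auto simp: pos_divide_less_eq pos_le_divide_eq)
  then have "\<lceil>s * n\<rceil> = int i + 1" by (intro ceiling_unique) auto
  then show ?thesis by (simp add: grid_control_def)
qed

text \<open>Each value is known at the left end of its slot, which makes the piecewise constant
  control progressively measurable and its noise increment independent of it.\<close>

definition grid_choices :: "(real \<times> real) set \<Rightarrow> nat \<Rightarrow> (nat \<Rightarrow> 'w \<Rightarrow> real \<times> real) \<Rightarrow> bool" where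
  "grid_choices P n \<kappa> \<longleftrightarrow> 0 < n \<and> (\<forall>i<n. \<kappa> i \<in> measurable (F (real i / n)) (count_space P))"

lemma grid_choicesD:
  assumes "grid_choices P n \<kappa>"
  shows "0 < n" "i < n \<Longrightarrow> \<kappa> i \<in> measurable (F (real i / n)) (count_space P)"
    "i < n \<Longrightarrow> \<omega> \<in> space M \<Longrightarrow> \<kappa> i \<omega> \<in> P"
    "i < n \<Longrightarrow> \<kappa> i \<in> borel_measurable (F (real i / n))"
proof -
  show *: "0 < n" "i < n \<Longrightarrow> \<kappa> i \<in> measurable (F (real i / n)) (count_space P)"
    using assms unfolding grid_choices_def by auto
  show "i < n \<Longrightarrow> \<omega> \<in> space M \<Longrightarrow> \<kappa> i \<omega> \<in> P" using measurable_space[OF *(2)] by simp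
  show "i < n \<Longrightarrow> \<kappa> i \<in> borel_measurable (F (real i / n))"
    using measurable_compose[OF *(2), of "\<lambda>x. x" borel] by simp
qed

lemma grid_index_less:
  assumes "0 < n" "s \<in> {0..1}"
  shows "nat (\<lceil>s * n\<rceil> - 1) < n" "real (nat (\<lceil>s * n\<rceil> - 1)) / n \<le> s"
proof -
  have n: "0 < real n" using assms by simp
  have "s * real n \<le> 1 * real n" by (rule mult_right_mono) (use assms in auto)
  then have "\<lceil>s * n\<rceil> \<le> int n" by (simp add: ceiling_le_iff)
  then show "nat (\<lceil>s * n\<rceil> - 1) < n" using assms(1) by linarith
  have "0 \<le> s * n" using assms by simp
  then have "real (nat (\<lceil>s * n\<rceil> - 1)) \<le> s * n"
    using ceiling_correct[of "s * n"] by linarith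
  then show "real (nat (\<lceil>s * n\<rceil> - 1)) / n \<le> s" using n by (simp add: pos_divide_le_eq)
qed

text \<open>At a time \<open>r\<close> up to \<open>s\<close> the active slot has started by
  \<open>r\<close>, so its value is already measurable at time \<open>s\<close>. Composing with the
  measurable slot index gives joint measurability.\<close>

lemma grid_control_in_controls:
  assumes \<kappa>: "grid_choices P n \<kappa>"
  shows "grid_control n \<kappa> \<in> controls M F P 0 1"
  unfolding controls_def progressively_measurable_def
proof (intro CollectI conjI ballI)
  note n = grid_choicesD(1)[OF \<kappa>]
  show "grid_control n \<kappa> s \<omega> \<in> P" if "s \<in> {0..1}" "\<omega> \<in> space M" for s \<omega>
    unfolding grid_control_def by (rule grid_choicesD(3)[OF \<kappa> grid_index_less(1)[OF n that(1)] that(2)])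
  fix s :: real assume s: "s \<in> {0..1}"
  \<comment> \<open>Slots that start after \<open>s\<close> are set to 0: their values need not be
    measurable at time \<open>s\<close>, and they are never active before \<open>s\<close>.\<close>
  define f where "f i x = (if i < n \<and> real i / n \<le> s then \<kappa> i (snd x) else 0)" for i and x :: "real \<times> 'w"
  let ?R = "restrict_space borel {0..s} \<Otimes>\<^sub>M F s"
  have f: "f i \<in> borel_measurable ?R" for i
  proof (cases "i < n \<and> real i / n \<le> s")
    case True
    then have "\<kappa> i \<in> borel_measurable (F s)"
      using grid_choicesD(4)[OF \<kappa>, of i] by (intro measurable_F_mono[of "real i / n" s]) auto
    then have "(\<lambda>x. \<kappa> i (snd x)) \<in> borel_measurable ?R" by (rule measurable_compose[OF measurable_snd])
    then show ?thesis using True by (simp add: f_def[abs_def])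
  next
    case False
    then have "f i = (\<lambda>x. 0)" by (auto simp: f_def fun_eq_iff)
    then show ?thesis by simp
  qed
  have "(\<lambda>r. nat (\<lceil>r * real n\<rceil> - 1)) \<in> measurable borel (count_space UNIV)"
    by (rule grid_index_measurable)
  then have "(\<lambda>r. nat (\<lceil>r * real n\<rceil> - 1)) \<in> measurable (restrict_space borel {0..s}) (count_space UNIV)"
    by (rule measurable_restrict_space1)
  then have "(\<lambda>x. nat (\<lceil>fst x * n\<rceil> - 1)) \<in> measurable ?R (count_space UNIV)"
    by (rule measurable_compose[OF measurable_fst])
  then have m: "(\<lambda>x. f (nat (\<lceil>fst x * n\<rceil> - 1)) x) \<in> borel_measurable ?R"
    by (rule measurable_compose_countable[OF f])
  have "(\<lambda>(r, \<omega>). grid_control n \<kappa> r \<omega>) \<in> borel_measurable ?R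
      \<longleftrightarrow> (\<lambda>x. f (nat (\<lceil>fst x * n\<rceil> - 1)) x) \<in> borel_measurable ?R"
  proof (rule measurable_cong)
    fix x assume "x \<in> space ?R"
    then have x: "fst x \<in> {0..s}" by (auto simp: space_pair_measure space_restrict_space)
    then have "fst x \<in> {0..1}" using s by auto
    from grid_index_less[OF n this] x
    show "(case x of (r, \<omega>) \<Rightarrow> grid_control n \<kappa> r \<omega>) = f (nat (\<lceil>fst x * n\<rceil> - 1)) x"
      by (auto simp: f_def grid_control_def case_prod_beta')
  qed
  with m show "(\<lambda>(r, \<omega>). grid_control n \<kappa> r \<omega>) \<in> borel_measurable ?R" by simp
qed

text \<open>Measurability with respect to \<open>F t\<close>, and not only \<open>M\<close>, is what
  later makes occupation times up to \<open>t\<close> observable at time \<open>t\<close>.\<close>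

lemma control_clamp_measurable:
  assumes a: "a \<in> controls M F P 0 1" and t: "t \<in> {0..1}"
  shows "(\<lambda>(\<omega>, s). a (clamp_time t s) \<omega>) \<in> borel_measurable (F t \<Otimes>\<^sub>M borel)"
proof -
  have p: "(\<lambda>(r, \<omega>). a r \<omega>) \<in> borel_measurable (restrict_space borel {0..t} \<Otimes>\<^sub>M F t)"
    using a t unfolding controls_def progressively_measurable_def by blast
  have "clamp_time t \<in> borel_measurable borel" unfolding clamp_time_def[abs_def] by measurable
  then have "clamp_time t \<in> measurable borel (restrict_space borel {0..t})"
    by (rule measurable_restrict_space2[rotated]) (use t clamp_time_in[of t] in auto)
  then have "(\<lambda>x. (clamp_time t (snd x), fst x)) \<in> measurable (F t \<Otimes>\<^sub>M borel) (restrict_space borel {0..t} \<Otimes>\<^sub>M F t)"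
    by (intro measurable_Pair measurable_fst measurable_compose[OF measurable_snd])
  from measurable_compose[OF this p] show ?thesis by (simp add: case_prod_beta')
qed

lemma control_clamp_measurable_M:
  assumes a: "a \<in> controls M F P 0 1"
  shows "(\<lambda>(\<omega>, s). a (clamp_time 1 s) \<omega>) \<in> borel_measurable (M \<Otimes>\<^sub>M borel)"
proof -
  have "(\<lambda>x. x) \<in> measurable (M \<Otimes>\<^sub>M borel) (F 1 \<Otimes>\<^sub>M (borel :: real measure))"
    using subalgebra_F[of 1] unfolding subalgebra_def
    by (intro measurable_pair_measureI) (auto simp: space_pair_measure intro: pair_measureI)
  from measurable_compose[OF this control_clamp_measurable[OF a, of 1]]
  show ?thesis by simp
qed

lemma real_pair_borel [measurable]:
  "(fst :: real \<times> real \<Rightarrow> real) \<in> borel_measurable borel"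
  "(snd :: real \<times> real \<Rightarrow> real) \<in> borel_measurable borel"
  by (intro borel_measurable_continuous_onI continuous_intros)+

lemma control_jointly_measurable:
  assumes a: "a \<in> controls M F P 0 1"
  shows "jointly_measurable (\<lambda>s \<omega>. snd (a s \<omega>))"
proof -
  have m: "(\<lambda>x. snd (case x of (\<omega>, s) \<Rightarrow> a (clamp_time 1 s) \<omega>)) \<in> borel_measurable (M \<Otimes>\<^sub>M lborel)"
    using measurable_compose[OF control_clamp_measurable_M[OF a] real_pair_borel(2)]
    by (simp cong: measurable_cong_sets)
  have "(\<lambda>x. snd (case x of (\<omega>, s) \<Rightarrow> a (clamp_time 1 s) \<omega>) * indicator {0..1} (snd x)) \<in> borel_measurable (M \<Otimes>\<^sub>M lborel)"
    by (intro borel_measurable_times m) measurable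
  moreover have "(\<lambda>x. snd (case x of (\<omega>, s) \<Rightarrow> a (clamp_time 1 s) \<omega>) * indicator {0..1} (snd x))
      = (\<lambda>(\<omega>, s). snd (a s \<omega>) * indicator {0..1} s)"
    by (auto simp: indicator_def fun_eq_iff)
  ultimately show ?thesis unfolding jointly_measurable_def by simp
qed

text \<open>The time during which two controls differ. For values in a finite set it controls both
  the difference of the drift integrals and the squared distance of the diffusion
  coefficients.\<close>

definition disagreement :: "(real \<Rightarrow> 'w \<Rightarrow> real \<times> real) \<Rightarrow> (real \<Rightarrow> 'w \<Rightarrow> real \<times> real) \<Rightarrow> 'w \<Rightarrow> real" where
  "disagreement a b \<omega> = (\<integral>s. (if a (clamp_time 1 s) \<omega> = b (clamp_time 1 s) \<omega> then 0 else 1) \<partial>unit_time)"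

lemma control_section_measurable:
  assumes a: "a \<in> controls M F P 0 1" and "\<omega> \<in> space M"
  shows "(\<lambda>s. a (clamp_time 1 s) \<omega>) \<in> borel_measurable borel"
  using measurable_compose[OF measurable_Pair1'[OF assms(2), of borel] control_clamp_measurable_M[OF a]] by simp

lemma disagree_integrand_measurable:
  assumes a: "a \<in> controls M F P 0 1" and b: "b \<in> controls M F Q 0 1"
  shows "(\<lambda>(\<omega>, s). if a (clamp_time 1 s) \<omega> = b (clamp_time 1 s) \<omega> then 0 else 1 :: real) \<in> borel_measurable (M \<Otimes>\<^sub>M borel)"
proof -
  note [measurable] = control_clamp_measurable_M[OF a] control_clamp_measurable_M[OF b]
  have "(\<lambda>x. if (case x of (\<omega>, s) \<Rightarrow> a (clamp_time 1 s) \<omega>) = (case x of (\<omega>, s) \<Rightarrow> b (clamp_time 1 s) \<omega>) then 0 else 1 :: real)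
      \<in> borel_measurable (M \<Otimes>\<^sub>M borel)" by measurable
  then show ?thesis by (simp add: case_prod_beta')
qed

lemma disagree_section_measurable:
  assumes a: "a \<in> controls M F P 0 1" and b: "b \<in> controls M F Q 0 1" and "\<omega> \<in> space M"
  shows "(\<lambda>s. if a (clamp_time 1 s) \<omega> = b (clamp_time 1 s) \<omega> then 0 else 1 :: real) \<in> borel_measurable borel"
  using measurable_compose[OF measurable_Pair1'[OF assms(3), of borel] disagree_integrand_measurable[OF a b]] by simp

lemma disagree_section_integrable:
  assumes a: "a \<in> controls M F P 0 1" and b: "b \<in> controls M F Q 0 1" and "\<omega> \<in> space M"
  shows "integrable unit_time (\<lambda>s. if a (clamp_time 1 s) \<omega> = b (clamp_time 1 s) \<omega> then 0 else 1 :: real)"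
  by (rule unit_time.integrable_const_bound[where B=1])
    (use disagree_section_measurable[OF assms] in \<open>auto cong: measurable_cong_sets\<close>)

lemma disagreement_bounds:
  assumes a: "a \<in> controls M F P 0 1" and b: "b \<in> controls M F Q 0 1" and "\<omega> \<in> space M"
  shows "0 \<le> disagreement a b \<omega>" "disagreement a b \<omega> \<le> 1"
proof -
  show "0 \<le> disagreement a b \<omega>" unfolding disagreement_def by simp
  have "disagreement a b \<omega> \<le> (\<integral>s. 1 \<partial>unit_time)"
    unfolding disagreement_def
    by (rule integral_mono[OF disagree_section_integrable[OF assms]]) auto
  then show "disagreement a b \<omega> \<le> 1" by (simp add: unit_time.prob_space[unfolded space_unit_time])
qed

lemma disagreement_measurable:
  assumes a: "a \<in> controls M F P 0 1" and b: "b \<in> controls M F Q 0 1"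
  shows "disagreement a b \<in> borel_measurable M"
  unfolding disagreement_def[abs_def]
proof (rule unit_time.borel_measurable_lebesgue_integral)
  show "(\<lambda>(\<omega>, s). if a (clamp_time 1 s) \<omega> = b (clamp_time 1 s) \<omega> then 0 else 1 :: real)
      \<in> borel_measurable (M \<Otimes>\<^sub>M unit_time)"
    using disagree_integrand_measurable[OF a b] by (simp cong: measurable_cong_sets)
qed

lemma disagreement_integrable:
  assumes a: "a \<in> controls M F P 0 1" and b: "b \<in> controls M F Q 0 1"
  shows "integrable M (disagreement a b)"
  by (rule integrable_const_bound[where B=1])
    (use disagreement_bounds[OF a b] disagreement_measurable[OF a b] in auto)

section \<open>Grid controls as walks with Gaussian steps\<close>

definition grid_walk :: "nat \<Rightarrow> (nat \<Rightarrow> 'w \<Rightarrow> real \<times> real) \<Rightarrow> nat \<Rightarrow> 'w \<Rightarrow> real \<times> real" where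
  "grid_walk n \<kappa> i \<omega> = (\<Sum>j<i. gauss_step n j (\<kappa> j \<omega>) \<omega>)"

definition grid_ito :: "nat \<Rightarrow> (nat \<Rightarrow> 'w \<Rightarrow> real \<times> real) \<Rightarrow> 'w \<Rightarrow> real" where
  "grid_ito n \<kappa> = simple_ito_integral W n (\<lambda>i. real i / n) (\<lambda>i \<omega>. snd (\<kappa> i \<omega>))"

definition grid_process :: "nat \<Rightarrow> (nat \<Rightarrow> 'w \<Rightarrow> real \<times> real) \<Rightarrow> real \<Rightarrow> 'w \<Rightarrow> real" where
  "grid_process n \<kappa> = simple_process n (\<lambda>i. real i / n) (\<lambda>i \<omega>. snd (\<kappa> i \<omega>))"

lemma grid_simple_integrand:
  assumes \<kappa>: "grid_choices P n \<kappa>" and "finite P"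
  shows "simple_integrand M F 0 1 n (\<lambda>i. real i / n) (\<lambda>i \<omega>. snd (\<kappa> i \<omega>))"
  unfolding simple_integrand_def
proof (intro conjI allI impI)
  note n = grid_choicesD(1)[OF \<kappa>]
  show "real 0 / n = 0" "real n / n = 1" using n by simp_all
  show "real i / n < real (Suc i) / n" for i by (rule grid_times(2)[OF n])
  show "(\<lambda>\<omega>. snd (\<kappa> i \<omega>)) \<in> borel_measurable (F (real i / n))" if "i < n" for i
    by (rule measurable_compose[OF grid_choicesD(4)[OF \<kappa> that] real_pair_borel(2)])
  show "\<exists>C. \<forall>i<n. \<forall>\<omega>\<in>space M. \<bar>snd (\<kappa> i \<omega>)\<bar> \<le> C"
  proof (intro exI allI impI ballI)
    fix i \<omega> assume "i < n" "\<omega> \<in> space M"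
    then have "\<kappa> i \<omega> \<in> P" by (rule grid_choicesD(3)[OF \<kappa>])
    then show "\<bar>snd (\<kappa> i \<omega>)\<bar> \<le> Max ((\<lambda>p. \<bar>snd p\<bar>) ` P)" using \<open>finite P\<close> by auto
  qed
qed

text \<open>At \<open>s = 0\<close> the simple process vanishes while the control does not; the
  single point has measure zero.\<close>

lemma grid_process_eq:
  assumes "0 < n" "0 < s" "s \<le> 1"
  shows "grid_process n \<kappa> s \<omega> = snd (grid_control n \<kappa> s \<omega>)"
proof -
  obtain i where i: "i < n" "s \<in> slot n i" using slot_index[OF assms] by blast
  have "grid_process n \<kappa> s \<omega> = (\<Sum>i<n. indicator (slot n i) s * snd (\<kappa> i \<omega>))"
    unfolding grid_process_def simple_process_def slot_def by (simp add: mult.commute)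
  then show ?thesis
    unfolding sum_slot[OF i(2,1)] grid_control_slot[OF assms(1) i(2)] .
qed

lemma grid_time_integral:
  assumes "0 < n"
  shows "(\<Sum>i<n. fst (\<kappa> i \<omega>) / n) = (\<integral>s. fst (grid_control n \<kappa> (clamp_time 1 s) \<omega>) \<partial>unit_time)"
proof -
  have int: "integrable unit_time (indicator (slot n i) :: real \<Rightarrow> real)" for i
    by (rule unit_time.integrable_const_bound[where B=1]) (auto simp: indicator_def)
  have slot: "measure unit_time (slot n i) = 1 / n" if "i < n" for i
  proof -
    have "0 \<le> real i / n" "real (Suc i) / n \<le> 1" using that assms by (auto simp: pos_divide_le_eq)
    then have "slot n i \<subseteq> {0..1}"
      unfolding slot_def greaterThanAtMost_def atLeastAtMost_def by (intro subsetI) (unfold Int_iff greaterThan_iff atMost_iff atLeast_iff, linarith)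
    then have "{0..1} \<inter> slot n i = slot n i" by (rule Int_absorb1)
    then show ?thesis using unit_time_measure[OF slot_borel(1)] measure_slots(1)[OF assms] by simp
  qed
  have "(\<integral>s. fst (grid_control n \<kappa> (clamp_time 1 s) \<omega>) \<partial>unit_time)
      = (\<integral>s. (\<Sum>i<n. indicator (slot n i) s * fst (\<kappa> i \<omega>)) \<partial>unit_time)"
  proof (rule integral_cong_AE)
    have c: "clamp_time 1 \<in> borel_measurable unit_time"
      unfolding clamp_time_def[abs_def] by measurable
    have "(\<lambda>r. nat (\<lceil>r * real n\<rceil> - 1)) \<in> measurable borel (count_space UNIV)"
    by (rule grid_index_measurable)
    then have "(\<lambda>r. fst (\<kappa> (nat (\<lceil>r * real n\<rceil> - 1)) \<omega>)) \<in> borel_measurable borel"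
      by (rule measurable_compose) simp
    then show "(\<lambda>s. fst (grid_control n \<kappa> (clamp_time 1 s) \<omega>)) \<in> borel_measurable unit_time"
      unfolding grid_control_def by (rule measurable_compose[OF c])
    show "AE s in unit_time. fst (grid_control n \<kappa> (clamp_time 1 s) \<omega>) = (\<Sum>i<n. indicator (slot n i) s * fst (\<kappa> i \<omega>))"
      using AE_unit_time
    proof eventually_elim
      case (elim s)
      then obtain i where i: "i < n" "s \<in> slot n i" using slot_index[OF assms] by blast
      have "clamp_time 1 s = s" using elim by simp
      then show ?case unfolding sum_slot[OF i(2,1)] by (simp add: grid_control_slot[OF assms i(2)])
    qed
  qed measurable
  also have "\<dots> = (\<Sum>i<n. measure unit_time (slot n i) * fst (\<kappa> i \<omega>))"
    by (subst Bochner_Integration.integral_sum) (use int in auto)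
  also have "\<dots> = (\<Sum>i<n. fst (\<kappa> i \<omega>) / n)"
    by (rule sum.cong) (auto simp: slot)
  finally show ?thesis by simp
qed

lemma grid_walk_eq:
  assumes "0 < n"
  shows "grid_walk n \<kappa> n \<omega> = (\<integral>s. fst (grid_control n \<kappa> (clamp_time 1 s) \<omega>) \<partial>unit_time, grid_ito n \<kappa> \<omega>)"
  unfolding grid_walk_def gauss_step_def sum_prod grid_time_integral[OF assms, symmetric] grid_ito_def simple_ito_integral_def
  by simp

text \<open>The integrand is 0 where the controls agree and at most \<open>D\<^sup>2\<close>
  elsewhere, so its integral is at most \<open>D\<^sup>2\<close> times the time of
  disagreement.\<close>

lemma grid_sq_dist_le:
  assumes \<kappa>: "grid_choices P n \<kappa>" and a: "a \<in> controls M F P 0 1"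
    and D: "\<And>p q. p \<in> P \<Longrightarrow> q \<in> P \<Longrightarrow> \<bar>snd p - snd q\<bar> \<le> D"
  shows "sq_dist (grid_process n \<kappa>) (\<lambda>s \<omega>. snd (a s \<omega>))
    \<le> ennreal (D\<^sup>2 * expectation (disagreement (grid_control n \<kappa>) a))"
proof -
  note n = grid_choicesD(1)[OF \<kappa>]
  let ?g = "grid_control n \<kappa>"
  note g = grid_control_in_controls[OF \<kappa>]
  let ?i = "\<lambda>s \<omega>. if ?g (clamp_time 1 s) \<omega> = a (clamp_time 1 s) \<omega> then 0 else 1 :: real"
  have "sq_dist (grid_process n \<kappa>) (\<lambda>s \<omega>. snd (a s \<omega>)) \<le> (\<integral>\<^sup>+\<omega>. ennreal (D\<^sup>2 * disagreement ?g a \<omega>) \<partial>M)"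
    unfolding sq_dist_def
  proof (rule nn_integral_mono)
    fix \<omega> assume \<omega>: "\<omega> \<in> space M"
    have "(\<integral>\<^sup>+s\<in>{0..1}. ennreal ((grid_process n \<kappa> s \<omega> - snd (a s \<omega>))\<^sup>2) \<partial>lborel)
        \<le> (\<integral>\<^sup>+s\<in>{0..1}. ennreal (D\<^sup>2 * ?i s \<omega>) \<partial>lborel)"
    proof (rule nn_integral_mono_AE)
      have "AE s in lborel. s \<noteq> (0::real)" by (rule AE_lborel_singleton)
      then show "AE s in lborel. ennreal ((grid_process n \<kappa> s \<omega> - snd (a s \<omega>))\<^sup>2) * indicator {0..1} s
          \<le> ennreal (D\<^sup>2 * ?i s \<omega>) * indicator {0..1} s"
      proof eventually_elim
        case (elim s)
        show ?case
        proof (cases "s \<in> {0..1}")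
          case True
          then have s: "0 < s" "s \<le> 1" "clamp_time 1 s = s" using elim by auto
          have in_P: "?g s \<omega> \<in> P" "a s \<omega> \<in> P"
            using g a True \<omega> unfolding controls_def by auto
          have "(grid_process n \<kappa> s \<omega> - snd (a s \<omega>))\<^sup>2 \<le> D\<^sup>2 * ?i s \<omega>"
          proof (cases "?g s \<omega> = a s \<omega>")
            case False
            have "\<bar>snd (?g s \<omega>) - snd (a s \<omega>)\<bar>\<^sup>2 \<le> D\<^sup>2"
              by (rule power_mono[OF D[OF in_P]]) simp
            then show ?thesis using False by (simp add: grid_process_eq[OF n s(1,2)] s(3))
          qed (simp add: grid_process_eq[OF n s(1,2)] s(3))
          then show ?thesis using True by (simp add: ennreal_leI)
        qed simp
      qed
    qed
    also have "\<dots> = (\<integral>\<^sup>+s. ennreal (D\<^sup>2 * ?i s \<omega>) \<partial>unit_time)"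
      by (rule nn_integral_unit_time[symmetric]) (use disagree_section_measurable[OF g a \<omega>] in measurable)
    also have "\<dots> = ennreal (D\<^sup>2 * disagreement ?g a \<omega>)"
      using disagree_section_integrable[OF g a \<omega>] unfolding disagreement_def
      by (subst nn_integral_eq_integral) auto
    finally show "(\<integral>\<^sup>+s\<in>{0..1}. ennreal ((grid_process n \<kappa> s \<omega> - snd (a s \<omega>))\<^sup>2) \<partial>lborel)
        \<le> ennreal (D\<^sup>2 * disagreement ?g a \<omega>)" .
  qed
  also have "\<dots> = ennreal (D\<^sup>2 * expectation (disagreement ?g a))"
    using disagreement_integrable[OF g a] disagreement_bounds(1)[OF g a]
    by (subst nn_integral_eq_integral) auto
  finally show ?thesis .
qed

lemma time_integral_diff_le:
  assumes g: "g \<in> controls M F P 0 1" and a: "a \<in> controls M F P 0 1" and \<omega>: "\<omega> \<in> space M"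
    and "finite P" and D: "\<And>p q. p \<in> P \<Longrightarrow> q \<in> P \<Longrightarrow> \<bar>fst p - fst q\<bar> \<le> D"
  shows "\<bar>(\<integral>s. fst (g (clamp_time 1 s) \<omega>) \<partial>unit_time) - (\<integral>s. fst (a (clamp_time 1 s) \<omega>) \<partial>unit_time)\<bar>
    \<le> D * disagreement g a \<omega>"
proof -
  have int: "integrable unit_time (\<lambda>s. fst (b (clamp_time 1 s) \<omega>))" if b: "b \<in> controls M F P 0 1" for b
  proof (rule unit_time.integrable_const_bound[where B="Max ((\<lambda>p. \<bar>fst p\<bar>) ` P)"])
    show "AE s in unit_time. norm (fst (b (clamp_time 1 s) \<omega>)) \<le> Max ((\<lambda>p. \<bar>fst p\<bar>) ` P)"
    proof (rule AE_I2)
      fix s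
      have "b (clamp_time 1 s) \<omega> \<in> P" using b \<omega> clamp_time_in[of 1 s] unfolding controls_def by auto
      then show "norm (fst (b (clamp_time 1 s) \<omega>)) \<le> Max ((\<lambda>p. \<bar>fst p\<bar>) ` P)" using \<open>finite P\<close> by auto
    qed
    show "(\<lambda>s. fst (b (clamp_time 1 s) \<omega>)) \<in> borel_measurable unit_time"
      using measurable_compose[OF control_section_measurable[OF b \<omega>] real_pair_borel(1)]
      by (simp cong: measurable_cong_sets)
  qed
  have "\<bar>(\<integral>s. fst (g (clamp_time 1 s) \<omega>) \<partial>unit_time) - (\<integral>s. fst (a (clamp_time 1 s) \<omega>) \<partial>unit_time)\<bar>
      = \<bar>\<integral>s. fst (g (clamp_time 1 s) \<omega>) - fst (a (clamp_time 1 s) \<omega>) \<partial>unit_time\<bar>"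
    using int[OF g] int[OF a] by simp
  also have "\<dots> \<le> (\<integral>s. \<bar>fst (g (clamp_time 1 s) \<omega>) - fst (a (clamp_time 1 s) \<omega>)\<bar> \<partial>unit_time)"
    by (rule integral_abs_bound)
  also have "\<dots> \<le> (\<integral>s. D * (if g (clamp_time 1 s) \<omega> = a (clamp_time 1 s) \<omega> then 0 else 1) \<partial>unit_time)"
  proof (rule integral_mono)
    fix s
    have "g (clamp_time 1 s) \<omega> \<in> P" "a (clamp_time 1 s) \<omega> \<in> P"
      using g a \<omega> clamp_time_in[of 1 s] unfolding controls_def by auto
    then show "\<bar>fst (g (clamp_time 1 s) \<omega>) - fst (a (clamp_time 1 s) \<omega>)\<bar>
        \<le> D * (if g (clamp_time 1 s) \<omega> = a (clamp_time 1 s) \<omega> then 0 else 1)"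
      using D by simp
  qed (use int[OF g] int[OF a] disagree_section_integrable[OF g a \<omega>] in auto)
  also have "\<dots> = D * disagreement g a \<omega>" unfolding disagreement_def by simp
  finally show ?thesis .
qed

lemma control_utility_eq:
  assumes a: "a \<in> controls M F P 0 1"
  shows "control_utility M B u a = expectation (\<lambda>\<omega>. u (\<integral>s. fst (a (clamp_time 1 s) \<omega>) \<partial>unit_time,
    ito_integral M F W 0 1 (\<lambda>s \<omega>. snd (a s \<omega>)) \<omega>))"
proof -
  have W: "(\<lambda>s \<omega>. snd (B s \<omega>)) = W" by (simp add: W_def fun_eq_iff)
  have "(LINT s:{0..1}|lborel. fst (a s \<omega>)) = (\<integral>s. fst (a (clamp_time 1 s) \<omega>) \<partial>unit_time)"
    if "\<omega> \<in> space M" for \<omega>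
  proof -
    have "(\<integral>s. fst (a (clamp_time 1 s) \<omega>) \<partial>unit_time) = (LINT s:{0..1}|lborel. fst (a (clamp_time 1 s) \<omega>))"
      by (rule integral_unit_time[OF measurable_compose[OF control_section_measurable[OF a that] real_pair_borel(1)]])
    also have "\<dots> = (LINT s:{0..1}|lborel. fst (a s \<omega>))"
      by (rule set_lebesgue_integral_cong) auto
    finally show ?thesis by (rule sym)
  qed
  then show ?thesis
    unfolding control_utility_def W by (intro Bochner_Integration.integral_cong) auto
qed

lemma time_integral_measurable:
  assumes a: "a \<in> controls M F P 0 1"
  shows "(\<lambda>\<omega>. \<integral>s. fst (a (clamp_time 1 s) \<omega>) \<partial>unit_time) \<in> borel_measurable M"
proof (rule unit_time.borel_measurable_lebesgue_integral)
  have "(\<lambda>x. fst (case x of (\<omega>, s) \<Rightarrow> a (clamp_time 1 s) \<omega>)) \<in> borel_measurable (M \<Otimes>\<^sub>M borel)"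
    by (rule measurable_compose[OF control_clamp_measurable_M[OF a] real_pair_borel(1)])
  then show "(\<lambda>(\<omega>, s). fst (a (clamp_time 1 s) \<omega>)) \<in> borel_measurable (M \<Otimes>\<^sub>M unit_time)"
    by (simp add: case_prod_beta' cong: measurable_cong_sets)
qed

text \<open>Of the last three terms, the first bounds the drift and the other two the stochastic
  integral: 4 comes from \<open>has_ito_integral_dist\<close> and \<open>D\<^sup>2\<close> from
  \<open>grid_sq_dist_le\<close>. Existence of the integral is assumed so that the selected version
  is a genuine one.\<close>

lemma control_utility_close:
  assumes \<kappa>: "grid_choices P n \<kappa>" and a: "a \<in> controls M F P 0 1" and "finite P"
    and D: "\<And>p q. p \<in> P \<Longrightarrow> q \<in> P \<Longrightarrow> \<bar>fst p - fst q\<bar> \<le> D"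
      "\<And>p q. p \<in> P \<Longrightarrow> q \<in> P \<Longrightarrow> \<bar>snd p - snd q\<bar> \<le> D"
    and u: "bounded_lipschitz C L u" and "0 \<le> L"
    and ex: "\<exists>I. has_ito_integral M F W 0 1 (\<lambda>s \<omega>. snd (a s \<omega>)) I" and "0 < \<epsilon>"
  defines "\<delta> \<equiv> expectation (disagreement (grid_control n \<kappa>) a)"
  shows "\<bar>expectation (\<lambda>\<omega>. u (grid_walk n \<kappa> n \<omega>)) - control_utility M B u a\<bar>
    \<le> L * (D * \<delta> + \<epsilon> + 4 * D\<^sup>2 * \<delta> / \<epsilon>)"
proof -
  note n = grid_choicesD(1)[OF \<kappa>]
  note g = grid_control_in_controls[OF \<kappa>]
  note si = grid_simple_integrand[OF \<kappa> \<open>finite P\<close>]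
  define I where "I = ito_integral M F W 0 1 (\<lambda>s \<omega>. snd (a s \<omega>))"
  have I: "has_ito_integral M F W 0 1 (\<lambda>s \<omega>. snd (a s \<omega>)) I"
    unfolding I_def ito_integral_def by (rule someI_ex[OF ex])
  then have IM: "I \<in> borel_measurable M" unfolding has_ito_integral_def by blast
  define T where "T b \<omega> = (\<integral>s. fst (b (clamp_time 1 s) \<omega>) \<partial>unit_time)" for b :: "real \<Rightarrow> 'w \<Rightarrow> real \<times> real" and \<omega>
  have T: "T b \<in> borel_measurable M" if "b \<in> controls M F P 0 1" for b
    unfolding T_def[abs_def] by (rule time_integral_measurable[OF that])
  have GM: "grid_ito n \<kappa> \<in> borel_measurable M"
    unfolding grid_ito_def by (rule simple_ito_integral_measurable[OF si])
  define Y where "Y \<omega> = grid_ito n \<kappa> \<omega> - I \<omega>" for \<omega>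
  have YM: "Y \<in> borel_measurable M" unfolding Y_def[abs_def] by (rule borel_measurable_diff[OF GM IM])
  have \<delta>: "0 \<le> \<delta>"
    unfolding \<delta>_def using disagreement_bounds(1)[OF g a] by (intro integral_nonneg_AE AE_I2)
  have Y2: "(\<integral>\<^sup>+\<omega>. ennreal ((Y \<omega>)\<^sup>2) \<partial>M) \<le> ennreal (4 * (D\<^sup>2 * \<delta>))"
  proof -
    have "(\<integral>\<^sup>+\<omega>. ennreal ((Y \<omega>)\<^sup>2) \<partial>M) \<le> 4 * sq_dist (grid_process n \<kappa>) (\<lambda>s \<omega>. snd (a s \<omega>))"
      unfolding Y_def grid_ito_def grid_process_def
      by (rule has_ito_integral_dist[OF I control_jointly_measurable[OF a] si])
    also have "\<dots> \<le> 4 * ennreal (D\<^sup>2 * \<delta>)"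
      unfolding \<delta>_def by (intro mult_left_mono grid_sq_dist_le[OF \<kappa> a D(2)]) simp_all
    also have "\<dots> = ennreal (4 * (D\<^sup>2 * \<delta>))" using \<delta> by (simp add: ennreal_mult)
    finally show ?thesis .
  qed
  have Yint: "integrable M (\<lambda>\<omega>. (Y \<omega>)\<^sup>2)"
  proof (rule integrableI_nonneg)
    show "(\<lambda>\<omega>. (Y \<omega>)\<^sup>2) \<in> borel_measurable M" using YM by measurable
    show "(\<integral>\<^sup>+\<omega>. ennreal ((Y \<omega>)\<^sup>2) \<partial>M) < \<infinity>" using Y2 by (rule order_le_less_trans) simp
  qed simp
  have EY: "expectation (\<lambda>\<omega>. (Y \<omega>)\<^sup>2) \<le> 4 * (D\<^sup>2 * \<delta>)"
  proof -
    have "ennreal (expectation (\<lambda>\<omega>. (Y \<omega>)\<^sup>2)) \<le> ennreal (4 * (D\<^sup>2 * \<delta>))"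
      using Y2 nn_integral_eq_integral[OF Yint] by simp
    then show ?thesis using \<delta> by (subst (asm) ennreal_le_iff) simp_all
  qed
  have um: "u \<in> borel_measurable borel" by (rule bounded_lipschitz_measurable[OF u])
  have int: "integrable M (\<lambda>\<omega>. u (f \<omega>, h \<omega>))" if "f \<in> borel_measurable M" "h \<in> borel_measurable M" for f h
  proof (rule integrable_const_bound[where B=C])
    have "(\<lambda>\<omega>. (f \<omega>, h \<omega>)) \<in> borel_measurable M"
      unfolding borel_prod[symmetric] using that by (rule measurable_Pair)
    from measurable_compose[OF this um] show "(\<lambda>\<omega>. u (f \<omega>, h \<omega>)) \<in> borel_measurable M" .
  qed (use bounded_lipschitzD(1)[OF u] in simp)
  note int1 = int[OF T[OF g] GM] and int2 = int[OF T[OF a] IM]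
  define d where "d = disagreement (grid_control n \<kappa>) a"
  have dint: "integrable M d" unfolding d_def by (rule disagreement_integrable[OF g a])
  have pt: "\<bar>u (T (grid_control n \<kappa>) \<omega>, grid_ito n \<kappa> \<omega>) - u (T a \<omega>, I \<omega>)\<bar> \<le> L * (D * d \<omega> + \<epsilon> + (Y \<omega>)\<^sup>2 / \<epsilon>)"
    if \<omega>: "\<omega> \<in> space M" for \<omega>
  proof -
    have "\<bar>u (T (grid_control n \<kappa>) \<omega>, grid_ito n \<kappa> \<omega>) - u (T a \<omega>, I \<omega>)\<bar>
        \<le> L * norm ((T (grid_control n \<kappa>) \<omega>, grid_ito n \<kappa> \<omega>) - (T a \<omega>, I \<omega>))"
      by (rule bounded_lipschitzD(2)[OF u])
    also have "\<dots> \<le> L * (D * d \<omega> + \<epsilon> + (Y \<omega>)\<^sup>2 / \<epsilon>)"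
    proof (rule mult_left_mono[OF _ \<open>0 \<le> L\<close>])
      have "norm ((T (grid_control n \<kappa>) \<omega>, grid_ito n \<kappa> \<omega>) - (T a \<omega>, I \<omega>))
          \<le> \<bar>T (grid_control n \<kappa>) \<omega> - T a \<omega>\<bar> + \<bar>Y \<omega>\<bar>"
        using norm_Pair_le[of "T (grid_control n \<kappa>) \<omega> - T a \<omega>" "Y \<omega>"] by (simp add: Y_def)
      moreover have "\<bar>T (grid_control n \<kappa>) \<omega> - T a \<omega>\<bar> \<le> D * d \<omega>"
        unfolding T_def d_def by (rule time_integral_diff_le[OF g a \<omega> \<open>finite P\<close> D(1)])
      \<comment> \<open>This bounds a first moment by a second one at the cost of
        \<open>\<epsilon>\<close>, so the isometry can be used without taking square roots.\<close>
      moreover have "\<bar>Y \<omega>\<bar> \<le> \<epsilon> + (Y \<omega>)\<^sup>2 / \<epsilon>"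
      proof (cases "\<bar>Y \<omega>\<bar> \<le> \<epsilon>")
        case True
        have "0 \<le> (Y \<omega>)\<^sup>2 / \<epsilon>" using \<open>0 < \<epsilon>\<close> by simp
        then show ?thesis using True by linarith
      next
        case False
        then have "\<epsilon> * \<bar>Y \<omega>\<bar> \<le> \<bar>Y \<omega>\<bar> * \<bar>Y \<omega>\<bar>" by (intro mult_right_mono) auto
        then have "\<bar>Y \<omega>\<bar> \<le> (Y \<omega>)\<^sup>2 / \<epsilon>"
          using \<open>0 < \<epsilon>\<close> by (simp add: pos_le_divide_eq power2_eq_square mult.commute)
        then show ?thesis using \<open>0 < \<epsilon>\<close> by linarith
      qed
      ultimately show "norm ((T (grid_control n \<kappa>) \<omega>, grid_ito n \<kappa> \<omega>) - (T a \<omega>, I \<omega>)) \<le> D * d \<omega> + \<epsilon> + (Y \<omega>)\<^sup>2 / \<epsilon>"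
        by linarith
    qed
    finally show ?thesis .
  qed
  have "\<bar>expectation (\<lambda>\<omega>. u (T (grid_control n \<kappa>) \<omega>, grid_ito n \<kappa> \<omega>)) - expectation (\<lambda>\<omega>. u (T a \<omega>, I \<omega>))\<bar>
      = \<bar>expectation (\<lambda>\<omega>. u (T (grid_control n \<kappa>) \<omega>, grid_ito n \<kappa> \<omega>) - u (T a \<omega>, I \<omega>))\<bar>"
    using int1 int2 by simp
  also have "\<dots> \<le> expectation (\<lambda>\<omega>. \<bar>u (T (grid_control n \<kappa>) \<omega>, grid_ito n \<kappa> \<omega>) - u (T a \<omega>, I \<omega>)\<bar>)"
    by (rule integral_abs_bound)
  also have "\<dots> \<le> expectation (\<lambda>\<omega>. L * (D * d \<omega> + \<epsilon> + (Y \<omega>)\<^sup>2 / \<epsilon>))"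
    by (rule integral_mono) (use int1 int2 dint Yint pt in auto)
  also have "\<dots> = L * (D * \<delta> + \<epsilon> + expectation (\<lambda>\<omega>. (Y \<omega>)\<^sup>2) / \<epsilon>)"
    using dint Yint by (simp add: \<delta>_def d_def prob_space)
  also have "\<dots> \<le> L * (D * \<delta> + \<epsilon> + 4 * D\<^sup>2 * \<delta> / \<epsilon>)"
  proof (rule mult_left_mono[OF _ \<open>0 \<le> L\<close>])
    have "expectation (\<lambda>\<omega>. (Y \<omega>)\<^sup>2) / \<epsilon> \<le> 4 * (D\<^sup>2 * \<delta>) / \<epsilon>"
      by (rule divide_right_mono[OF EY]) (use \<open>0 < \<epsilon>\<close> in simp)
    then show "D * \<delta> + \<epsilon> + expectation (\<lambda>\<omega>. (Y \<omega>)\<^sup>2) / \<epsilon> \<le> D * \<delta> + \<epsilon> + 4 * D\<^sup>2 * \<delta> / \<epsilon>"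
      by (simp add: mult.assoc)
  qed
  finally show ?thesis
    unfolding grid_walk_eq[OF n] control_utility_eq[OF a] T_def I_def .
qed

lemma finite_spread:
  fixes P :: "(real \<times> real) set"
  assumes "finite P"
  shows "\<exists>D\<ge>0. \<forall>p\<in>P. \<forall>q\<in>P. \<bar>fst p - fst q\<bar> \<le> D \<and> \<bar>snd p - snd q\<bar> \<le> D"
proof -
  define D where "D = (\<Sum>p\<in>P. \<bar>fst p\<bar> + \<bar>snd p\<bar>) + (\<Sum>p\<in>P. \<bar>fst p\<bar> + \<bar>snd p\<bar>)"
  have le: "\<bar>fst p\<bar> + \<bar>snd p\<bar> \<le> (\<Sum>p\<in>P. \<bar>fst p\<bar> + \<bar>snd p\<bar>)" if "p \<in> P" for p
    by (rule member_le_sum[OF that]) (use assms in auto)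
  have "\<bar>fst p - fst q\<bar> \<le> D \<and> \<bar>snd p - snd q\<bar> \<le> D" if "p \<in> P" "q \<in> P" for p q
    using le[OF that(1)] le[OF that(2)] unfolding D_def by linarith
  moreover have "0 \<le> D" unfolding D_def by (intro add_nonneg_nonneg sum_nonneg) auto
  ultimately show ?thesis by blast
qed

lemma disagreement_self: "disagreement a a = (\<lambda>\<omega>. 0)"
  unfolding disagreement_def by simp

text \<open>The preceding estimate is applied to the grid control as an approximation of itself: the
  disagreement is 0, and letting \<open>\<epsilon>\<close> tend to 0 gives equality.\<close>

lemma grid_control_utility:
  assumes \<kappa>: "grid_choices P n \<kappa>" and "finite P" and u: "bounded_lipschitz C L u" "0 \<le> L"
  shows "control_utility M B u (grid_control n \<kappa>) = expectation (\<lambda>\<omega>. u (grid_walk n \<kappa> n \<omega>))"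
proof -
  note g = grid_control_in_controls[OF \<kappa>]
  obtain D where D: "0 \<le> D" "\<And>p q. p \<in> P \<Longrightarrow> q \<in> P \<Longrightarrow> \<bar>fst p - fst q\<bar> \<le> D"
    "\<And>p q. p \<in> P \<Longrightarrow> q \<in> P \<Longrightarrow> \<bar>snd p - snd q\<bar> \<le> D"
    using finite_spread[OF \<open>finite P\<close>] by blast
  have "sq_dist (grid_process n \<kappa>) (\<lambda>s \<omega>. snd (grid_control n \<kappa> s \<omega>)) \<le> 0"
    using grid_sq_dist_le[OF \<kappa> g D(3)] by (simp add: disagreement_self)
  then have sq: "sq_dist (grid_process n \<kappa>) (\<lambda>s \<omega>. snd (grid_control n \<kappa> s \<omega>)) = 0" by simp
  have ex: "\<exists>I. has_ito_integral M F W 0 1 (\<lambda>s \<omega>. snd (grid_control n \<kappa> s \<omega>)) I"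
  proof (rule has_ito_integral_exists[OF control_jointly_measurable[OF g]])
    show "simple_integrand M F 0 1 n (\<lambda>i. real i / n) (\<lambda>i \<omega>. snd (\<kappa> i \<omega>))" for j :: nat
      by (rule grid_simple_integrand[OF \<kappa> \<open>finite P\<close>])
    \<comment> \<open>A constant approximating sequence: the simple process differs from the control
      only at time 0.\<close>
    show "(\<lambda>j::nat. sq_dist (simple_process n (\<lambda>i. real i / n) (\<lambda>i \<omega>. snd (\<kappa> i \<omega>)))
        (\<lambda>s \<omega>. snd (grid_control n \<kappa> s \<omega>))) \<longlonglongrightarrow> 0"
      using sq unfolding grid_process_def by simp
  qed
  let ?d = "\<bar>expectation (\<lambda>\<omega>. u (grid_walk n \<kappa> n \<omega>)) - control_utility M B u (grid_control n \<kappa>)\<bar>"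
  have le: "?d \<le> L * \<epsilon>" if "0 < \<epsilon>" for \<epsilon>
    using control_utility_close[OF \<kappa> g \<open>finite P\<close> D(2,3) u ex that] by (simp add: disagreement_self)
  have "?d \<le> 0"
  proof (rule field_le_epsilon)
    fix e :: real assume "0 < e"
    have "L * (e / (L + 1)) \<le> e" using \<open>0 \<le> L\<close> \<open>0 < e\<close> by (simp add: field_simps)
    moreover have "?d \<le> L * (e / (L + 1))" by (rule le) (use \<open>0 \<le> L\<close> \<open>0 < e\<close> in simp)
    ultimately show "?d \<le> 0 + e" by linarith
  qed
  then show ?thesis by simp
qed

lemma gauss_step_choice_measurable:
  assumes "0 < n" "j < i" and \<kappa>: "\<kappa> j \<in> borel_measurable (F (real j / n))"
  shows "(\<lambda>\<omega>. gauss_step n j (\<kappa> j \<omega>) \<omega>) \<in> borel_measurable (F (real i / n))"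
proof -
  have "real j / n \<le> real i / n" "real (Suc j) / n \<le> real i / n"
    using assms(1,2) by (auto intro!: divide_right_mono)
  note [measurable] = measurable_F_mono[OF this(1) \<kappa>] W_measurable_F[OF grid_times(1)[OF assms(1)] this(1)]
    W_measurable_F[OF grid_times(1)[OF assms(1)] this(2)]
  have [measurable]: "(\<lambda>\<omega>. fst (\<kappa> j \<omega>)) \<in> borel_measurable (F (real i / n))"
    "(\<lambda>\<omega>. snd (\<kappa> j \<omega>)) \<in> borel_measurable (F (real i / n))"
    by (rule measurable_compose[OF measurable_F_mono[OF \<open>real j / n \<le> real i / n\<close> \<kappa>]], rule real_pair_borel)+
  show ?thesis
    unfolding gauss_step_def borel_prod[symmetric] by measurable
qed

lemma grid_walk_measurable:
  assumes "0 < n" "\<And>j. j < i \<Longrightarrow> \<kappa> j \<in> borel_measurable (F (real j / n))"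
  shows "grid_walk n \<kappa> i \<in> borel_measurable (F (real i / n))"
  unfolding grid_walk_def[abs_def]
  by (intro borel_measurable_sum gauss_step_choice_measurable assms) auto

lemma controlled_walk_grid:
  assumes \<kappa>: "grid_choices P n \<kappa>" and P: "finite P" "P \<noteq> {}"
  shows "controlled_walk M P (gauss_law n) n (\<lambda>i. F (real i / n)) (grid_walk n \<kappa>) \<kappa> (gauss_step n)"
proof -
  note n = grid_choicesD(1)[OF \<kappa>]
  interpret control_family P "gauss_law n"
    by (rule consistent_control_family[OF consistent_gauss_law[OF P] n])
  show ?thesis
  proof unfold_locales
    fix i assume "i < n"
    show "grid_walk n \<kappa> i \<in> borel_measurable (F (real i / n))"
      by (rule grid_walk_measurable[OF n]) (rule grid_choicesD(4)[OF \<kappa>], use \<open>i < n\<close> in simp)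
    show "\<kappa> i \<in> measurable (F (real i / n)) (count_space P)" by (rule grid_choicesD(2)[OF \<kappa> \<open>i < n\<close>])
  qed (auto intro: subalgebra_F gauss_step_indep[OF n] gauss_step_law[OF n] simp: grid_walk_def)
qed

text \<open>Backward selectors and forward recursion as for the arms; Brownian grid increments
  replace the payoffs.\<close>

lemma exists_optimal_grid:
  assumes P: "finite P" "P \<noteq> {}" and "0 < n" and u: "bounded_lipschitz C L u"
  shows "\<exists>\<kappa>. grid_choices P n \<kappa> \<and> expectation (\<lambda>\<omega>. u (grid_walk n \<kappa> n \<omega>)) = (bellman P (gauss_law n) ^^ n) u 0"
proof -
  interpret A: control_family P "gauss_law n"
    by (rule consistent_control_family[OF consistent_gauss_law[OF P] \<open>0 < n\<close>])
  define f where "f j = (bellman P (gauss_law n) ^^ j) u" for j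
  have "\<forall>j. \<exists>sel. sel \<in> measurable borel (count_space P) \<and>
      (\<forall>s. average (gauss_law n (sel s)) (f j) s = f (Suc j) s)"
    using A.bellman_selector[OF A.bounded_lipschitz_bellman_funpow[OF u]] unfolding f_def funpow.simps comp_def by blast
  from choice[OF this] obtain sel where sel: "\<And>j. sel j \<in> measurable borel (count_space P)"
    "\<And>j s. average (gauss_law n (sel j s)) (f j) s = f (Suc j) s" by blast
  define S where "S = rec_nat (\<lambda>_. 0) (\<lambda>i S \<omega>. S \<omega> + gauss_step n i (sel (n - Suc i) (S \<omega>)) \<omega>)"
  have S_0: "S 0 \<omega> = 0" and S_Suc: "S (Suc i) \<omega> = S i \<omega> + gauss_step n i (sel (n - Suc i) (S i \<omega>)) \<omega>" for i \<omega>
    unfolding S_def by simp_all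
  define \<kappa> where "\<kappa> i \<omega> = sel (n - Suc i) (S i \<omega>)" for i \<omega>
  have S: "S i = grid_walk n \<kappa> i" for i
  proof (rule ext)
    show "S i \<omega> = grid_walk n \<kappa> i \<omega>" for \<omega>
    proof (induction i)
      case 0
      show ?case by (simp add: grid_walk_def S_0)
    next
      case (Suc i)
      then show ?case unfolding S_Suc by (simp add: grid_walk_def \<kappa>_def)
    qed
  qed
  \<comment> \<open>Strong induction, because the position after \<open>i\<close> steps involves the
    choices of all earlier steps and these depend on all earlier positions.\<close>
  have SM: "S i \<in> borel_measurable (F (real i / n))" for i
  proof (induction i rule: less_induct)
    case (less i)
    show ?case
      unfolding S
    proof (rule grid_walk_measurable[OF \<open>0 < n\<close>])
      fix j assume "j < i"
      have "\<kappa> j \<in> measurable (F (real j / n)) (count_space P)"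
        unfolding \<kappa>_def[abs_def] by (rule measurable_compose[OF less[OF \<open>j < i\<close>] sel(1)])
      from measurable_compose[OF this, of "\<lambda>x. x" borel]
      show "\<kappa> j \<in> borel_measurable (F (real j / n))" by simp
    qed
  qed
  have \<kappa>: "grid_choices P n \<kappa>"
    unfolding grid_choices_def \<kappa>_def[abs_def] using \<open>0 < n\<close> measurable_compose[OF SM sel(1)] by blast
  have "expectation (\<lambda>\<omega>. u (grid_walk n \<kappa> n \<omega>)) = (bellman P (gauss_law n) ^^ n) u 0"
  proof (rule controlled_walk.expectation_eq_bellman[OF controlled_walk_grid[OF \<kappa> P] u])
    fix i \<omega> assume "i < n"
    then have "n - i = Suc (n - Suc i)" by simp
    then show "average (gauss_law n (\<kappa> i \<omega>)) ((bellman P (gauss_law n) ^^ (n - Suc i)) u) (grid_walk n \<kappa> i \<omega>)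
        = (bellman P (gauss_law n) ^^ (n - i)) u (grid_walk n \<kappa> i \<omega>)"
      using sel(2)[of "n - Suc i" "S i \<omega>"] unfolding f_def by (simp add: \<kappa>_def S[symmetric])
  qed
  then show ?thesis using \<kappa> by blast
qed

text \<open>Wherever the replacement differs from the control, the current value and the chosen one
  together have lag error at least 1. Integrating over time bounds the disagreement by the sum of
  the lag errors, separately for each path.\<close>

lemma exists_lagged_choices:
  assumes a: "a \<in> controls M F P 0 1" and P: "finite P" "P \<noteq> {}" and "0 < n"
  shows "\<exists>\<kappa>. grid_choices P n \<kappa> \<and> (\<forall>\<omega>\<in>space M. disagreement (grid_control n \<kappa>) a \<omega>
    \<le> (\<Sum>p\<in>P. lag_error n {s. a (clamp_time 1 s) \<omega> = p}))"
proof -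
  define A where "A p \<omega> = {s. a (clamp_time 1 s) \<omega> = p}" for p \<omega>
  define h where "h i p \<omega> = measure lborel (A p \<omega> \<inter> previous_slot n i)" for i p \<omega>
  have sec: "A p \<omega> \<in> sets borel" if "\<omega> \<in> space M" for p \<omega>
    using measurable_sets[OF control_section_measurable[OF a that], of "{p}"] unfolding A_def by (simp add: vimage_def)
  have h: "h i p \<in> borel_measurable (F (real i / n))" if "i < n" for i p
  proof -
    let ?t = "real i / n"
    have t: "?t \<in> {0..1}" using that by (auto simp: divide_le_eq_1)
    define g where "g = (\<lambda>(\<omega>, s). a (clamp_time ?t s) \<omega>)"
    have g: "g \<in> borel_measurable (F ?t \<Otimes>\<^sub>M borel)"
      unfolding g_def by (rule control_clamp_measurable[OF a t])
    \<comment> \<open>The set whose sections are the occupied parts of the preceding slot. Working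
      over \<open>F ?t\<close> makes the measure of a section observable at the start of the
      slot.\<close>
    define Q where "Q = {x \<in> space (F ?t \<Otimes>\<^sub>M lborel). g x = p \<and> snd x \<in> previous_slot n i}"
    have "Q \<in> sets (F ?t \<Otimes>\<^sub>M lborel)"
    proof -
      have g': "g \<in> borel_measurable (F ?t \<Otimes>\<^sub>M lborel)" using g by (simp cong: measurable_cong_sets)
      have "{x \<in> space (F ?t \<Otimes>\<^sub>M lborel). g x = p} \<in> sets (F ?t \<Otimes>\<^sub>M lborel)"
        using measurable_sets[OF g', of "{p}"] by (simp add: vimage_def Int_def conj_commute)
      moreover have "{x \<in> space (F ?t \<Otimes>\<^sub>M lborel). snd x \<in> previous_slot n i} \<in> sets (F ?t \<Otimes>\<^sub>M lborel)"
        by measurable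
      ultimately have "{x \<in> space (F ?t \<Otimes>\<^sub>M lborel). g x = p} \<inter> {x \<in> space (F ?t \<Otimes>\<^sub>M lborel). snd x \<in> previous_slot n i}
          \<in> sets (F ?t \<Otimes>\<^sub>M lborel)" by (rule sets.Int)
      moreover have "{x \<in> space (F ?t \<Otimes>\<^sub>M lborel). g x = p} \<inter> {x \<in> space (F ?t \<Otimes>\<^sub>M lborel). snd x \<in> previous_slot n i} = Q"
        unfolding Q_def by blast
      ultimately show ?thesis by simp
    qed
    from lborel.measurable_emeasure_Pair[OF this]
    have m: "(\<lambda>\<omega>. enn2real (emeasure lborel (Pair \<omega> -` Q))) \<in> borel_measurable (F ?t)"
      by (rule measurable_compose) measurable
    have "h i p \<in> borel_measurable (F ?t) \<longleftrightarrow> (\<lambda>\<omega>. enn2real (emeasure lborel (Pair \<omega> -` Q))) \<in> borel_measurable (F ?t)"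
    proof (rule measurable_cong)
      fix \<omega> assume "\<omega> \<in> space (F ?t)"
      then have "Pair \<omega> -` Q = {s. a (clamp_time ?t s) \<omega> = p} \<inter> previous_slot n i"
        unfolding Q_def g_def by (auto simp: space_pair_measure)
      also have "\<dots> = A p \<omega> \<inter> previous_slot n i"
      proof -
        \<comment> \<open>The preceding slot ends at \<open>?t\<close>, so clamping there instead of
          at 1 changes nothing; this is where the lag gives adaptedness.\<close>
        have "clamp_time ?t s = clamp_time 1 s" if "s \<in> previous_slot n i" for s
          using that t unfolding previous_slot_def clamp_time_def by auto
        then show ?thesis unfolding A_def by auto
      qed
      finally show "h i p \<omega> = enn2real (emeasure lborel (Pair \<omega> -` Q))"
        unfolding h_def measure_def by simp
    qed
    then show ?thesis using m by simp
  qed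
  have "\<forall>i. \<exists>sel. i < n \<longrightarrow> sel \<in> measurable (F (real i / n)) (count_space P) \<and>
      (\<forall>\<omega>\<in>space M. \<forall>p\<in>P. h i p \<omega> \<le> h i (sel \<omega>) \<omega>)"
    using argmax_measurable[OF P, where h="h _"] h by (metis space_natural_filtration)
  from choice[OF this] obtain \<kappa> where \<kappa>: "\<And>i. i < n \<Longrightarrow> \<kappa> i \<in> measurable (F (real i / n)) (count_space P)"
    "\<And>i \<omega> p. i < n \<Longrightarrow> \<omega> \<in> space M \<Longrightarrow> p \<in> P \<Longrightarrow> h i p \<omega> \<le> h i (\<kappa> i \<omega>) \<omega>" by blast
  have gc: "grid_choices P n \<kappa>" unfolding grid_choices_def using \<open>0 < n\<close> \<kappa>(1) by blast
  note g = grid_control_in_controls[OF gc]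
  have "disagreement (grid_control n \<kappa>) a \<omega> \<le> (\<Sum>p\<in>P. lag_error n (A p \<omega>))" if \<omega>: "\<omega> \<in> space M" for \<omega>
  proof -
    note int = lag_error_integrable(1)[OF sec[OF \<omega>] \<open>0 < n\<close>]
    have "disagreement (grid_control n \<kappa>) a \<omega>
        \<le> (\<integral>s. (\<Sum>p\<in>P. \<bar>lagged_average n (A p \<omega>) s - indicator (A p \<omega>) s\<bar>) \<partial>unit_time)"
      unfolding disagreement_def
    proof (rule integral_mono_AE[OF disagree_section_integrable[OF g a \<omega>]])
      show "AE s in unit_time. (if grid_control n \<kappa> (clamp_time 1 s) \<omega> = a (clamp_time 1 s) \<omega> then 0 else 1)
          \<le> (\<Sum>p\<in>P. \<bar>lagged_average n (A p \<omega>) s - indicator (A p \<omega>) s\<bar>)"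
        using AE_unit_time
      proof eventually_elim
        case (elim s)
        then obtain i where i: "i < n" "s \<in> slot n i" using slot_index[OF \<open>0 < n\<close>] by blast
        have c: "clamp_time 1 s = s" using elim by simp
        let ?q = "a s \<omega>" and ?k = "\<kappa> i \<omega>"
        let ?t = "\<lambda>p. \<bar>lagged_average n (A p \<omega>) s - indicator (A p \<omega>) s\<bar>"
        have gs: "grid_control n \<kappa> s \<omega> = ?k" by (rule grid_control_slot[OF \<open>0 < n\<close> i(2)])
        show ?case
        proof (cases "?k = ?q")
          case True
          then show ?thesis unfolding c gs by (simp add: sum_nonneg)
        next
          case False
          have q: "?q \<in> P" using a \<omega> elim unfolding controls_def by auto
          have k: "?k \<in> P" by (rule grid_choicesD(3)[OF gc i(1) \<omega>])
          have "lagged_average n (A ?q \<omega>) s \<le> lagged_average n (A ?k \<omega>) s"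
            unfolding lagged_average_slot[OF i(2,1)]
            using \<kappa>(2)[OF i(1) \<omega> q] unfolding h_def by (intro mult_left_mono) auto
          moreover have "indicator (A ?q \<omega>) s = (1::real)" "indicator (A ?k \<omega>) s = (0::real)"
            unfolding A_def c using False by (auto simp: indicator_def c)
          \<comment> \<open>The indicators are 1 and 0, while the fraction of \<open>?q\<close> is
            at most that of \<open>?k\<close>; the two gaps therefore add up to at least 1.\<close>
          ultimately have "1 \<le> ?t ?q + ?t ?k" by linarith
          also have "\<dots> = (\<Sum>p\<in>{?q, ?k}. ?t p)" using False by simp
          also have "\<dots> \<le> (\<Sum>p\<in>P. ?t p)" by (rule sum_mono2) (use P(1) q k in auto)
          finally show ?thesis unfolding c gs using False by simp
        qed
      qed
    qed (use int in auto)
    also have "\<dots> = (\<Sum>p\<in>P. lag_error n (A p \<omega>))"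
      unfolding lag_error_def by (rule Bochner_Integration.integral_sum) (rule int)
    finally show ?thesis .
  qed
  then show ?thesis using gc unfolding A_def by blast
qed

text \<open>The lag errors vanish along every path, and the disagreement never exceeds 1, so
  dominated convergence applies.\<close>

lemma exists_approximating_grid:
  assumes a: "a \<in> controls M F P 0 1" and P: "finite P" "P \<noteq> {}"
  shows "\<exists>\<kappa>. (\<forall>n>0. grid_choices P n (\<kappa> n)) \<and> (\<lambda>n. expectation (disagreement (grid_control n (\<kappa> n)) a)) \<longlonglongrightarrow> 0"
proof -
  have "\<forall>n. \<exists>\<kappa>. 0 < n \<longrightarrow> grid_choices P n \<kappa> \<and> (\<forall>\<omega>\<in>space M. disagreement (grid_control n \<kappa>) a \<omega>
      \<le> (\<Sum>p\<in>P. lag_error n {s. a (clamp_time 1 s) \<omega> = p}))"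
  proof
    fix n :: nat
    show "\<exists>\<kappa>. 0 < n \<longrightarrow> grid_choices P n \<kappa> \<and> (\<forall>\<omega>\<in>space M. disagreement (grid_control n \<kappa>) a \<omega>
      \<le> (\<Sum>p\<in>P. lag_error n {s. a (clamp_time 1 s) \<omega> = p}))"
      using exists_lagged_choices[OF a P, of n] by (cases "0 < n") auto
  qed
  from choice[OF this] obtain \<kappa> where \<kappa>: "\<And>n. 0 < n \<Longrightarrow> grid_choices P n (\<kappa> n)"
    "\<And>n \<omega>. 0 < n \<Longrightarrow> \<omega> \<in> space M \<Longrightarrow> disagreement (grid_control n (\<kappa> n)) a \<omega>
      \<le> (\<Sum>p\<in>P. lag_error n {s. a (clamp_time 1 s) \<omega> = p})" by blast
  note g = grid_control_in_controls[OF \<kappa>(1)]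
  \<comment> \<open>Shifted by one, since there is no grid with 0 slots.\<close>
  have "(\<lambda>n. expectation (disagreement (grid_control (Suc n) (\<kappa> (Suc n))) a)) \<longlonglongrightarrow> expectation (\<lambda>_. 0)"
  proof (rule integral_dominated_convergence[where w="\<lambda>_. 1"])
    show "disagreement (grid_control (Suc n) (\<kappa> (Suc n))) a \<in> borel_measurable M" for n
      by (rule disagreement_measurable[OF g a]) simp
    show "AE \<omega> in M. norm (disagreement (grid_control (Suc n) (\<kappa> (Suc n))) a \<omega>) \<le> 1" for n
    proof (rule AE_I2)
      fix \<omega> assume "\<omega> \<in> space M"
      from disagreement_bounds[OF g[OF zero_less_Suc] a this, of n]
      show "norm (disagreement (grid_control (Suc n) (\<kappa> (Suc n))) a \<omega>) \<le> 1" by simp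
    qed
    show "AE \<omega> in M. (\<lambda>n. disagreement (grid_control (Suc n) (\<kappa> (Suc n))) a \<omega>) \<longlonglongrightarrow> 0"
    proof (rule AE_I2)
      fix \<omega> assume \<omega>: "\<omega> \<in> space M"
      have "{s. a (clamp_time 1 s) \<omega> = p} \<in> sets borel" for p
        using measurable_sets[OF control_section_measurable[OF a \<omega>], of "{p}"] by (simp add: vimage_def)
      then have "(\<lambda>n. \<Sum>p\<in>P. lag_error (Suc n) {s. a (clamp_time 1 s) \<omega> = p}) \<longlonglongrightarrow> (\<Sum>p\<in>P. 0)"
        by (intro tendsto_sum LIMSEQ_Suc lag_error_tendsto)
      then have lim: "(\<lambda>n. \<Sum>p\<in>P. lag_error (Suc n) {s. a (clamp_time 1 s) \<omega> = p}) \<longlonglongrightarrow> 0" by simp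
      show "(\<lambda>n. disagreement (grid_control (Suc n) (\<kappa> (Suc n))) a \<omega>) \<longlonglongrightarrow> 0"
      proof (rule tendsto_sandwich[OF _ _ tendsto_const lim])
        show "\<forall>\<^sub>F n in sequentially. 0 \<le> disagreement (grid_control (Suc n) (\<kappa> (Suc n))) a \<omega>"
          by (rule always_eventually, rule allI, rule disagreement_bounds(1)[OF g a \<omega>]) simp
        show "\<forall>\<^sub>F n in sequentially. disagreement (grid_control (Suc n) (\<kappa> (Suc n))) a \<omega>
            \<le> (\<Sum>p\<in>P. lag_error (Suc n) {s. a (clamp_time 1 s) \<omega> = p})"
          by (rule always_eventually, rule allI, rule \<kappa>(2)[OF _ \<omega>]) simp
      qed
    qed
  qed simp_all
  then have "(\<lambda>n. expectation (disagreement (grid_control (Suc n) (\<kappa> (Suc n))) a)) \<longlonglongrightarrow> 0" by simp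
  then have "(\<lambda>n. expectation (disagreement (grid_control n (\<kappa> n)) a)) \<longlonglongrightarrow> 0"
    by (rule LIMSEQ_imp_Suc)
  then show ?thesis using \<kappa>(1) by blast
qed

text \<open>The approximating grid controls serve twice: their simple processes prove that the Ito
  integral of \<open>a\<close> exists, and their utilities, bounded by dynamic programming, converge
  to that of \<open>a\<close>.\<close>

lemma control_utility_le_bellman:
  assumes a: "a \<in> controls M F P 0 1" and P: "finite P" "P \<noteq> {}"
    and u: "bounded_lipschitz C L u" "0 \<le> L" and "0 < e"
  shows "\<forall>\<^sub>F n in sequentially. control_utility M B u a \<le> (bellman P (gauss_law n) ^^ n) u 0 + e"
proof -
  obtain D where D: "0 \<le> D" "\<And>p q. p \<in> P \<Longrightarrow> q \<in> P \<Longrightarrow> \<bar>fst p - fst q\<bar> \<le> D"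
    "\<And>p q. p \<in> P \<Longrightarrow> q \<in> P \<Longrightarrow> \<bar>snd p - snd q\<bar> \<le> D"
    using finite_spread[OF \<open>finite P\<close>] by blast
  obtain \<kappa> where \<kappa>: "\<And>n. 0 < n \<Longrightarrow> grid_choices P n (\<kappa> n)"
    and lim: "(\<lambda>n. expectation (disagreement (grid_control n (\<kappa> n)) a)) \<longlonglongrightarrow> 0"
    using exists_approximating_grid[OF a P] by blast
  define \<delta> where "\<delta> n = expectation (disagreement (grid_control n (\<kappa> n)) a)" for n
  have \<delta>: "\<delta> \<longlonglongrightarrow> 0" using lim unfolding \<delta>_def[abs_def] .
  have ex: "\<exists>I. has_ito_integral M F W 0 1 (\<lambda>s \<omega>. snd (a s \<omega>)) I"
  proof (rule has_ito_integral_exists[OF control_jointly_measurable[OF a]])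
    show "simple_integrand M F 0 1 (Suc j) (\<lambda>i. real i / Suc j) (\<lambda>i \<omega>. snd (\<kappa> (Suc j) i \<omega>))" for j :: nat
      by (rule grid_simple_integrand[OF \<kappa> P(1)]) simp
    have "(\<lambda>j. ennreal (D\<^sup>2 * \<delta> (Suc j))) \<longlonglongrightarrow> ennreal (D\<^sup>2 * 0)"
      by (intro tendsto_ennrealI tendsto_mult tendsto_const LIMSEQ_Suc \<delta>)
    then have 0: "(\<lambda>j. ennreal (D\<^sup>2 * \<delta> (Suc j))) \<longlonglongrightarrow> 0" by simp
    show "(\<lambda>j. sq_dist (simple_process (Suc j) (\<lambda>i. real i / Suc j) (\<lambda>i \<omega>. snd (\<kappa> (Suc j) i \<omega>)))
        (\<lambda>s \<omega>. snd (a s \<omega>))) \<longlonglongrightarrow> 0"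
    proof (rule tendsto_sandwich[OF _ _ tendsto_const 0])
      show "\<forall>\<^sub>F j in sequentially. sq_dist (simple_process (Suc j) (\<lambda>i. real i / Suc j) (\<lambda>i \<omega>. snd (\<kappa> (Suc j) i \<omega>)))
          (\<lambda>s \<omega>. snd (a s \<omega>)) \<le> ennreal (D\<^sup>2 * \<delta> (Suc j))"
        unfolding \<delta>_def
        by (rule always_eventually, rule allI,
            rule grid_sq_dist_le[OF \<kappa> a D(3), unfolded grid_process_def]) simp_all
    qed simp
  qed
  \<comment> \<open>The factor 2 makes \<open>L * \<epsilon> < e\<close> strict, which leaves room
    for the terms that vanish with \<open>\<delta> n\<close>.\<close>
  define \<epsilon> where "\<epsilon> = e / (2 * (L + 1))"
  have \<epsilon>: "0 < \<epsilon>" "L * \<epsilon> < e" 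
  proof -
    have "0 \<le> L * e" using \<open>0 \<le> L\<close> \<open>0 < e\<close> by simp
    then have "L * e < e * (2 * (L + 1))" using \<open>0 < e\<close> by (simp add: algebra_simps)
    then show "L * \<epsilon> < e" unfolding \<epsilon>_def using \<open>0 \<le> L\<close> by (simp add: pos_divide_less_eq)
    show "0 < \<epsilon>" unfolding \<epsilon>_def using \<open>0 \<le> L\<close> \<open>0 < e\<close> by simp
  qed
  have "(\<lambda>n. L * (D * \<delta> n + \<epsilon> + 4 * D\<^sup>2 * \<delta> n / \<epsilon>)) \<longlonglongrightarrow> L * (D * 0 + \<epsilon> + 4 * D\<^sup>2 * 0 / \<epsilon>)"
    by (intro tendsto_intros \<delta>) (use \<epsilon> in simp)
  then have "\<forall>\<^sub>F n in sequentially. L * (D * \<delta> n + \<epsilon> + 4 * D\<^sup>2 * \<delta> n / \<epsilon>) < e"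
    by (rule order_tendstoD) (use \<epsilon> in simp)
  then show ?thesis
    using eventually_gt_at_top[of 0]
  proof eventually_elim
    case (elim n)
    have "\<bar>expectation (\<lambda>\<omega>. u (grid_walk n (\<kappa> n) n \<omega>)) - control_utility M B u a\<bar>
        \<le> L * (D * \<delta> n + \<epsilon> + 4 * D\<^sup>2 * \<delta> n / \<epsilon>)"
      unfolding \<delta>_def by (rule control_utility_close[OF \<kappa>[OF elim(2)] a P(1) D(2,3) u ex \<epsilon>(1)])
    moreover have "expectation (\<lambda>\<omega>. u (grid_walk n (\<kappa> n) n \<omega>)) \<le> (bellman P (gauss_law n) ^^ n) u 0"
      by (rule controlled_walk.expectation_le_bellman[OF controlled_walk_grid[OF \<kappa>[OF elim(2)] P] u(1)])
    ultimately show ?case using elim(1) by linarith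
  qed
qed

lemma bellman_attained_by_control:
  assumes P: "finite P" "P \<noteq> {}" and "0 < n" and u: "bounded_lipschitz C L u" "0 \<le> L"
  shows "\<exists>a\<in>controls M F P 0 1. control_utility M B u a = (bellman P (gauss_law n) ^^ n) u 0"
proof -
  obtain \<kappa> where \<kappa>: "grid_choices P n \<kappa>"
    "expectation (\<lambda>\<omega>. u (grid_walk n \<kappa> n \<omega>)) = (bellman P (gauss_law n) ^^ n) u 0"
    using exists_optimal_grid[OF P \<open>0 < n\<close> u(1)] by blast
  show ?thesis
    using grid_control_in_controls[OF \<kappa>(1)] grid_control_utility[OF \<kappa>(1) P(1) u] \<kappa>(2) by metis
qed

text \<open>Valid for arbitrary \<open>a\<close>: without integrability the expectation is 0 by
  convention, which also lies between \<open>- C\<close> and \<open>C\<close>. It provides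
  boundedness of the utilities for the suprema.\<close>

lemma control_utility_bounded:
  assumes u: "\<And>x. \<bar>u x\<bar> \<le> C"
  shows "\<bar>control_utility M B u a\<bar> \<le> C"
proof -
  have C: "0 \<le> C" using u[of undefined] by linarith
  show ?thesis
    unfolding control_utility_def
  proof (cases "integrable M (\<lambda>\<omega>. u (LINT s:{0..1}|lborel. fst (a s \<omega>),
      ito_integral M F (\<lambda>s \<omega>. snd (B s \<omega>)) 0 1 (\<lambda>s \<omega>. snd (a s \<omega>)) \<omega>))")
    case True
    let ?v = "\<lambda>\<omega>. u (LINT s:{0..1}|lborel. fst (a s \<omega>),
      ito_integral M F (\<lambda>s \<omega>. snd (B s \<omega>)) 0 1 (\<lambda>s \<omega>. snd (a s \<omega>)) \<omega>)"
    have "\<bar>expectation ?v\<bar> \<le> expectation (\<lambda>\<omega>. \<bar>?v \<omega>\<bar>)" by (rule integral_abs_bound)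
    also have "\<dots> \<le> expectation (\<lambda>_. C)"
      by (rule integral_mono) (use True u in auto)
    finally show "\<bar>expectation ?v\<bar> \<le> C" by (simp add: prob_space)
  qed (simp add: not_integrable_integral_eq C)
qed

end

section \<open>Convergence of the values\<close>

lemma sd_pairs_finite:
  assumes "finite A"
  shows "finite (sd_pairs A)"
proof -
  have "sd_pairs A \<subseteq> (\<lambda>(m, v). (m, sqrt v)) ` A"
    unfolding sd_pairs_def by (force simp: image_iff)
  then show ?thesis using assms finite_surj by blast
qed

text \<open>Nonnegative second coordinates have square roots, so passing to standard deviations
  loses no pair; for variances this hypothesis always holds.\<close>

lemma square_image_sd_pairs:
  assumes "\<And>p. p \<in> A \<Longrightarrow> 0 \<le> snd p"
  shows "(\<lambda>p. (fst p, (snd p)\<^sup>2)) ` sd_pairs A = A"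
proof
  show "A \<subseteq> (\<lambda>p. (fst p, (snd p)\<^sup>2)) ` sd_pairs A"
  proof
    fix p assume p: "p \<in> A"
    then have "(fst p, sqrt (snd p)) \<in> sd_pairs A" "(fst p, (sqrt (snd p))\<^sup>2) = p"
      using assms[OF p] unfolding sd_pairs_def by auto
    then show "p \<in> (\<lambda>p. (fst p, (snd p)\<^sup>2)) ` sd_pairs A" by force
  qed
qed (auto simp: sd_pairs_def)

lemma ext_hull_subset: "ext_hull A \<subseteq> A"
  unfolding ext_hull_def using extreme_point_of_convex_hull by blast

lemma convex_hull_ext_hull: "finite A \<Longrightarrow> convex hull (ext_hull A) = convex hull A"
  unfolding ext_hull_def
  using Krein_Milman_Minkowski[of "convex hull A"] by (simp add: finite_imp_compact_convex_hull)

theorem proposition6: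
  fixes M :: "'w measure"
    and K :: nat
    and X :: "nat \<Rightarrow> 'w \<Rightarrow> real"
    and Xs :: "nat \<Rightarrow> nat \<Rightarrow> 'w \<Rightarrow> real"
    and B :: "real \<Rightarrow> 'w \<Rightarrow> real \<times> real"
    and u :: "real \<times> real \<Rightarrow> real"
  assumes "prob_space M"
    and "K \<ge> 1"
    and finite_mean: "\<And>k. k \<in> {1..K} \<Longrightarrow> integrable M (X k)"
    and finite_variance:
      "\<And>k. k \<in> {1..K} \<Longrightarrow> integrable M (\<lambda>\<omega>. (X k \<omega> - prob_space.expectation M (X k))\<^sup>2)"
    and copies: "\<And>k n. k \<in> {1..K} \<Longrightarrow> n \<ge> 1 \<Longrightarrow> distr M borel (Xs k n) = distr M borel (X k)"
    and indep: "prob_space.indep_vars M (\<lambda>_. borel) (\<lambda>(k, n). Xs k n) ({1..K} \<times> {1..})"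
    and brownian: "brownian_motion_2d M B"
    and bounded: "bounded (range u)"
    and lipschitz: "\<exists>L. L-lipschitz_on UNIV u"
  shows "\<exists>V. (\<lambda>n. horizon_value M K Xs u n) \<longlonglongrightarrow> V \<and>
    V = (SUP a\<in>controls M (natural_filtration M B) (sd_pairs (mv_pairs M K X)) 0 1.
           control_utility M B u a) \<and>
    V = (SUP a\<in>controls M (natural_filtration M B) (sd_pairs (ext_hull (mv_pairs M K X))) 0 1.
           control_utility M B u a)"
proof -
  interpret prob_space M by fact
  interpret bandit M K X Xs
    by unfold_locales (fact assms)+
  interpret brownian M B
    by unfold_locales (fact brownian)
  obtain C where C: "\<And>x. \<bar>u x\<bar> \<le> C" using bounded unfolding bounded_iff by auto
  obtain L where L: "L-lipschitz_on UNIV u" using lipschitz by blast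
  have "0 \<le> L" using L by (rule lipschitz_on_nonneg)
  have u: "bounded_lipschitz C L u"
    unfolding bounded_lipschitz_def using C lipschitz_onD[OF L] by (simp add: dist_norm)
  let ?A = "mv_pairs M K X"
  let ?E = "ext_hull ?A"
  let ?P = "sd_pairs ?A" and ?Q = "sd_pairs ?E"
  have A: "finite ?A" "?A \<noteq> {}" "\<And>p. p \<in> ?A \<Longrightarrow> 0 \<le> snd p"
    using K unfolding mv_pairs_def mean_variance_def by auto
  have E: "finite ?E" "?E \<noteq> {}" "\<And>p. p \<in> ?E \<Longrightarrow> 0 \<le> snd p"
  proof -
    show "finite ?E" by (rule finite_subset[OF ext_hull_subset A(1)])
    show "?E \<noteq> {}" 
    proof
      assume "?E = {}"
      then have "convex hull ?A = {}" using convex_hull_ext_hull[OF A(1)] by simp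
      then show False using hull_subset[of ?A convex] A(2) by blast
    qed
    show "0 \<le> snd p" if "p \<in> ?E" for p by (rule A(3)[OF subsetD[OF ext_hull_subset that]])
  qed
  let ?m = "\<lambda>p::real \<times> real. (fst p, (snd p)\<^sup>2)"
  have imP: "?m ` ?P = ?A" by (rule square_image_sd_pairs) (rule A(3))
  have imQ: "?m ` ?Q = ?E" by (rule square_image_sd_pairs) (rule E(3))
  have P: "finite ?P" "?P \<noteq> {}" using sd_pairs_finite[OF A(1)] imP A(2) by auto
  have Q: "finite ?Q" "?Q \<noteq> {}" using sd_pairs_finite[OF E(1)] imQ E(2) by auto
  have imX: "(\<lambda>k. mean_variance M (X k)) ` {1..K} = ?A" unfolding mv_pairs_def ..
  have hull1: "?A \<subseteq> convex hull ?E" unfolding convex_hull_ext_hull[OF A(1)] by (rule hull_subset)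
  have hull2: "?E \<subseteq> convex hull ?A" by (rule order_trans[OF ext_hull_subset hull_subset])
  have h13: "(\<lambda>k. mean_variance M (X k)) ` {1..K} \<subseteq> convex hull (?m ` ?Q)"
    unfolding imX imQ by (rule hull1)
  have h23: "?m ` ?P \<subseteq> convex hull (?m ` ?Q)"
    unfolding imP imQ by (rule hull1)
  have h31: "?m ` ?Q \<subseteq> convex hull ((\<lambda>k. mean_variance M (X k)) ` {1..K})"
    unfolding imX imQ by (rule hull2)
  \<comment> \<open>\<open>v1\<close> belongs to the arms, \<open>v2\<close> to Gaussian steps for
    all pairs, \<open>v3\<close> to Gaussian steps for the extreme pairs. The extreme problem is the
    smallest, so the others are compared with it.\<close>
  define v1 where "v1 n = (bellman {1..K} (arm_law n) ^^ n) u 0" for n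
  define v2 where "v2 n = (bellman ?P (gauss_law n) ^^ n) u 0" for n
  define v3 where "v3 n = (bellman ?Q (gauss_law n) ^^ n) u 0" for n
  have c13: "\<forall>\<^sub>F n in sequentially. v1 n \<le> v3 n + e" if "0 < e" for e
    unfolding v1_def v3_def
    by (rule bellman_comparison[OF consistent_arm_law consistent_gauss_law[OF Q] h13 u \<open>0 \<le> L\<close> that])
  have c23: "\<forall>\<^sub>F n in sequentially. v2 n \<le> v3 n + e" if "0 < e" for e
    unfolding v2_def v3_def
    by (rule bellman_comparison[OF consistent_gauss_law[OF P] consistent_gauss_law[OF Q] h23 u \<open>0 \<le> L\<close> that])
  have c31: "\<forall>\<^sub>F n in sequentially. v3 n \<le> v1 n + e" if "0 < e" for e
    unfolding v1_def v3_def
    by (rule bellman_comparison[OF consistent_gauss_law[OF Q] consistent_arm_law h31 u \<open>0 \<le> L\<close> that])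
  let ?CP = "controls M F ?P 0 1" and ?CQ = "controls M F ?Q 0 1"
  let ?U = "control_utility M B u"
  have CQP: "?CQ \<subseteq> ?CP"
  proof -
    have "?Q \<subseteq> ?P" using ext_hull_subset[of ?A] unfolding sd_pairs_def by auto
    then show ?thesis unfolding controls_def by blast
  qed
  have bdd: "bdd_above (?U ` S)" for S
  proof (rule bdd_aboveI)
    fix x assume "x \<in> ?U ` S"
    then obtain a where "x = ?U a" by blast
    then show "x \<le> C" using control_utility_bounded[of u C a, OF C] by simp
  qed
  have ne: "?CQ \<noteq> {}" using bellman_attained_by_control[OF Q zero_less_one u \<open>0 \<le> L\<close>] by blast
  define VP where "VP = (SUP a\<in>?CP. ?U a)"
  define VQ where "VQ = (SUP a\<in>?CQ. ?U a)"
  have QP: "VQ \<le> VP" unfolding VQ_def VP_def by (rule cSUP_subset_mono[OF ne bdd CQP]) simp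
  \<comment> \<open>This holds for every positive \<open>n\<close> without error, because the
    Gaussian value is the utility of an actual control with extreme values.\<close>
  have v3_le: "v3 n \<le> VQ" if n: "0 < n" for n
  proof -
    obtain a where a: "a \<in> ?CQ" "?U a = v3 n"
      using bellman_attained_by_control[OF Q n u \<open>0 \<le> L\<close>] unfolding v3_def by blast
    show ?thesis unfolding VQ_def a(2)[symmetric] by (rule cSUP_upper[OF a(1) bdd])
  qed
  \<comment> \<open>Three thirds of \<open>e\<close>: for a nearly optimal control, for its
    approximation on grids, and for passing from all pairs to the extreme ones.\<close>
  have v3_ge: "\<forall>\<^sub>F n in sequentially. VP - e < v3 n" if "0 < e" for e
  proof -
    have "?CP \<noteq> {}" using ne CQP by blast
    moreover have "VP - e / 3 < (SUP a\<in>?CP. ?U a)" unfolding VP_def using that by simp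
    ultimately have "\<exists>a\<in>?CP. VP - e / 3 < ?U a" using less_cSUP_iff[of ?CP ?U] bdd[of ?CP] by simp
    then obtain a where a: "a \<in> ?CP" "VP - e / 3 < ?U a" by (elim bexE)
    have "\<forall>\<^sub>F n in sequentially. ?U a \<le> v2 n + e / 3"
      unfolding v2_def by (rule control_utility_le_bellman[OF a(1) P u \<open>0 \<le> L\<close>]) (use that in simp)
    moreover have "\<forall>\<^sub>F n in sequentially. v2 n \<le> v3 n + e / 3" by (rule c23) (use that in simp)
    ultimately show ?thesis
    proof eventually_elim
      case (elim n)
      with a(2) show ?case by linarith
    qed
  qed
  \<comment> \<open>Both bounds on \<open>v3\<close> refer to the same sequence, which squeezes the
    larger supremum against the smaller one.\<close>
  have eq: "VP = VQ"
  proof (rule antisym[OF _ QP])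
    show "VP \<le> VQ"
    proof (rule field_le_epsilon)
      fix e :: real assume "0 < e"
      have "\<forall>\<^sub>F n in sequentially. VP \<le> VQ + e"
        using v3_ge[OF \<open>0 < e\<close>] eventually_gt_at_top[of 0]
      proof eventually_elim
        case (elim n)
        then show ?case using v3_le[of n] by linarith
      qed
      then show "VP \<le> VQ + e" by simp
    qed
  qed
  have "(\<lambda>n. horizon_value M K Xs u n) \<longlonglongrightarrow> VQ"
  proof (rule tendsto_cong[THEN iffD2])
    show "\<forall>\<^sub>F n in sequentially. horizon_value M K Xs u n = v1 n"
      using eventually_gt_at_top[of 0]
    proof eventually_elim
      case (elim n)
      show ?case unfolding v1_def by (rule horizon_value_eq_bellman[OF elim u])
    qed
    show "v1 \<longlonglongrightarrow> VQ"
    proof (rule order_tendstoI)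
      fix x assume x: "x < VQ"
      define e where "e = (VQ - x) / 2"
      have e: "0 < e" using x by (simp add: e_def)
      show "\<forall>\<^sub>F n in sequentially. x < v1 n"
        using v3_ge[OF e] c31[OF e]
      proof eventually_elim
        case (elim n)
        have "e + e = VQ - x" unfolding e_def by (rule field_sum_of_halves)
        with elim eq show ?case by linarith
      qed
    next
      fix x assume x: "VQ < x"
      define e where "e = (x - VQ) / 2"
      have e: "0 < e" using x by (simp add: e_def)
      show "\<forall>\<^sub>F n in sequentially. v1 n < x"
        using c13[OF e] eventually_gt_at_top[of 0]
      proof eventually_elim
        case (elim n)
        then have "v1 n \<le> VQ + e" using v3_le[of n] by linarith
        moreover have "e + e = x - VQ" unfolding e_def by (rule field_sum_of_halves)
        ultimately show ?case using e by linarith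
      qed
    qed
  qed
  moreover have "VQ = VP" using eq by (rule sym)
  ultimately show ?thesis
    unfolding VP_def[symmetric] VQ_def[symmetric] by (intro exI[of _ VQ] conjI refl)
qed

end
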